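(* Let $\mathfrak g=\mathfrak g_-\oplus\mathfrak g_0=\mathfrak g_{-k}\oplus\cdots\oplus\mathfrak g_0$ be a non-positively graded fundamental Lie algebra with a Euclidean metric $\langle\cdot,\cdot\rangle_{\mathfrak g}$ adapted to the gradation, and let $\langle\cdot,\cdot\rangle$ be the metric on $\mathfrak h=t^*(\mathfrak g)=\mathfrak g\oplus\mathfrak g^*$ which coincides with $\langle\cdot,\cdot\rangle_{\mathfrak g}$ on $\mathfrak g$, with the induced metric $\langle\cdot,\cdot\rangle_{\mathfrak g^*}$ on $\mathfrak g^*$, and for which $\mathfrak g$ is orthogonal to $\mathfrak g^*$. The metric $\langle\cdot,\cdot\rangle$ is admissible if and only if $$\theta([X+\xi,\theta([Y,Z+\alpha])])=[\theta([X,\theta(Y)]),Z+\alpha]+[Y,\theta([X+\xi,\theta(Z+\alpha)])]$$ for any $X+\xi\in\mathfrak g_0\oplus\mathfrak g^*$, $Y\in\mathfrak g_-$ and $Z+\alpha\in\mathfrak g\oplus\mathfrak g^*$, where $\theta:\mathfrak h\to\mathfrak h$ is defined by $\theta(X)=X^\sharp$, $\theta(\alpha)=\alpha^\flat$ ($X\in\mathfrak g$, $\alpha\in\mathfrak g^*$).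
   Context: Lie algebras are real and finite dimensional. Fundamental gradation of $\mathfrak g$: $[\mathfrak g_i,\mathfrak g_j]\subset\mathfrak g_{i+j}$ ($\mathfrak g_i=0$ for $i<-k$ or $i>0$), $k>0$, $\mathfrak g_-=\mathfrak g_{-k}\oplus\cdots\oplus\mathfrak g_{-1}$ is generated by $\mathfrak g_{-1}$, $\mathfrak g_0$ and $\mathfrak g_{-k}$ are non-trivial, and the adjoint action of $\mathfrak g_0$ on $\mathfrak g_{-1}$ is exact (faithful). A Euclidean metric is adapted to the gradation if different graded components are orthogonal. $X\mapsto X^\sharp=\langle X,\cdot\rangle_{\mathfrak g}$ is the Riemannian duality $\mathfrak g\to\mathfrak g^*$ and $\alpha\mapsto\alpha^\flat$ its inverse. For $X\in\mathfrak g$, $L_X(\alpha)(Y)=-\alpha([X,Y])$ is the coadjoint action on $\mathfrak g^*$. The cotangent Lie algebra is $\mathfrak h=t^*(\mathfrak g)=\mathfrak g\oplus\mathfrak g^*$ with bracket $[X+\xi,Y+\eta]=[X,Y]+L_X(\eta)-L_Y(\xi)$; its gradation is $\mathfrak h_i=\mathfrak g_i$ ($i<0$), $\mathfrak h_0=\mathfrak g_0\oplus(\mathfrak g_0)^*$, $\mathfrak h_i=(\mathfrak g_{-i})^*$ ($i>0$). So $\mathfrak h_-=\mathfrak g_-$ and $\mathfrak q:=\mathfrak h_0\oplus\mathfrak h_+=\mathfrak g_0\oplus\mathfrak g^*$. $H$ is a connected Lie group with Lie algebra $\mathfrak h$ and $Q$ its connected subgroup with Lie algebra $\mathfrak q$.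 Admissibility. $C^p(\mathfrak h_-,\mathfrak h)=\Lambda^p(\mathfrak h_-^* )\otimes\mathfrak h$, with Lie algebra differential $$(\partial\phi)(X_0,\dots,X_p)=\sum_i(-1)^i[X_i,\phi(\dots,\widehat{X_i},\dots)]+\sum_{i<j}(-1)^{i+j}\phi([X_i,X_j],\dots,\widehat{X_i},\dots,\widehat{X_j},\dots);$$ $\partial^*$ is its metric adjoint with respect to the metrics naturally induced on the spaces $C^p(\mathfrak h_-,\mathfrak h)$. $Q$ acts on $\mathfrak h_-\cong\mathfrak h/\mathfrak q$ by the action $\mathrm{Ad}^-$ induced by the adjoint action, and on $C^p(\mathfrak h_-,\mathfrak h)$ by $(g\cdot\phi)(X_1,\dots,X_p)=\mathrm{Ad}_g(\phi(\mathrm{Ad}^-_{g^{-1}}X_1,\dots,\mathrm{Ad}^-_{g^{-1}}X_p))$. The metric is admissible if $\partial^*:C^{p+1}(\mathfrak h_-,\mathfrak h)\to C^p(\mathfrak h_-,\mathfrak h)$ is $Q$-invariant (commutes with the $Q$-actions) for every $p\ge0$. *)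

theory Defs
  imports "HOL-Analysis.Analysis" "HOL-Algebra.Group"
begin

section \<open>Smooth manifolds and Lie groups\<close>

text \<open>
  Only used for open \<open>S\<close> in finite-dimensional spaces. There, continuity of
  \<open>x \<mapsto> f' x v\<close> for every \<open>v\<close> amounts to continuity of the derivative \<open>f'\<close>.
\<close>

primrec Ck_on :: "nat \<Rightarrow> 'a::real_normed_vector set \<Rightarrow> ('a \<Rightarrow> 'b::real_normed_vector) \<Rightarrow> bool" where
  "Ck_on 0 S f \<longleftrightarrow> continuous_on S f"
| "Ck_on (Suc n) S f \<longleftrightarrow>
     (\<exists>f'. (\<forall>x\<in>S. (f has_derivative f' x) (at x)) \<and> (\<forall>v. Ck_on n S (\<lambda>x. f' x v)))"

definition smooth_on :: "'a::real_normed_vector set \<Rightarrow> ('a \<Rightarrow> 'b::real_normed_vector) \<Rightarrow> bool" where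
  "smooth_on S f \<longleftrightarrow> (\<forall>n. Ck_on n S f)"

text \<open>A chart is a pair \<open>(U, \<phi>)\<close> of its domain and its coordinate map.\<close>

type_synonym ('g, 'e) chart = "'g set \<times> ('g \<Rightarrow> 'e)"

definition chart_inv :: "('g, 'e) chart \<Rightarrow> 'e \<Rightarrow> 'g" where
  "chart_inv c = inv_into (fst c) (snd c)"

definition is_chart :: "'g topology \<Rightarrow> ('g, 'e::euclidean_space) chart \<Rightarrow> bool" where
  "is_chart T c \<longleftrightarrow> openin T (fst c) \<and> open (snd c ` fst c) \<and>
     homeomorphic_map (subtopology T (fst c)) (top_of_set (snd c ` fst c)) (snd c)"

definition smooth_manifold :: "'g topology \<Rightarrow> ('g, 'e::euclidean_space) chart set \<Rightarrow> bool" where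
  "smooth_manifold T A \<longleftrightarrow>
     Hausdorff_space T \<and> second_countable T \<and>
     (\<forall>c\<in>A. is_chart T c) \<and> (\<Union>c\<in>A. fst c) = topspace T \<and>
     (\<forall>c\<in>A. \<forall>d\<in>A. smooth_on (snd c ` (fst c \<inter> fst d)) (snd d \<circ> chart_inv c))"

definition smooth_map ::
  "'g topology \<Rightarrow> ('g, 'e::euclidean_space) chart set \<Rightarrow>
   'h topology \<Rightarrow> ('h, 'f::euclidean_space) chart set \<Rightarrow> ('g \<Rightarrow> 'h) \<Rightarrow> bool" where
  "smooth_map T A T' A' f \<longleftrightarrow> continuous_map T T' f \<and>
     (\<forall>c\<in>A. \<forall>d\<in>A'. smooth_on (snd c ` {x \<in> fst c. f x \<in> fst d}) (snd d \<circ> f \<circ> chart_inv c))"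

definition prod_atlas ::
  "('g, 'e) chart set \<Rightarrow> ('h, 'f) chart set \<Rightarrow> ('g \<times> 'h, 'e \<times> 'f) chart set" where
  "prod_atlas A A' = {(fst c \<times> fst d, map_prod (snd c) (snd d)) | c d. c \<in> A \<and> d \<in> A'}"

text \<open>The differential of \<open>f\<close> at \<open>x\<close>, in the chart \<open>c\<close> around \<open>x\<close> and the chart \<open>d\<close> around \<open>f x\<close>.\<close>

definition chart_deriv ::
  "('g, 'e::euclidean_space) chart \<Rightarrow> ('h, 'f::euclidean_space) chart \<Rightarrow>
   ('g \<Rightarrow> 'h) \<Rightarrow> 'g \<Rightarrow> 'e \<Rightarrow> 'f" where
  "chart_deriv c d f x = frechet_derivative (snd d \<circ> f \<circ> chart_inv c) (at (snd c x))"

definition lie_group ::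
  "('g, 'm) monoid_scheme \<Rightarrow> 'g topology \<Rightarrow> ('g, 'e::euclidean_space) chart set \<Rightarrow> bool" where
  "lie_group G T A \<longleftrightarrow> group G \<and> topspace T = carrier G \<and> smooth_manifold T A \<and>
     smooth_map (prod_topology T T) (prod_atlas A A) T A (\<lambda>(x, y). x \<otimes>\<^bsub>G\<^esub> y) \<and>
     smooth_map T A T A (m_inv G)"

text \<open>
  A chart \<open>c\<close> around the identity identifies the tangent space at the identity with the model
  space \<open>'e\<close>. In these coordinates, \<open>Ad\<close> is the differential of conjugation at the identity.
\<close>

definition Ad_chart ::
  "('g, 'm) monoid_scheme \<Rightarrow> ('g, 'e::euclidean_space) chart \<Rightarrow> 'g \<Rightarrow> 'e \<Rightarrow> 'e" where
  "Ad_chart G c g = chart_deriv c c (\<lambda>x. g \<otimes>\<^bsub>G\<^esub> x \<otimes>\<^bsub>G\<^esub> m_inv G g) \<one>\<^bsub>G\<^esub>"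

text \<open>
  \<open>L\<close> identifies the tangent space at the identity of \<open>G\<close> (in the coordinates of \<open>c\<close>) with the
  Lie algebra \<open>(br)\<close>, as Lie algebras. The Lie bracket of \<open>G\<close> is the differential of \<open>Ad\<close> at the
  identity: \<open>[u, v] = (d\<^sub>e Ad)(u)(v)\<close>.
\<close>

definition lie_algebra_identification ::
  "('g, 'm) monoid_scheme \<Rightarrow> ('g, 'e::euclidean_space) chart \<Rightarrow>
   ('h::real_vector \<Rightarrow> 'h \<Rightarrow> 'h) \<Rightarrow> ('e \<Rightarrow> 'h) \<Rightarrow> bool" where
  "lie_algebra_identification G c br L \<longleftrightarrow> linear L \<and> bij L \<and>
     (\<forall>u v. L (frechet_derivative (\<lambda>x. Ad_chart G c (chart_inv c x) v) (at (snd c \<one>\<^bsub>G\<^esub>)) u)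
              = br (L u) (L v))"

definition Ad_rep ::
  "('g, 'm) monoid_scheme \<Rightarrow> ('g, 'e::euclidean_space) chart \<Rightarrow> ('e \<Rightarrow> 'h) \<Rightarrow> 'g \<Rightarrow> 'h \<Rightarrow> 'h" where
  "Ad_rep G c L g = L \<circ> Ad_chart G c g \<circ> the_inv L"

text \<open>
  Lie subgroups are immersed, not necessarily embedded: \<open>Q\<close> carries its own topology and atlas.
\<close>

definition lie_subgroup ::
  "'g monoid \<Rightarrow> 'g topology \<Rightarrow> ('g, 'e::euclidean_space) chart set \<Rightarrow>
   'g set \<Rightarrow> 'g topology \<Rightarrow> ('g, 'f::euclidean_space) chart set \<Rightarrow> bool" where
  "lie_subgroup G T A Q TQ AQ \<longleftrightarrow> subgroup Q G \<and> lie_group (G\<lparr>carrier := Q\<rparr>) TQ AQ \<and>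
     smooth_map TQ AQ T A (\<lambda>x. x) \<and>
     (\<forall>x\<in>Q. \<forall>c\<in>AQ. \<forall>d\<in>A. x \<in> fst c \<and> x \<in> fst d \<longrightarrow> inj (chart_deriv c d (\<lambda>x. x) x))"

text \<open>The tangent space at the identity of a Lie subgroup, in the chart \<open>c\<close> of the ambient group.\<close>

definition subgroup_tangent ::
  "'g monoid \<Rightarrow> ('g, 'e::euclidean_space) chart \<Rightarrow> ('g, 'f::euclidean_space) chart set \<Rightarrow> 'e set" where
  "subgroup_tangent G c AQ =
     {chart_deriv d c (\<lambda>x. x) \<one>\<^bsub>G\<^esub> v | d v. d \<in> AQ \<and> \<one>\<^bsub>G\<^esub> \<in> fst d}"


section \<open>Graded Lie algebras\<close>

definition lie_algebra :: "('a::real_vector \<Rightarrow> 'a \<Rightarrow> 'a) \<Rightarrow> bool" where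
  "lie_algebra br \<longleftrightarrow> bilinear br \<and> (\<forall>x. br x x = 0) \<and>
     (\<forall>x y z. br x (br y z) + br y (br z x) + br z (br x y) = 0)"

definition gradation :: "('a::real_vector \<Rightarrow> 'a \<Rightarrow> 'a) \<Rightarrow> (int \<Rightarrow> 'a set) \<Rightarrow> int \<Rightarrow> bool" where
  "gradation br \<gg> k \<longleftrightarrow>
     (\<forall>i. subspace (\<gg> i)) \<and>
     (\<forall>i. i < - k \<or> i > 0 \<longrightarrow> \<gg> i = {0}) \<and>
     (\<forall>x. \<exists>!f. (\<forall>i. f i \<in> \<gg> i) \<and> x = (\<Sum>i\<in>{- k..0}. f i)) \<and>
     (\<forall>i j. \<forall>x\<in>\<gg> i. \<forall>y\<in>\<gg> j. br x y \<in> \<gg> (i + j))"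

definition neg_part :: "(int \<Rightarrow> 'a::real_vector set) \<Rightarrow> 'a set" where
  "neg_part \<gg> = span (\<Union>i\<in>{..<0}. \<gg> i)"

definition fundamental_gradation ::
  "('a::real_vector \<Rightarrow> 'a \<Rightarrow> 'a) \<Rightarrow> (int \<Rightarrow> 'a set) \<Rightarrow> int \<Rightarrow> bool" where
  "fundamental_gradation br \<gg> k \<longleftrightarrow> k > 0 \<and> gradation br \<gg> k \<and>
     (\<lambda>S. subspace S \<and> (\<forall>x\<in>S. \<forall>y\<in>S. br x y \<in> S)) hull \<gg> (- 1) = neg_part \<gg> \<and>
     \<gg> 0 \<noteq> {0} \<and> \<gg> (- k) \<noteq> {0} \<and>
     (\<forall>x\<in>\<gg> 0. (\<forall>y\<in>\<gg> (- 1). br x y = 0) \<longrightarrow> x = 0)"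

definition adapted_metric :: "(int \<Rightarrow> 'a::real_inner set) \<Rightarrow> bool" where
  "adapted_metric \<gg> \<longleftrightarrow> (\<forall>i j. i \<noteq> j \<longrightarrow> (\<forall>x\<in>\<gg> i. \<forall>y\<in>\<gg> j. x \<bullet> y = 0))"


section \<open>The cotangent Lie algebra\<close>

type_synonym 'a cotangent = "'a \<times> ('a \<Rightarrow>\<^sub>L real)"

definition coadjoint ::
  "('a::euclidean_space \<Rightarrow> 'a \<Rightarrow> 'a) \<Rightarrow> 'a \<Rightarrow> ('a \<Rightarrow>\<^sub>L real) \<Rightarrow> ('a \<Rightarrow>\<^sub>L real)" where
  "coadjoint br X \<alpha> = Blinfun (\<lambda>Y. - blinfun_apply \<alpha> (br X Y))"

definition cotangent_bracket ::
  "('a::euclidean_space \<Rightarrow> 'a \<Rightarrow> 'a) \<Rightarrow> 'a cotangent \<Rightarrow> 'a cotangent \<Rightarrow> 'a cotangent" where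
  "cotangent_bracket br = (\<lambda>(X, \<xi>) (Y, \<eta>). (br X Y, coadjoint br X \<eta> - coadjoint br Y \<xi>))"

definition sharp :: "'a::euclidean_space \<Rightarrow> ('a \<Rightarrow>\<^sub>L real)" where
  "sharp X = blinfun_inner_right X"

definition flat :: "('a::euclidean_space \<Rightarrow>\<^sub>L real) \<Rightarrow> 'a" where
  "flat = the_inv sharp"

definition cotangent_metric :: "'a::euclidean_space cotangent \<Rightarrow> 'a cotangent \<Rightarrow> real" where
  "cotangent_metric = (\<lambda>(X, \<xi>) (Y, \<eta>). X \<bullet> Y + flat \<xi> \<bullet> flat \<eta>)"

definition theta :: "'a::euclidean_space cotangent \<Rightarrow> 'a cotangent" where
  "theta = (\<lambda>(X, \<xi>). (flat \<xi>, sharp X))"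

definition cotangent_neg :: "(int \<Rightarrow> 'a::euclidean_space set) \<Rightarrow> 'a cotangent set" where
  "cotangent_neg \<gg> = neg_part \<gg> \<times> {0}"

definition cotangent_q :: "(int \<Rightarrow> 'a::euclidean_space set) \<Rightarrow> 'a cotangent set" where
  "cotangent_q \<gg> = \<gg> 0 \<times> UNIV"


section \<open>Cochains and admissible metrics\<close>

text \<open>
  Here \<open>m\<close> stands for \<open>\<hh>\<^sub>-\<close>, a subspace of \<open>\<hh>\<close>, and \<open>met\<close> for the metric on \<open>\<hh>\<close>. An element of
  \<open>C\<^sup>p(\<hh>\<^sub>-, \<hh>)\<close> is an alternating \<open>p\<close>-linear map, encoded as a function on lists that vanishes on
  everything except lists of length \<open>p\<close> with entries in \<open>m\<close>.
\<close>

definition cochains :: "'h::real_vector set \<Rightarrow> nat \<Rightarrow> ('h list \<Rightarrow> 'h) set" where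
  "cochains m p = {\<phi>.
     (\<forall>xs. \<not> (length xs = p \<and> set xs \<subseteq> m) \<longrightarrow> \<phi> xs = 0) \<and>
     (\<forall>xs ys x y a b. length xs + length ys + 1 = p \<and> set xs \<subseteq> m \<and> set ys \<subseteq> m \<and> x \<in> m \<and> y \<in> m \<longrightarrow>
        \<phi> (xs @ (a *\<^sub>R x + b *\<^sub>R y) # ys) = a *\<^sub>R \<phi> (xs @ x # ys) + b *\<^sub>R \<phi> (xs @ y # ys)) \<and>
     (\<forall>xs. \<not> distinct xs \<longrightarrow> \<phi> xs = 0)}"

text \<open>The differential \<open>C\<^sup>p \<rightarrow> C\<^sup>p\<^sup>+\<^sup>1\<close>; omitted arguments are removed by restricting the index set.\<close>

definition differential ::
  "('h::real_vector \<Rightarrow> 'h \<Rightarrow> 'h) \<Rightarrow> 'h set \<Rightarrow> nat \<Rightarrow> ('h list \<Rightarrow> 'h) \<Rightarrow> 'h list \<Rightarrow> 'h" where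
  "differential br m p \<phi> xs =
     (if length xs = Suc p \<and> set xs \<subseteq> m then
        (\<Sum>i\<le>p. (- 1) ^ i *\<^sub>R br (xs ! i) (\<phi> (nths xs (- {i})))) +
        (\<Sum>j\<le>p. \<Sum>i<j. (- 1) ^ (i + j) *\<^sub>R \<phi> (br (xs ! i) (xs ! j) # nths xs (- {i, j})))
      else 0)"

definition orthonormal_basis :: "('h::real_vector \<Rightarrow> 'h \<Rightarrow> real) \<Rightarrow> 'h set \<Rightarrow> 'h set \<Rightarrow> bool" where
  "orthonormal_basis met m B \<longleftrightarrow> finite B \<and> B \<subseteq> m \<and> span B = m \<and>
     (\<forall>x\<in>B. \<forall>y\<in>B. met x y = (if x = y then 1 else 0))"

text \<open>
  The metric induced on \<open>\<Lambda>\<^sup>p(\<hh>\<^sub>-\<^sup>*) \<otimes> \<hh>\<close>. It is independent of the orthonormal basis \<open>B\<close> of \<open>m\<close>; the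
  factor \<open>1 / p!\<close> turns the sum over all \<open>p\<close>-tuples from \<open>B\<close> into a sum over \<open>p\<close>-element subsets.
\<close>

definition cochain_metric ::
  "('h::real_vector \<Rightarrow> 'h \<Rightarrow> real) \<Rightarrow> 'h set \<Rightarrow> nat \<Rightarrow> ('h list \<Rightarrow> 'h) \<Rightarrow> ('h list \<Rightarrow> 'h) \<Rightarrow> real" where
  "cochain_metric met m p \<phi> \<psi> =
     (let B = (SOME B. orthonormal_basis met m B)
      in (\<Sum>xs | length xs = p \<and> set xs \<subseteq> B. met (\<phi> xs) (\<psi> xs)) / fact p)"

text \<open>The metric adjoint \<open>\<partial>\<^sup>* : C\<^sup>p\<^sup>+\<^sup>1 \<rightarrow> C\<^sup>p\<close> of the differential.\<close>

definition codifferential ::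
  "('h::real_vector \<Rightarrow> 'h \<Rightarrow> 'h) \<Rightarrow> ('h \<Rightarrow> 'h \<Rightarrow> real) \<Rightarrow> 'h set \<Rightarrow> nat \<Rightarrow>
   ('h list \<Rightarrow> 'h) \<Rightarrow> 'h list \<Rightarrow> 'h" where
  "codifferential br met m p \<psi> = (THE \<omega>. \<omega> \<in> cochains m p \<and>
     (\<forall>\<phi>\<in>cochains m p. cochain_metric met m (Suc p) (differential br m p \<phi>) \<psi>
                         = cochain_metric met m p \<phi> \<omega>))"

text \<open>
  The map induced by \<open>f\<close> on \<open>\<hh>/\<qq>\<close>, transported to \<open>m = \<hh>\<^sub>-\<close> along \<open>\<hh>\<^sub>- \<cong> \<hh>/\<qq>\<close>.
\<close>

definition induced_minus ::
  "'h::real_vector set \<Rightarrow> 'h set \<Rightarrow> ('h \<Rightarrow> 'h) \<Rightarrow> 'h \<Rightarrow> 'h" where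
  "induced_minus m q f x = (THE y. y \<in> m \<and> f x - y \<in> q)"

definition cochain_action ::
  "('g, 'm) monoid_scheme \<Rightarrow> ('g \<Rightarrow> 'h \<Rightarrow> 'h) \<Rightarrow> 'h::real_vector set \<Rightarrow> 'h set \<Rightarrow>
   'g \<Rightarrow> ('h list \<Rightarrow> 'h) \<Rightarrow> 'h list \<Rightarrow> 'h" where
  "cochain_action G Ad m q g \<phi> xs =
     (if set xs \<subseteq> m then Ad g (\<phi> (map (induced_minus m q (Ad (m_inv G g))) xs)) else 0)"

definition admissible ::
  "('g, 'm) monoid_scheme \<Rightarrow> 'g set \<Rightarrow> ('g \<Rightarrow> 'h \<Rightarrow> 'h) \<Rightarrow>
   ('h::real_vector \<Rightarrow> 'h \<Rightarrow> 'h) \<Rightarrow> 'h set \<Rightarrow> 'h set \<Rightarrow> ('h \<Rightarrow> 'h \<Rightarrow> real) \<Rightarrow> bool" where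
  "admissible G Q Ad br m q met \<longleftrightarrow>
     (\<forall>p. \<forall>g\<in>Q. \<forall>\<psi>\<in>cochains m (Suc p).
        codifferential br met m p (cochain_action G Ad m q g \<psi>)
        = cochain_action G Ad m q g (codifferential br met m p \<psi>))"

end

theory Submission
  imports Defs
begin

text \<open>
  Let \<open>m = \<hh>\<^sub>-\<close>. The proof passes through the metric adjoint \<open>C g\<close> of \<open>Ad g\<close> for \<open>g \<in> Q\<close>. Since \<open>\<partial>\<^sup>*\<close> is the
  adjoint of \<open>\<partial>\<close>, it commutes with the action of \<open>Q\<close> on cochains iff \<open>\<partial>\<close> commutes with the adjoint
  of that action. The spaces \<open>m\<close> and \<open>\<qq>\<close> are orthogonal and \<open>Ad g\<close> preserves \<open>\<qq>\<close>, so \<open>C g\<close>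
  preserves \<open>m\<close>, and the adjoint of the action of \<open>g\<close> is transport of structure along \<open>C g\<close>,
  \<open>\<phi> \<mapsto> C g (\<phi> ((C g)\<inverse> X\<^sub>1, \<dots>, (C g)\<inverse> X\<^sub>p))\<close>.
  On \<open>0\<close>-cochains, commuting with \<open>\<partial>\<close> is the identity
  \<open>C g [Y, v] = [C g Y, C g v]\<close> for \<open>Y \<in> m\<close> and \<open>v \<in> \<hh>\<close>. Conversely, this identity says that \<open>C g\<close>
  respects all the data that enter the definition of \<open>\<partial>\<close>, whence \<open>\<partial>\<close> commutes with it in every
  degree (lemma \<open>admissible_iff_adj_bracket\<close>).

  The second step linearises this identity. Differentiating it at the unit of \<open>Q\<close> in the direction
  \<open>x \<in> \<qq>\<close> gives \<open>a [Y, v] = [a Y, v] + [Y, a v]\<close>, where \<open>a\<close> is the adjoint of \<open>ad x\<close>.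
  For the converse, the defect \<open>f g = C g [Y, v] - [C g Y, C g v]\<close> vanishes at the unit and, by the
  infinitesimal identity, its derivative at each \<open>g\<close> is a linear function of \<open>f g\<close> itself. Near the
  unit, the mean value inequality makes such a function vanish, and connectedness of \<open>Q\<close> makes it
  vanish everywhere (lemma \<open>vanish_if_equivariant_derivative\<close>). The same argument, applied to the
  component of \<open>C g Y\<close> in \<open>\<qq>\<close>, shows that \<open>C g\<close> preserves \<open>m\<close>.

  Finally, \<open>\<langle>x, \<theta> y\<rangle>\<close> is the canonical pairing of \<open>\<gg> \<oplus> \<gg>\<^sup>*\<close>, which is \<open>ad\<close>-invariant; so the adjoint of
  \<open>ad x\<close> is \<open>- \<theta> \<circ> ad x \<circ> \<theta>\<close> (lemma \<open>cotangent_metric_ad_theta\<close>), and the infinitesimal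
  identity becomes the stated one.
\<close>

section \<open>Multilinear functions of lists\<close>

text \<open>
  The linearity clause of \<open>cochains\<close> alone. Alternation is kept apart: the adjunction
  arguments below treat \<open>\<partial>\<phi>\<close> as a multilinear map.
\<close>

definition slot_linear :: "'h::real_vector set \<Rightarrow> nat \<Rightarrow> ('h list \<Rightarrow> 'v::real_vector) \<Rightarrow> bool" where
  "slot_linear m p \<phi> \<longleftrightarrow>
     (\<forall>xs ys x y a b. length xs + length ys + 1 = p \<and> set xs \<subseteq> m \<and> set ys \<subseteq> m \<and> x \<in> m \<and> y \<in> m \<longrightarrow>
        \<phi> (xs @ (a *\<^sub>R x + b *\<^sub>R y) # ys) = a *\<^sub>R \<phi> (xs @ x # ys) + b *\<^sub>R \<phi> (xs @ y # ys))"

lemma slot_linearD: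
  assumes "slot_linear m p \<phi>" "length xs + length ys + 1 = p" "set xs \<subseteq> m" "set ys \<subseteq> m" "x \<in> m" "y \<in> m"
  shows "\<phi> (xs @ (a *\<^sub>R x + b *\<^sub>R y) # ys) = a *\<^sub>R \<phi> (xs @ x # ys) + b *\<^sub>R \<phi> (xs @ y # ys)"
  using assms unfolding slot_linear_def by blast

lemma cochains_iff:
  "\<phi> \<in> cochains m p \<longleftrightarrow> (\<forall>xs. \<not> (length xs = p \<and> set xs \<subseteq> m) \<longrightarrow> \<phi> xs = 0)
     \<and> slot_linear m p \<phi> \<and> (\<forall>xs. \<not> distinct xs \<longrightarrow> \<phi> xs = 0)"
  unfolding cochains_def slot_linear_def by blast

lemma slot_linear_Cons:
  assumes "slot_linear m (Suc p) \<phi>" "x \<in> m"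
  shows "slot_linear m p (\<lambda>xs. \<phi> (x # xs))"
  unfolding slot_linear_def
proof (intro allI impI)
  fix xs ys :: "'a list" and y z a b
  assume "length xs + length ys + 1 = p \<and> set xs \<subseteq> m \<and> set ys \<subseteq> m \<and> y \<in> m \<and> z \<in> m"
  then show "\<phi> (x # xs @ (a *\<^sub>R y + b *\<^sub>R z) # ys) = a *\<^sub>R \<phi> (x # xs @ y # ys) + b *\<^sub>R \<phi> (x # xs @ z # ys)"
    using slot_linearD[OF assms(1), of "x # xs" ys y z a b] assms(2) by auto
qed

lemma slot_linear_head_sum:
  assumes "slot_linear m (Suc p) \<phi>" "subspace m" "finite B" "B \<subseteq> m" "set zs \<subseteq> m" "length zs = p"
  shows "\<phi> ((\<Sum>b\<in>B. c b *\<^sub>R b) # zs) = (\<Sum>b\<in>B. c b *\<^sub>R \<phi> (b # zs))"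
  using assms(3,4)
proof (induction B rule: finite_induct)
  case empty
  show ?case
    using slot_linearD[OF assms(1), of "[]" zs 0 0 0 0] assms(2,5,6) by (simp add: subspace_0)
next
  case (insert x F)
  have F: "(\<Sum>b\<in>F. c b *\<^sub>R b) \<in> m"
    using insert.prems assms(2) by (auto intro!: subspace_sum subspace_scale)
  have "\<phi> ((\<Sum>b\<in>insert x F. c b *\<^sub>R b) # zs) = \<phi> ([] @ (c x *\<^sub>R x + 1 *\<^sub>R (\<Sum>b\<in>F. c b *\<^sub>R b)) # zs)"
    using insert.hyps by simp
  also have "\<dots> = c x *\<^sub>R \<phi> (x # zs) + \<phi> ((\<Sum>b\<in>F. c b *\<^sub>R b) # zs)"
    using slot_linearD[OF assms(1), of "[]" zs x "\<Sum>b\<in>F. c b *\<^sub>R b" "c x" 1] insert.prems F assms(5,6) by simp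
  finally show ?case using insert by simp
qed

lemma sum_lists_Suc:
  assumes "finite B"
  shows "(\<Sum>xs | length xs = Suc p \<and> set xs \<subseteq> B. f xs) = (\<Sum>xs | length xs = p \<and> set xs \<subseteq> B. \<Sum>x\<in>B. f (x # xs))"
proof -
  have "{xs. length xs = Suc p \<and> set xs \<subseteq> B} = (\<lambda>(xs, x). x # xs) ` ({xs. length xs = p \<and> set xs \<subseteq> B} \<times> B)"
    by (auto simp: length_Suc_conv image_iff)
  moreover have "inj_on (\<lambda>(xs, x). x # xs) ({xs. length xs = p \<and> set xs \<subseteq> B} \<times> B)"
    by (auto simp: inj_on_def)
  ultimately show ?thesis
    by (simp add: sum.reindex sum.cartesian_product case_prod_unfold o_def)
qed

lemma finite_lists: "finite B \<Longrightarrow> finite {xs. length xs = p \<and> set xs \<subseteq> B}"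
  using finite_lists_length_eq[of B p] by (simp add: conj_commute)

lemma nths_append_Cons:
  "nths (xs @ z # ys) I = nths xs I @ (if length xs \<in> I then [z] else []) @ nths ys {j. Suc (j + length xs) \<in> I}"
  by (simp add: nths_append nths_Cons)

lemma length_nths_remove:
  assumes "finite I" "I \<subseteq> {..<length xs}"
  shows "length (nths xs (- I)) = length xs - card I"
proof -
  have "{i. i < length xs \<and> i \<in> - I} = {..<length xs} - I" by auto
  then show ?thesis using assms by (simp add: length_nths card_Diff_subset)
qed

lemma slot_linear_sum:
  assumes "\<And>i. i \<in> I \<Longrightarrow> slot_linear m p (f i)"
  shows "slot_linear m p (\<lambda>xs. \<Sum>i\<in>I. f i xs)"
  unfolding slot_linear_def
  by (intro allI impI)
    (simp add: slot_linearD[OF assms] sum.distrib scaleR_sum_right cong: sum.cong)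

lemma slot_linear_add:
  "slot_linear m p f \<Longrightarrow> slot_linear m p g \<Longrightarrow> slot_linear m p (\<lambda>xs. f xs + g xs)"
  unfolding slot_linear_def by (simp add: algebra_simps)

lemma slot_linear_scale:
  "slot_linear m p f \<Longrightarrow> slot_linear m p (\<lambda>xs. r *\<^sub>R f xs)"
  unfolding slot_linear_def by (simp add: algebra_simps)

text \<open>
  If \<open>i\<close> is the varying slot, the variation is seen by the bracket and \<open>nths\<close> drops it; otherwise
  the slot survives in \<open>nths\<close> at a shifted position and linearity is that of \<open>\<phi>\<close>.
\<close>

lemma slot_linear_bracket_term:
  assumes \<phi>: "slot_linear m p \<phi>" and br: "bilinear br" and i: "i \<le> p"
  shows "slot_linear m (Suc p) (\<lambda>xs. br (xs ! i) (\<phi> (nths xs (- {i}))))"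
  unfolding slot_linear_def
proof (intro allI impI)
  fix xs ys :: "'a list" and x y a b
  assume as: "length xs + length ys + 1 = Suc p \<and> set xs \<subseteq> m \<and> set ys \<subseteq> m \<and> x \<in> m \<and> y \<in> m"
  let ?I = "- {i}"
  define us vs where "us = nths xs ?I" and "vs = nths ys {j. Suc (j + length xs) \<in> ?I}"
  have uv: "set us \<subseteq> m" "set vs \<subseteq> m" using as by (auto simp: us_def vs_def dest!: in_set_nthsD)
  have n: "nths (xs @ z # ys) ?I = us @ (if length xs \<in> ?I then [z] else []) @ vs" for z
    unfolding us_def vs_def by (rule nths_append_Cons)
  have len: "length us + length vs + (if length xs \<in> ?I then 1 else 0) = p"
    using length_nths_remove[of "{i}" "xs @ x # ys"] as i unfolding n by (auto split: if_splits)
  show "br ((xs @ (a *\<^sub>R x + b *\<^sub>R y) # ys) ! i) (\<phi> (nths (xs @ (a *\<^sub>R x + b *\<^sub>R y) # ys) ?I)) =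
     a *\<^sub>R br ((xs @ x # ys) ! i) (\<phi> (nths (xs @ x # ys) ?I)) + b *\<^sub>R br ((xs @ y # ys) ! i) (\<phi> (nths (xs @ y # ys) ?I))"
  proof (cases "i = length xs")
    case True
    then show ?thesis unfolding n using br by (simp add: bilinear_ladd bilinear_lmul)
  next
    case False
    have nth: "(xs @ z # ys) ! i = (xs @ x # ys) ! i" for z using False by (auto simp: nth_append nth_Cons')
    have "\<phi> (us @ (a *\<^sub>R x + b *\<^sub>R y) # vs) = a *\<^sub>R \<phi> (us @ x # vs) + b *\<^sub>R \<phi> (us @ y # vs)"
      using slot_linearD[OF \<phi> _ uv] len as False by auto
    then show ?thesis unfolding n nth[of "a *\<^sub>R x + b *\<^sub>R y"] nth[of y] using br False
      by (simp add: bilinear_radd bilinear_rmul)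
  qed
qed

text \<open>
  The varying slot is \<open>i\<close>, or \<open>j\<close>, and is then seen by the first argument of \<open>\<phi>\<close>, or is one of the
  slots that remain in \<open>nths\<close>.
\<close>

lemma slot_linear_contraction_term:
  assumes \<phi>: "slot_linear m p \<phi>" and br: "bilinear br" and ij: "i < j" "j \<le> p"
    and cl: "\<And>x y. x \<in> m \<Longrightarrow> y \<in> m \<Longrightarrow> br x y \<in> m" 
  shows "slot_linear m (Suc p) (\<lambda>xs. \<phi> (br (xs ! i) (xs ! j) # nths xs (- {i, j})))"
  unfolding slot_linear_def
proof (intro allI impI)
  fix xs ys :: "'a list" and x y a b
  assume as: "length xs + length ys + 1 = Suc p \<and> set xs \<subseteq> m \<and> set ys \<subseteq> m \<and> x \<in> m \<and> y \<in> m"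
  let ?I = "- {i, j}"
  define us vs where "us = nths xs ?I" and "vs = nths ys {j. Suc (j + length xs) \<in> ?I}"
  have uv: "set us \<subseteq> m" "set vs \<subseteq> m" using as by (auto simp: us_def vs_def dest!: in_set_nthsD)
  have n: "nths (xs @ z # ys) ?I = us @ (if length xs \<in> ?I then [z] else []) @ vs" for z
    unfolding us_def vs_def by (rule nths_append_Cons)
  have len: "length us + length vs + (if length xs \<in> ?I then 1 else 0) + 1 = p"
    using length_nths_remove[of "{i, j}" "xs @ x # ys"] as ij unfolding n by (auto split: if_splits)
  have mem: "(xs @ z # ys) ! l \<in> m" if "l \<le> p" "z \<in> m" for l z
  proof -
    have "(xs @ z # ys) ! l \<in> set (xs @ z # ys)" by (rule nth_mem) (use as that in simp)
    then show ?thesis using as that by auto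
  qed
  have nth: "(xs @ z # ys) ! l = (xs @ x # ys) ! l" if "l \<noteq> length xs" for l z
    using that by (auto simp: nth_append nth_Cons')
  let ?z = "a *\<^sub>R x + b *\<^sub>R y"
  have head: "\<phi> ((a *\<^sub>R u + b *\<^sub>R v) # us @ vs) = a *\<^sub>R \<phi> (u # us @ vs) + b *\<^sub>R \<phi> (v # us @ vs)"
    if "u \<in> m" "v \<in> m" "length us + length vs + 1 = p" for u v
    using slot_linearD[OF \<phi>, of "[]" "us @ vs" u v a b] that uv by simp
  consider "i = length xs" | "j = length xs" | "i \<noteq> length xs" "j \<noteq> length xs" by blast
  then show "\<phi> (br ((xs @ ?z # ys) ! i) ((xs @ ?z # ys) ! j) # nths (xs @ ?z # ys) ?I) =
       a *\<^sub>R \<phi> (br ((xs @ x # ys) ! i) ((xs @ x # ys) ! j) # nths (xs @ x # ys) ?I) +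
       b *\<^sub>R \<phi> (br ((xs @ y # ys) ! i) ((xs @ y # ys) ! j) # nths (xs @ y # ys) ?I)"
  proof cases
    case 1
    have j: "j \<noteq> length xs" using 1 ij by simp
    have w: "(xs @ x # ys) ! j \<in> m" using mem ij as by simp
    show ?thesis unfolding n nth[OF j, of ?z] nth[OF j, of y] using 1 len
      head[OF cl[of x] cl[of y], OF _ w _ w] as br by (simp add: bilinear_ladd bilinear_lmul)
  next
    case 2
    have i: "i \<noteq> length xs" using 2 ij by simp
    have w: "(xs @ x # ys) ! i \<in> m" using mem ij as by simp
    show ?thesis unfolding n nth[OF i, of ?z] nth[OF i, of y] using 2 len
      head[OF cl[of _ x] cl[of _ y], OF w _ w] as br by (simp add: bilinear_radd bilinear_rmul)
  next
    case 3
    let ?w = "br ((xs @ x # ys) ! i) ((xs @ x # ys) ! j)"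
    have w: "?w \<in> m" using cl mem ij as by simp
    show ?thesis unfolding n nth[OF 3(1), of ?z] nth[OF 3(1), of y] nth[OF 3(2), of ?z] nth[OF 3(2), of y]
      using slot_linearD[OF \<phi>, of "?w # us" vs x y a b] 3 len w as uv by simp
  qed
qed

lemma slot_linear_cong:
  assumes "slot_linear m p f" "subspace m" "\<And>xs. length xs = p \<Longrightarrow> set xs \<subseteq> m \<Longrightarrow> g xs = f xs"
  shows "slot_linear m p g"
  unfolding slot_linear_def
proof (intro allI impI)
  fix xs ys :: "'a list" and x y a b
  assume as: "length xs + length ys + 1 = p \<and> set xs \<subseteq> m \<and> set ys \<subseteq> m \<and> x \<in> m \<and> y \<in> m"
  then have "a *\<^sub>R x + b *\<^sub>R y \<in> m" using assms(2) by (simp add: subspace_add subspace_scale)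
  then show "g (xs @ (a *\<^sub>R x + b *\<^sub>R y) # ys) = a *\<^sub>R g (xs @ x # ys) + b *\<^sub>R g (xs @ y # ys)"
    using as slot_linearD[OF assms(1)] by (simp add: assms(3))
qed

lemma slot_linear_differential:
  assumes "slot_linear m p \<phi>" "bilinear br" "subspace m"
    and "\<And>x y. x \<in> m \<Longrightarrow> y \<in> m \<Longrightarrow> br x y \<in> m" 
  shows "slot_linear m (Suc p) (differential br m p \<phi>)"
proof (rule slot_linear_cong[OF _ assms(3)])
  show "slot_linear m (Suc p) (\<lambda>xs. (\<Sum>i\<le>p. (- 1) ^ i *\<^sub>R br (xs ! i) (\<phi> (nths xs (- {i})))) +
        (\<Sum>j\<le>p. \<Sum>i<j. (- 1) ^ (i + j) *\<^sub>R \<phi> (br (xs ! i) (xs ! j) # nths xs (- {i, j}))))"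
    using assms by (intro slot_linear_add slot_linear_sum slot_linear_scale slot_linear_bracket_term
        slot_linear_contraction_term) auto
qed (simp add: differential_def)

section \<open>Representation of functionals on a finite-dimensional space\<close>

text \<open>
  A subspace \<open>S\<close> of \<open>\<real>\<^sup>I\<close> represents its functionals by its own elements. The elements of \<open>S\<close> may be
  of any type \<open>'v\<close>: they enter through their coordinates \<open>\<epsilon> i\<close> and the operation \<open>x + a y\<close>, so that
  the lemma applies to spaces of functions. In the induction on \<open>I\<close> a new coordinate \<open>j\<close> cuts out
  the hyperplane \<open>S0 = {x \<in> S. \<epsilon> j x = 0}\<close>; the induction hypothesis gives the representing element
  on \<open>S0\<close> and, applied to the functional \<open>\<langle>\<cdot>, x\<rangle>\<close>, also a vector \<open>u\<close> orthogonal to \<open>S0\<close>.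
\<close>

lemma finite_riesz:
  fixes \<epsilon> :: "'i \<Rightarrow> 'v \<Rightarrow> real" and add_scaled :: "real \<Rightarrow> 'v \<Rightarrow> 'v \<Rightarrow> 'v"
  assumes "finite I" "z \<in> S"
    and "\<And>a x y. x \<in> S \<Longrightarrow> y \<in> S \<Longrightarrow> add_scaled a x y \<in> S"
    and "\<And>i a x y. i \<in> I \<Longrightarrow> x \<in> S \<Longrightarrow> y \<in> S \<Longrightarrow> \<epsilon> i (add_scaled a x y) = \<epsilon> i x + a * \<epsilon> i y"
    and "\<And>a x y. x \<in> S \<Longrightarrow> y \<in> S \<Longrightarrow> F (add_scaled a x y) = F x + a * F y"
    and "\<And>x. x \<in> S \<Longrightarrow> (\<And>i. i \<in> I \<Longrightarrow> \<epsilon> i x = 0) \<Longrightarrow> F x = 0"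
    and "\<And>i. i \<in> I \<Longrightarrow> \<epsilon> i z = 0"
  shows "\<exists>s\<in>S. \<forall>t\<in>S. F t = (\<Sum>i\<in>I. \<epsilon> i t * \<epsilon> i s)"
  using assms
proof (induction I arbitrary: S F rule: finite_induct)
  case empty
  then show ?case by auto
next
  case (insert j I)
  note cS = insert.prems(2) and eps = insert.prems(3) and Flin = insert.prems(4)
  define S0 where "S0 = {x \<in> S. \<epsilon> j x = 0}"
  have S0S: "x \<in> S" if "x \<in> S0" for x using that by (simp add: S0_def)
  have zS0: "z \<in> S0" using insert.prems by (simp add: S0_def)
  have c0: "add_scaled a x y \<in> S0" if "x \<in> S0" "y \<in> S0" for a x y
    using that cS eps by (simp add: S0_def)
  have riesz0: "\<exists>s\<in>S0. \<forall>t\<in>S0. G t = (\<Sum>i\<in>I. \<epsilon> i t * \<epsilon> i s)"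
    if "\<And>a x y. x \<in> S0 \<Longrightarrow> y \<in> S0 \<Longrightarrow> G (add_scaled a x y) = G x + a * G y"
      and "\<And>x. x \<in> S0 \<Longrightarrow> (\<And>i. i \<in> I \<Longrightarrow> \<epsilon> i x = 0) \<Longrightarrow> G x = 0" for G
  proof (rule insert.IH)
    show "z \<in> S0" by (rule zS0)
    show "add_scaled a x y \<in> S0" if "x \<in> S0" "y \<in> S0" for a x y using that by (rule c0)
    show "\<epsilon> i (add_scaled a x y) = \<epsilon> i x + a * \<epsilon> i y" if "i \<in> I" "x \<in> S0" "y \<in> S0" for i a x y
      using that eps S0S by simp
    show "\<epsilon> i z = 0" if "i \<in> I" for i using that insert.prems(6) by simp
  qed (fact that)+
  obtain s0 where s0: "s0 \<in> S0" "\<And>t. t \<in> S0 \<Longrightarrow> F t = (\<Sum>i\<in>I. \<epsilon> i t * \<epsilon> i s0)"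
  proof -
    have "\<exists>s\<in>S0. \<forall>t\<in>S0. F t = (\<Sum>i\<in>I. \<epsilon> i t * \<epsilon> i s)"
    proof (rule riesz0)
      show "F (add_scaled a x y) = F x + a * F y" if "x \<in> S0" "y \<in> S0" for a x y
        using that by (intro Flin S0S)
      show "F x = 0" if "x \<in> S0" "\<And>i. i \<in> I \<Longrightarrow> \<epsilon> i x = 0" for x
        by (rule insert.prems(5)) (use that in \<open>auto simp: S0_def\<close>)
    qed
    then show thesis using that by blast
  qed
  have s0j: "\<epsilon> j s0 = 0" "s0 \<in> S" using s0(1) by (auto simp: S0_def)
  show ?case
  proof (cases "\<exists>x\<in>S. \<epsilon> j x \<noteq> 0")
    case False
    then show ?thesis using s0 insert.hyps by (auto simp: S0_def intro!: bexI[of _ s0])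
  next
    case True
    then obtain x where x: "x \<in> S" "\<epsilon> j x \<noteq> 0" by blast
    obtain p where p: "p \<in> S0" "\<And>t. t \<in> S0 \<Longrightarrow> (\<Sum>i\<in>I. \<epsilon> i t * \<epsilon> i x) = (\<Sum>i\<in>I. \<epsilon> i t * \<epsilon> i p)"
    proof -
      have "\<exists>s\<in>S0. \<forall>t\<in>S0. (\<Sum>i\<in>I. \<epsilon> i t * \<epsilon> i x) = (\<Sum>i\<in>I. \<epsilon> i t * \<epsilon> i s)"
      proof (rule riesz0)
        fix a v w assume "v \<in> S0" "w \<in> S0"
        then have "\<epsilon> i (add_scaled a v w) * \<epsilon> i x = \<epsilon> i v * \<epsilon> i x + a * (\<epsilon> i w * \<epsilon> i x)" if "i \<in> I" for i
          using that eps S0S by (simp add: algebra_simps)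
        then show "(\<Sum>i\<in>I. \<epsilon> i (add_scaled a v w) * \<epsilon> i x) = (\<Sum>i\<in>I. \<epsilon> i v * \<epsilon> i x) + a * (\<Sum>i\<in>I. \<epsilon> i w * \<epsilon> i x)"
          by (simp add: sum.distrib sum_distrib_left)
      qed simp
      then show thesis using that by blast
    qed
    have pS: "p \<in> S" "\<epsilon> j p = 0" using p(1) by (auto simp: S0_def)
    \<comment> \<open>\<open>p\<close> is the orthogonal projection of \<open>x\<close> to \<open>S0\<close>, so \<open>S\<close> is the orthogonal sum of \<open>S0\<close> and the line of \<open>u\<close>.\<close>
    define u where "u = add_scaled (- 1) x p"
    have u: "u \<in> S" "\<And>i. i \<in> insert j I \<Longrightarrow> \<epsilon> i u = \<epsilon> i x - \<epsilon> i p"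
      using x pS cS eps by (auto simp: u_def)
    have uj: "\<epsilon> j u \<noteq> 0" using u x pS by auto
    have orth: "(\<Sum>i\<in>I. \<epsilon> i t * \<epsilon> i u) = 0" if "t \<in> S0" for t
      using p(2)[OF that] u(2) by (simp add: right_diff_distrib sum_subtractf)
    define N where "N = (\<Sum>i\<in>insert j I. \<epsilon> i u * \<epsilon> i u)"
    have N: "N > 0"
    proof -
      have "(\<Sum>i\<in>I. \<epsilon> i u * \<epsilon> i u) \<ge> 0" by (intro sum_nonneg) auto
      moreover have "\<epsilon> j u * \<epsilon> j u > 0" using uj by (simp add: zero_less_mult_iff) linarith
      ultimately show ?thesis unfolding N_def using insert.hyps by simp
    qed
    define K where "K = F u / N"
    define s where "s = add_scaled K s0 u"
    have s: "s \<in> S" "\<And>i. i \<in> insert j I \<Longrightarrow> \<epsilon> i s = \<epsilon> i s0 + K * \<epsilon> i u"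
      using s0j u(1) cS eps by (auto simp: s_def)
    have "F t = (\<Sum>i\<in>insert j I. \<epsilon> i t * \<epsilon> i s)" if t: "t \<in> S" for t
    proof -
      define r where "r = \<epsilon> j t / \<epsilon> j u"
      define t0 where "t0 = add_scaled (- r) t u"
      have t0: "t0 \<in> S0" "F t0 = F t - r * F u" "\<And>i. i \<in> insert j I \<Longrightarrow> \<epsilon> i t0 = \<epsilon> i t - r * \<epsilon> i u"
        using t u(1) uj cS eps Flin by (auto simp: t0_def S0_def r_def)
      have "(\<Sum>i\<in>insert j I. \<epsilon> i t * \<epsilon> i s)
          = (\<Sum>i\<in>insert j I. (\<epsilon> i t0 + r * \<epsilon> i u) * (\<epsilon> i s0 + K * \<epsilon> i u))"
        by (rule sum.cong) (simp_all add: t0(3) s(2))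
      also have "\<dots> = (\<Sum>i\<in>insert j I. \<epsilon> i t0 * \<epsilon> i s0) + K * (\<Sum>i\<in>insert j I. \<epsilon> i t0 * \<epsilon> i u)
            + r * (\<Sum>i\<in>insert j I. \<epsilon> i s0 * \<epsilon> i u) + r * (K) * N"
        unfolding N_def by (simp add: sum.distrib sum_distrib_left algebra_simps del: sum.insert)
      also have "(\<Sum>i\<in>insert j I. \<epsilon> i t0 * \<epsilon> i s0) = F t0"
        using s0(2)[OF t0(1)] s0j insert.hyps by simp
      also have "(\<Sum>i\<in>insert j I. \<epsilon> i t0 * \<epsilon> i u) = 0"
        using orth[OF t0(1)] t0(1) insert.hyps by (simp add: S0_def)
      also have "(\<Sum>i\<in>insert j I. \<epsilon> i s0 * \<epsilon> i u) = 0"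
        using orth[OF s0(1)] s0j insert.hyps by simp
      finally show ?thesis using N t0(2) by (simp add: K_def)
    qed
    then show ?thesis using s(1) by blast
  qed
qed

section \<open>Orthonormal bases and adjoints\<close>

lemma orthonormal_basis_expand:
  assumes "orthonormal_basis met S B" "bilinear met" "x \<in> S"
  shows "(\<Sum>b\<in>B. met x b *\<^sub>R b) = x"
proof -
  have B: "finite B" "span B = S" "\<And>x y. x \<in> B \<Longrightarrow> y \<in> B \<Longrightarrow> met x y = (if x = y then 1 else 0)"
    using assms(1) by (auto simp: orthonormal_basis_def)
  obtain c where c: "x = (\<Sum>b\<in>B. c b *\<^sub>R b)"
    using assms(3) B(1,2) by (auto simp: span_finite)
  have "met x b = c b" if "b \<in> B" for b
  proof -
    have lin: "linear (\<lambda>u. met u b)" using assms(2) by (simp add: bilinear_def)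
    have "met x b = (\<Sum>b'\<in>B. c b' * met b' b)"
      unfolding c by (simp add: linear_sum[OF lin] linear_scale[OF lin])
    also have "\<dots> = (\<Sum>b'\<in>B. if b = b' then c b' else 0)"
      by (rule sum.cong) (use B(3) that in auto)
    finally show ?thesis using that B(1) by simp
  qed
  then show ?thesis using c by simp
qed

text \<open>
  Expanding \<open>P x\<close> in the orthonormal basis and collecting the terms on the other side moves the map
  from one slot of \<open>\<psi>\<close> to the same slot of \<open>\<phi>\<close>, one slot at a time.
\<close>

lemma pullback_adjoint:
  assumes "slot_linear m p \<phi>" "slot_linear m p \<psi>"
    and met: "bilinear met" "\<And>x y. met x y = met y x" and B: "orthonormal_basis met m B"
    and m: "subspace m" and P: "\<And>x. x \<in> m \<Longrightarrow> P x \<in> m" and D: "\<And>x. x \<in> m \<Longrightarrow> D x \<in> m"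
    and adj: "\<And>x y. x \<in> m \<Longrightarrow> y \<in> m \<Longrightarrow> met (P x) y = met x (D y)"
  shows "(\<Sum>xs | length xs = p \<and> set xs \<subseteq> B. met (\<phi> xs) (\<psi> (map P xs)))
       = (\<Sum>xs | length xs = p \<and> set xs \<subseteq> B. met (\<phi> (map D xs)) (\<psi> xs))"
  using assms(1,2)
proof (induction p arbitrary: \<phi> \<psi>)
  case 0
  have "{xs. length xs = 0 \<and> set xs \<subseteq> B} = {[]}" by auto
  then show ?case by simp
next
  case (Suc p)
  have fB: "finite B" and Bm: "B \<subseteq> m" using B by (auto simp: orthonormal_basis_def)
  have lists_m: "set (map D xs) \<subseteq> m" if "set xs \<subseteq> B" for xs using that Bm D by auto
  let ?L = "{xs. length xs = p \<and> set xs \<subseteq> B}"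
  have expand_P: "\<psi> (P x # xs) = (\<Sum>y\<in>B. met (P x) y *\<^sub>R \<psi> (y # xs))" if "x \<in> B" "xs \<in> ?L" for x xs
  proof -
    have "P x \<in> m" "set xs \<subseteq> m" "length xs = p" using that Bm P by auto
    then show ?thesis
      using slot_linear_head_sum[OF Suc.prems(2) m fB Bm, of xs "met (P x)"]
        orthonormal_basis_expand[OF B met(1), of "P x"] by simp
  qed
  have expand_D: "\<phi> (D y # map D xs) = (\<Sum>x\<in>B. met (D y) x *\<^sub>R \<phi> (x # map D xs))" if "y \<in> B" "xs \<in> ?L" for y xs
  proof -
    have "D y \<in> m" "set (map D xs) \<subseteq> m" "length (map D xs) = p" using that Bm D lists_m by auto
    then show ?thesis
      using slot_linear_head_sum[OF Suc.prems(1) m fB Bm, of "map D xs" "met (D y)"]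
        orthonormal_basis_expand[OF B met(1), of "D y"] by simp
  qed
  have lin: "linear (\<lambda>y. met x y)" "linear (\<lambda>x. met x y)" for x y
    using met(1) by (simp_all add: bilinear_def)
  have "(\<Sum>xs | length xs = Suc p \<and> set xs \<subseteq> B. met (\<phi> xs) (\<psi> (map P xs)))
      = (\<Sum>x\<in>B. \<Sum>xs\<in>?L. met (\<phi> (x # xs)) (\<psi> (P x # map P xs)))"
    by (subst sum.swap) (simp add: sum_lists_Suc[OF fB])
  also have "\<dots> = (\<Sum>x\<in>B. \<Sum>xs\<in>?L. met (\<phi> (x # map D xs)) (\<psi> (P x # xs)))"
    by (rule sum.cong[OF refl], rule Suc.IH[OF slot_linear_Cons[OF Suc.prems(1)] slot_linear_Cons[OF Suc.prems(2)]])
      (use Bm P in auto)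
  also have "\<dots> = (\<Sum>x\<in>B. \<Sum>xs\<in>?L. \<Sum>y\<in>B. met (P x) y * met (\<phi> (x # map D xs)) (\<psi> (y # xs)))"
    by (intro sum.cong refl) (simp add: expand_P linear_sum[OF lin(1)] linear_scale[OF lin(1)])
  also have "\<dots> = (\<Sum>xs\<in>?L. \<Sum>x\<in>B. \<Sum>y\<in>B. met (P x) y * met (\<phi> (x # map D xs)) (\<psi> (y # xs)))"
    by (rule sum.swap)
  also have "\<dots> = (\<Sum>xs\<in>?L. \<Sum>y\<in>B. \<Sum>x\<in>B. met (P x) y * met (\<phi> (x # map D xs)) (\<psi> (y # xs)))"
    by (intro sum.cong refl sum.swap)
  also have "\<dots> = (\<Sum>xs\<in>?L. \<Sum>y\<in>B. met (\<phi> (D y # map D xs)) (\<psi> (y # xs)))"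
  proof (intro sum.cong refl)
    fix xs y assume "xs \<in> ?L" "y \<in> B"
    moreover have "met (P x) y = met (D y) x" if "x \<in> B" for x
      using adj[of x y] that \<open>y \<in> B\<close> Bm met(2) by auto
    ultimately show "(\<Sum>x\<in>B. met (P x) y * met (\<phi> (x # map D xs)) (\<psi> (y # xs))) = met (\<phi> (D y # map D xs)) (\<psi> (y # xs))"
      by (simp add: expand_D linear_sum[OF lin(2)] linear_scale[OF lin(2)])
  qed
  also have "\<dots> = (\<Sum>xs | length xs = Suc p \<and> set xs \<subseteq> B. met (\<phi> (map D xs)) (\<psi> xs))"
    by (simp add: sum_lists_Suc[OF fB])
  finally show ?case .
qed

lemma slot_linear_eq_0:
  assumes "slot_linear m p \<phi>" "orthonormal_basis met m B" "bilinear met" "subspace m"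
    and "\<And>xs. length xs = p \<Longrightarrow> set xs \<subseteq> B \<Longrightarrow> \<phi> xs = 0"
    and "length xs = p" "set xs \<subseteq> m"
  shows "\<phi> xs = 0"
  using assms(1,5-7)
proof (induction p arbitrary: \<phi> xs)
  case 0
  then show ?case by simp
next
  case (Suc p)
  have B: "finite B" "B \<subseteq> m" using assms(2) by (auto simp: orthonormal_basis_def)
  obtain x ys where xs: "xs = x # ys" "length ys = p" "x \<in> m" "set ys \<subseteq> m"
    using Suc.prems(3,4) by (auto simp: length_Suc_conv)
  have "\<phi> (b # ys) = 0" if "b \<in> B" for b
    by (rule Suc.IH[OF slot_linear_Cons[OF Suc.prems(1)]]) (use that B xs Suc.prems(2) in auto)
  then have "\<phi> ((\<Sum>b\<in>B. met x b *\<^sub>R b) # ys) = 0"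
    using slot_linear_head_sum[OF Suc.prems(1) assms(4) B, of ys] xs by simp
  then show ?case using orthonormal_basis_expand[OF assms(2,3) xs(3)] xs(1) by simp
qed

text \<open>
  The form is a function, as \<open>cotangent_metric\<close> is, and not the inner product of a type class.
  Definiteness and finite dimension come from the orthonormal basis \<open>E\<close> of the whole space.
\<close>

locale finite_metric =
  fixes met :: "'h::real_vector \<Rightarrow> 'h \<Rightarrow> real" and E :: "'h set"
  assumes met_bilinear: "bilinear met"
    and met_sym: "met x y = met y x"
    and E_basis: "orthonormal_basis met UNIV E"
begin

lemma met_linear: "linear (\<lambda>y. met x y)" "linear (\<lambda>x. met x y)"
  using met_bilinear by (simp_all add: bilinear_def)

lemma met_expand: "(\<Sum>b\<in>E. met x b *\<^sub>R b) = x"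
  by (rule orthonormal_basis_expand[OF E_basis met_bilinear]) simp

lemma finite_E: "finite E"
  using E_basis by (simp add: orthonormal_basis_def)

lemma met_eq_sum: "met x y = (\<Sum>b\<in>E. met x b * met y b)"
proof -
  have "met x y = met x (\<Sum>b\<in>E. met y b *\<^sub>R b)" by (simp add: met_expand)
  also have "\<dots> = (\<Sum>b\<in>E. met x b * met y b)"
    by (simp add: linear_sum[OF met_linear(1)] linear_scale[OF met_linear(1)] mult.commute)
  finally show ?thesis .
qed

lemma met_nonneg: "met x x \<ge> 0"
  unfolding met_eq_sum[of x x] by (intro sum_nonneg) simp

lemma met_definite: "met x x = 0 \<Longrightarrow> x = 0"
proof -
  assume "met x x = 0"
  then have "\<forall>b\<in>E. met x b * met x b = 0"
    unfolding met_eq_sum[of x x] using sum_nonneg_eq_0_iff[OF finite_E, of "\<lambda>b. met x b * met x b"] by simp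
  then have "(\<Sum>b\<in>E. met x b *\<^sub>R b) = 0" by simp
  then show "x = 0" by (simp add: met_expand)
qed

lemma met_simps:
  "met (x + y) z = met x z + met y z" "met z (x + y) = met z x + met z y"
  "met (x - y) z = met x z - met y z" "met z (x - y) = met z x - met z y"
  "met (r *\<^sub>R x) z = r * met x z" "met z (r *\<^sub>R x) = r * met z x"
  "met 0 z = 0" "met z 0 = 0" "met (- x) z = - met x z" "met z (- x) = - met z x"
  by (simp_all add: linear_add[OF met_linear(1)] linear_add[OF met_linear(2)]
    linear_diff[OF met_linear(1)] linear_diff[OF met_linear(2)]
    linear_scale[OF met_linear(1)] linear_scale[OF met_linear(2)]
    linear_0[OF met_linear(1)] linear_0[OF met_linear(2)]
    linear_neg[OF met_linear(1)] linear_neg[OF met_linear(2)])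

lemma met_eqI: "(\<And>w. met x w = met y w) \<Longrightarrow> x = y"
  using met_definite[of "x - y"] by (simp add: met_simps)

definition adj :: "('h \<Rightarrow> 'h) \<Rightarrow> 'h \<Rightarrow> 'h" where
  "adj f v = (\<Sum>b\<in>E. met v (f b) *\<^sub>R b)"

lemma met_adj: "linear f \<Longrightarrow> met (adj f v) w = met v (f w)"
proof -
  assume f: "linear f"
  have "met v (f w) = met v (f (\<Sum>b\<in>E. met w b *\<^sub>R b))" by (simp add: met_expand)
  also have "\<dots> = (\<Sum>b\<in>E. met w b * met v (f b))"
    by (simp add: linear_sum[OF f] linear_scale[OF f] linear_sum[OF met_linear(1)] linear_scale[OF met_linear(1)])
  also have "\<dots> = met (adj f v) w"
    by (simp add: adj_def linear_sum[OF met_linear(2)] linear_scale[OF met_linear(2)] met_sym[of w] mult.commute)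
  finally show ?thesis by simp
qed

lemma adj_eqI: "linear f \<Longrightarrow> (\<And>w. met x w = met v (f w)) \<Longrightarrow> adj f v = x"
  by (rule met_eqI) (simp add: met_adj)

lemma linear_adj: "linear (adj f)"
  by (rule linearI) (simp_all add: adj_def met_simps sum.distrib scaleR_add_left scaleR_sum_right)

lemma adj_adj_comp: "linear f \<Longrightarrow> linear g \<Longrightarrow> adj f (adj g v) = adj (\<lambda>x. g (f x)) v"
  by (rule adj_eqI[symmetric]) (simp_all add: met_adj linear_compose[unfolded o_def])

lemma adj_id: "adj (\<lambda>x. x) v = v"
  by (rule adj_eqI) (simp_all add: linear_id[unfolded id_def])

end

section \<open>Cochains and the codifferential\<close>

text \<open>
  The part of the situation that the cochain calculus depends on: an orthogonal decomposition
  \<open>\<hh> = m \<oplus> q\<close> in which \<open>m\<close> is a subalgebra.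
\<close>

locale split_metric_algebra = finite_metric met E
  for met :: "'h::real_vector \<Rightarrow> 'h \<Rightarrow> real" and E :: "'h set" +
  fixes br :: "'h \<Rightarrow> 'h \<Rightarrow> 'h" and m q :: "'h set"
  assumes br_bilinear: "bilinear br"
    and m_subspace: "subspace m" and q_subspace: "subspace q"
    and m_closed: "\<And>x y. x \<in> m \<Longrightarrow> y \<in> m \<Longrightarrow> br x y \<in> m"
    and orth: "\<And>x y. x \<in> m \<Longrightarrow> y \<in> q \<Longrightarrow> met x y = 0"
    and split: "\<And>x. \<exists>y\<in>m. x - y \<in> q"
    and m_basis: "\<exists>B. orthonormal_basis met m B"
begin

text \<open>
  The identification of \<open>\<hh>/q\<close> with \<open>m\<close>. As \<open>m\<close> and \<open>q\<close> are orthogonal, it is also the orthogonal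
  projection, which links \<open>Ad\<^sup>-\<close> to the metric.
\<close>

definition proj :: "'h \<Rightarrow> 'h" where
  "proj x = (THE y. y \<in> m \<and> x - y \<in> q)"

lemma proj_unique: "y \<in> m \<Longrightarrow> x - y \<in> q \<Longrightarrow> y' \<in> m \<Longrightarrow> x - y' \<in> q \<Longrightarrow> y = y'"
proof -
  assume y: "y \<in> m" "x - y \<in> q" "y' \<in> m" "x - y' \<in> q"
  have "y - y' \<in> m" using y m_subspace by (simp add: subspace_diff)
  moreover have "(x - y') - (x - y) \<in> q" by (rule subspace_diff[OF q_subspace y(4) y(2)])
  then have "y - y' \<in> q" by simp
  ultimately have "met (y - y') (y - y') = 0" by (rule orth)
  then show "y = y'" using met_definite by fastforce
qed

lemma proj_props: "proj x \<in> m \<and> x - proj x \<in> q"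
  unfolding proj_def by (rule theI') (use split[of x] proj_unique in blast)

lemma proj_eqI: "y \<in> m \<Longrightarrow> x - y \<in> q \<Longrightarrow> proj x = y"
  using proj_props proj_unique by blast

lemma induced_minus_eq: "induced_minus m q f x = proj (f x)"
  by (simp add: induced_minus_def proj_def)

lemma linear_proj: "linear proj"
proof (rule linearI)
  fix x y
  have "x + y - (proj x + proj y) = (x - proj x) + (y - proj y)" by simp
  then show "proj (x + y) = proj x + proj y"
    by (intro proj_eqI) (simp_all only: subspace_add m_subspace q_subspace proj_props)
next
  fix r x
  have "r *\<^sub>R x - r *\<^sub>R proj x = r *\<^sub>R (x - proj x)" by (simp add: scaleR_diff_right)
  then show "proj (r *\<^sub>R x) = r *\<^sub>R proj x"
    by (intro proj_eqI) (simp_all only: subspace_scale m_subspace q_subspace proj_props)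
qed

lemma proj_m: "x \<in> m \<Longrightarrow> proj x = x"
  by (rule proj_eqI) (simp_all add: subspace_0 q_subspace)

lemma met_proj: "y \<in> m \<Longrightarrow> met (proj x) y = met x y"
  using orth[of y "x - proj x"] proj_props[of x] by (simp add: met_simps met_sym)

lemma mem_m_if_orth: "(\<And>z. z \<in> q \<Longrightarrow> met x z = 0) \<Longrightarrow> x \<in> m"
proof -
  assume *: "\<And>z. z \<in> q \<Longrightarrow> met x z = 0"
  let ?z = "x - proj x"
  have z: "?z \<in> q" "proj x \<in> m" using proj_props by auto
  have "met ?z ?z = 0" using *[OF z(1)] orth[OF z(2,1)] by (simp add: met_simps)
  then have "?z = 0" by (rule met_definite)
  then show "x \<in> m" using z by simp
qed

abbreviation (input) cmet where "cmet \<equiv> cochain_metric met m"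

definition onb :: "'h set" where "onb = (SOME B. orthonormal_basis met m B)"

lemma onb: "orthonormal_basis met m onb"
  unfolding onb_def using m_basis by (rule someI_ex)

lemma cmet_eq: "cmet p \<phi> \<psi> = (\<Sum>xs | length xs = p \<and> set xs \<subseteq> onb. met (\<phi> xs) (\<psi> xs)) / fact p"
  by (simp add: cochain_metric_def Let_def onb_def)

lemma finite_onb_lists: "finite {xs. length xs = p \<and> set xs \<subseteq> onb}"
  using onb by (intro finite_lists) (simp add: orthonormal_basis_def)

definition add_scaled :: "real \<Rightarrow> ('h list \<Rightarrow> 'h) \<Rightarrow> ('h list \<Rightarrow> 'h) \<Rightarrow> ('h list \<Rightarrow> 'h)" where
  "add_scaled a \<phi> \<psi> = (\<lambda>xs. \<phi> xs + a *\<^sub>R \<psi> xs)"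

lemma add_scaled_cochains: "\<phi> \<in> cochains m p \<Longrightarrow> \<psi> \<in> cochains m p \<Longrightarrow> add_scaled a \<phi> \<psi> \<in> cochains m p"
  unfolding cochains_iff add_scaled_def by (auto intro: slot_linear_add slot_linear_scale)

lemma cmet_add_scaled: "cmet p (add_scaled a \<phi> \<psi>) \<omega> = cmet p \<phi> \<omega> + a * cmet p \<psi> \<omega>"
    "cmet p \<omega> (add_scaled a \<phi> \<psi>) = cmet p \<omega> \<phi> + a * cmet p \<omega> \<psi>"
  unfolding cmet_eq add_scaled_def
  by (simp_all add: met_simps sum.distrib add_divide_distrib sum_distrib_left)

lemma cmet_definite:
  assumes "slot_linear m p \<phi>" "cmet p \<phi> \<phi> = 0" "length xs = p" "set xs \<subseteq> m"
  shows "\<phi> xs = 0"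
proof -
  have "(\<Sum>xs | length xs = p \<and> set xs \<subseteq> onb. met (\<phi> xs) (\<phi> xs)) = 0"
    using assms(2) by (simp add: cmet_eq)
  then have "\<phi> xs = 0" if "length xs = p" "set xs \<subseteq> onb" for xs
    using sum_nonneg_eq_0_iff[OF finite_onb_lists, of p "\<lambda>xs. met (\<phi> xs) (\<phi> xs)"] that met_nonneg met_definite
    by auto
  then show ?thesis
    using slot_linear_eq_0[OF assms(1) onb met_bilinear m_subspace _ assms(3,4)] by blast
qed

lemma zero_cochain: "(\<lambda>_. 0) \<in> cochains m p"
  by (simp add: cochains_def)

text \<open>
  Positive definiteness of the metric on cochains: the difference is orthogonal to itself, and a
  multilinear map that vanishes on a basis is zero.
\<close>

lemma cochain_eqI:
  assumes "\<phi> \<in> cochains m p" "\<psi> \<in> cochains m p" "\<And>\<omega>. \<omega> \<in> cochains m p \<Longrightarrow> cmet p \<omega> \<phi> = cmet p \<omega> \<psi>"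
  shows "\<phi> = \<psi>"
proof
  fix xs
  let ?d = "add_scaled (- 1) \<phi> \<psi>"
  have d: "?d \<in> cochains m p" using assms by (intro add_scaled_cochains)
  have "cmet p ?d ?d = 0" using assms(3)[OF d] by (simp add: cmet_add_scaled(2))
  then have "?d xs = 0" if "length xs = p" "set xs \<subseteq> m"
    using cmet_definite[of p ?d xs] d that by (simp add: cochains_iff)
  moreover have "?d xs = 0" if "\<not> (length xs = p \<and> set xs \<subseteq> m)"
    using d that by (simp add: cochains_iff)
  ultimately show "\<phi> xs = \<psi> xs" by (auto simp: add_scaled_def)
qed

lemma differential_add_scaled: "differential br m p (add_scaled a \<phi> \<psi>) = add_scaled a (differential br m p \<phi>) (differential br m p \<psi>)"
  by (rule ext)
    (simp add: differential_def add_scaled_def bilinear_radd[OF br_bilinear] bilinear_rmul[OF br_bilinear]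
      scaleR_add_right sum.distrib scaleR_sum_right mult.commute)

text \<open>
  The coordinates of a cochain are its components on basis tuples; \<open>finite_riesz\<close> represents the
  functional \<open>\<phi> \<mapsto> \<langle>\<partial>\<phi>, \<psi>\<rangle>\<close> inside the subspace of alternating maps.
\<close>

lemma codifferential_unique_ex:
  "\<exists>!\<omega>. \<omega> \<in> cochains m p \<and> (\<forall>\<phi>\<in>cochains m p. cmet (Suc p) (differential br m p \<phi>) \<psi> = cmet p \<phi> \<omega>)"
proof -
  let ?L = "{xs. length xs = p \<and> set xs \<subseteq> onb}"
  let ?F = "\<lambda>\<phi>. fact p * cmet (Suc p) (differential br m p \<phi>) \<psi>"
  have "\<exists>s\<in>cochains m p. \<forall>t\<in>cochains m p.
      ?F t = (\<Sum>(xs, b)\<in>?L \<times> E. met (t xs) b * met (s xs) b)"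
    unfolding case_prod_unfold
  proof (rule finite_riesz[where z = "\<lambda>_. 0" and add_scaled = add_scaled and F = ?F])
    show "finite (?L \<times> E)" using finite_onb_lists finite_E by simp
    show "(\<lambda>_. 0) \<in> cochains m p" by (rule zero_cochain)
    show "add_scaled a x y \<in> cochains m p" if "x \<in> cochains m p" "y \<in> cochains m p" for a x y
      using that by (rule add_scaled_cochains)
    show "met (add_scaled a x y (fst i)) (snd i) = met (x (fst i)) (snd i) + a * met (y (fst i)) (snd i)" for i a x y
      by (simp add: add_scaled_def met_simps)
    show "?F (add_scaled a x y) = ?F x + a * ?F y" for a x y
      by (simp add: differential_add_scaled cmet_add_scaled algebra_simps)
    show "met ((\<lambda>_. 0) (fst i)) (snd i) = 0" for i :: "'h list \<times> 'h" by (simp add: met_simps)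
    show "?F x = 0" if x: "x \<in> cochains m p" and 0: "\<And>i. i \<in> ?L \<times> E \<Longrightarrow> met (x (fst i)) (snd i) = 0" for x
    proof -
      have "x xs = 0" if "length xs = p" "set xs \<subseteq> onb" for xs
      proof -
        have "met (x xs) b = 0" if "b \<in> E" for b
          using 0[of "(xs, b)"] that \<open>length xs = p\<close> \<open>set xs \<subseteq> onb\<close> by simp
        then show ?thesis using met_expand[of "x xs"] by simp
      qed
      then have "cmet p \<omega> x = cmet p \<omega> (\<lambda>_. 0)" for \<omega> by (simp add: cmet_eq)
      then have "x = (\<lambda>_. 0)" using x zero_cochain by (intro cochain_eqI)
      then have "add_scaled 1 x x = x" by (simp add: add_scaled_def)
      then have "cmet (Suc p) (differential br m p x) \<psi>
          = cmet (Suc p) (add_scaled 1 (differential br m p x) (differential br m p x)) \<psi>"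
        using differential_add_scaled[of p 1 x x] by simp
      then show ?thesis by (simp only: cmet_add_scaled) simp
    qed
  qed
  then obtain s where s: "s \<in> cochains m p"
    "\<And>t. t \<in> cochains m p \<Longrightarrow> ?F t = (\<Sum>(xs, b)\<in>?L \<times> E. met (t xs) b * met (s xs) b)" by blast
  have *: "cmet p t s = (\<Sum>(xs, b)\<in>?L \<times> E. met (t xs) b * met (s xs) b) / fact p" for t
    unfolding cmet_eq by (simp only: sum.cartesian_product[symmetric] met_eq_sum[symmetric])
  have "cmet (Suc p) (differential br m p t) \<psi> = cmet p t s" if "t \<in> cochains m p" for t
    unfolding * s(2)[OF that, symmetric] by simp
  then show ?thesis
    using s(1) by (intro ex1I[of _ s]) (auto intro!: cochain_eqI)
qed

lemma codifferential_cochain: "codifferential br met m p \<psi> \<in> cochains m p"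
  and codifferential_adjoint: "\<phi> \<in> cochains m p \<Longrightarrow>
     cmet (Suc p) (differential br m p \<phi>) \<psi> = cmet p \<phi> (codifferential br met m p \<psi>)"
  using theI'[OF codifferential_unique_ex[of p \<psi>]] unfolding codifferential_def by blast+

lemma codifferential_eqI:
  assumes "\<omega> \<in> cochains m p" "\<And>\<phi>. \<phi> \<in> cochains m p \<Longrightarrow> cmet (Suc p) (differential br m p \<phi>) \<psi> = cmet p \<phi> \<omega>"
  shows "codifferential br met m p \<psi> = \<omega>"
  unfolding codifferential_def by (rule the1_equality[OF codifferential_unique_ex]) (use assms in blast)

section \<open>The action on cochains\<close>

text \<open>
  Both the action of a group element (\<open>f = Ad g\<close>, \<open>g\<close> the induced map of the inverse) and its metric
  adjoint have this form.
\<close>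

definition act :: "('h \<Rightarrow> 'h) \<Rightarrow> ('h \<Rightarrow> 'h) \<Rightarrow> ('h list \<Rightarrow> 'h) \<Rightarrow> 'h list \<Rightarrow> 'h" where
  "act f g \<phi> xs = (if set xs \<subseteq> m then f (\<phi> (map g xs)) else 0)"

lemma cochain_action_eq:
  "cochain_action H Ad m q g \<phi> = act (Ad g) (\<lambda>x. proj (Ad (m_inv H g) x)) \<phi>"
proof -
  have "induced_minus m q (Ad (m_inv H g)) = (\<lambda>x. proj (Ad (m_inv H g) x))"
    by (rule ext) (rule induced_minus_eq)
  then show ?thesis unfolding cochain_action_def act_def by presburger
qed

lemma act_slot_linear:
  assumes "slot_linear m p \<phi>" "linear f" "linear g" "\<And>x. x \<in> m \<Longrightarrow> g x \<in> m"
  shows "slot_linear m p (act f g \<phi>)"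
proof (rule slot_linear_cong[OF _ m_subspace])
  show "slot_linear m p (\<lambda>xs. f (\<phi> (map g xs)))"
    unfolding slot_linear_def
  proof (intro allI impI)
    fix xs ys :: "'h list" and x y a b
    assume as: "length xs + length ys + 1 = p \<and> set xs \<subseteq> m \<and> set ys \<subseteq> m \<and> x \<in> m \<and> y \<in> m"
    have sub: "set (map g zs) \<subseteq> m" if "set zs \<subseteq> m" for zs using that assms(4) by auto
    have "\<phi> (map g xs @ (a *\<^sub>R g x + b *\<^sub>R g y) # map g ys)
        = a *\<^sub>R \<phi> (map g xs @ g x # map g ys) + b *\<^sub>R \<phi> (map g xs @ g y # map g ys)"
      by (rule slot_linearD[OF assms(1)]) (use as assms(4) sub in \<open>simp_all del: set_map\<close>)
    then show "f (\<phi> (map g (xs @ (a *\<^sub>R x + b *\<^sub>R y) # ys)))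
        = a *\<^sub>R f (\<phi> (map g (xs @ x # ys))) + b *\<^sub>R f (\<phi> (map g (xs @ y # ys)))"
      by (simp add: linear_add[OF assms(2)] linear_scale[OF assms(2)] linear_add[OF assms(3)] linear_scale[OF assms(3)])
  qed
qed (simp add: act_def)

lemma act_cochains:
  assumes "\<phi> \<in> cochains m p" "linear f" "linear g" "\<And>x. x \<in> m \<Longrightarrow> g x \<in> m"
  shows "act f g \<phi> \<in> cochains m p"
  unfolding cochains_iff
proof (intro conjI allI impI)
  show "slot_linear m p (act f g \<phi>)"
    using assms by (intro act_slot_linear) (simp_all add: cochains_iff)
  fix xs :: "'h list"
  show "act f g \<phi> xs = 0" if "\<not> (length xs = p \<and> set xs \<subseteq> m)"
    using that assms(1) linear_0[OF assms(2)] by (auto simp: act_def cochains_iff)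
  show "act f g \<phi> xs = 0" if "\<not> distinct xs"
    using that assms(1) linear_0[OF assms(2)] by (auto simp: act_def cochains_iff distinct_map)
qed

text \<open>
  The adjoint of the group action is again an action, by the adjoint maps. On \<open>m\<close> the projection
  disappears: \<open>\<langle>proj (g x), y\<rangle> = \<langle>x, adj g y\<rangle>\<close> for \<open>x\<close> and \<open>y\<close> in \<open>m\<close>.
\<close>

lemma cmet_act:
  assumes "slot_linear m p \<phi>" "slot_linear m p \<psi>" "linear f" "linear g"
    and ag: "\<And>x. x \<in> m \<Longrightarrow> adj g x \<in> m"
  shows "cmet p \<phi> (act f (\<lambda>x. proj (g x)) \<psi>) = cmet p (act (adj f) (adj g) \<phi>) \<psi>"
proof -
  let ?L = "{xs. length xs = p \<and> set xs \<subseteq> onb}"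
  have om: "set xs \<subseteq> m" if "xs \<in> ?L" for xs using that onb by (auto simp: orthonormal_basis_def)
  have adjoint: "met (proj (g x)) y = met x (adj g y)" if "x \<in> m" "y \<in> m" for x y
    using that assms(4) by (simp add: met_proj met_sym[of x] met_adj met_sym[of "g x"])
  have lin: "slot_linear m p (\<lambda>xs. adj f (\<phi> xs))"
    using assms(1) unfolding slot_linear_def
    by (simp add: linear_add[OF linear_adj] linear_scale[OF linear_adj])
  have "(\<Sum>xs\<in>?L. met (\<phi> xs) (act f (\<lambda>x. proj (g x)) \<psi> xs))
      = (\<Sum>xs\<in>?L. met (adj f (\<phi> xs)) (\<psi> (map (\<lambda>x. proj (g x)) xs)))"
    by (rule sum.cong) (use om in \<open>simp_all add: act_def met_adj[OF assms(3)]\<close>)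
  also have "\<dots> = (\<Sum>xs\<in>?L. met (adj f (\<phi> (map (adj g) xs))) (\<psi> xs))"
    by (rule pullback_adjoint[OF lin assms(2) met_bilinear met_sym onb m_subspace])
      (simp_all add: proj_props ag adjoint)
  also have "\<dots> = (\<Sum>xs\<in>?L. met (act (adj f) (adj g) \<phi> xs) (\<psi> xs))"
    by (rule sum.cong) (use om in \<open>simp_all add: act_def\<close>)
  finally show ?thesis by (simp add: cmet_eq)
qed

text \<open>
  Naturality of the differential. The hypotheses on \<open>g\<close> say that the pair \<open>(f, g)\<close> transports the
  bracket on \<open>m\<close> and the action of \<open>m\<close> on the coefficients.
\<close>

lemma differential_act:
  assumes f: "linear f" and g: "\<And>x. x \<in> m \<Longrightarrow> g x \<in> m"
    and fg: "\<And>x v. x \<in> m \<Longrightarrow> f (br (g x) v) = br x (f v)"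
    and gm: "\<And>x y. x \<in> m \<Longrightarrow> y \<in> m \<Longrightarrow> g (br x y) = br (g x) (g y)"
  shows "differential br m p (act f g \<phi>) = act f g (differential br m p \<phi>)"
proof
  fix xs
  show "differential br m p (act f g \<phi>) xs = act f g (differential br m p \<phi>) xs"
  proof (cases "length xs = Suc p \<and> set xs \<subseteq> m")
    case False
    then show ?thesis by (auto simp: differential_def act_def linear_0[OF f])
  next
    case True
    have nth: "xs ! i \<in> m" if "i \<le> p" for i using True that nth_mem[of i xs] by auto
    have sub: "set (nths xs I) \<subseteq> m" for I using True set_nths_subset by fastforce
    have gs: "set (map g xs) \<subseteq> m" using True g by auto
    have t1: "br (xs ! i) (act f g \<phi> (nths xs (- {i}))) = f (br (map g xs ! i) (\<phi> (nths (map g xs) (- {i}))))"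
      if "i \<le> p" for i
      using that nth[OF that] sub True by (simp add: act_def fg nths_map)
    have t2: "act f g \<phi> (br (xs ! i) (xs ! j) # nths xs (- {i, j}))
        = f (\<phi> (br (map g xs ! i) (map g xs ! j) # nths (map g xs) (- {i, j})))" if "i < j" "j \<le> p" for i j
      using that nth[of i] nth[of j] sub True by (simp add: act_def gm nths_map m_closed)
    have "differential br m p (act f g \<phi>) xs
      = (\<Sum>i\<le>p. (- 1) ^ i *\<^sub>R br (xs ! i) (act f g \<phi> (nths xs (- {i})))) +
        (\<Sum>j\<le>p. \<Sum>i<j. (- 1) ^ (i + j) *\<^sub>R act f g \<phi> (br (xs ! i) (xs ! j) # nths xs (- {i, j})))"
      using True by (simp add: differential_def)
    also have "\<dots> = (\<Sum>i\<le>p. (- 1) ^ i *\<^sub>R f (br (map g xs ! i) (\<phi> (nths (map g xs) (- {i}))))) +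
        (\<Sum>j\<le>p. \<Sum>i<j. (- 1) ^ (i + j) *\<^sub>R f (\<phi> (br (map g xs ! i) (map g xs ! j) # nths (map g xs) (- {i, j}))))"
      by (intro arg_cong2[of _ _ _ _ "(+)"] sum.cong refl) (simp_all only: t1 t2 atMost_iff lessThan_iff)
    also have "\<dots> = f (differential br m p \<phi> (map g xs))"
      using True gs by (simp add: differential_def linear_add[OF f] linear_sum[OF f] linear_scale[OF f] del: set_map)
    finally show ?thesis using True by (simp add: act_def)
  qed
qed

text \<open>
  Both sides have the same pairing with every \<open>\<phi>\<close>: move the action to \<open>\<phi>\<close> by adjunction, exchange it
  with the differential there, and move it back.
\<close>

lemma codifferential_act_commute:
  assumes lin: "linear f" "linear g" and inv: "\<And>x. g (f x) = x"
    and am: "\<And>x. x \<in> m \<Longrightarrow> adj g x \<in> m"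
    and hom: "\<And>x v. x \<in> m \<Longrightarrow> adj f (br x v) = br (adj f x) (adj f v)"
      "\<And>x v. x \<in> m \<Longrightarrow> adj g (br x v) = br (adj g x) (adj g v)"
    and \<psi>: "\<psi> \<in> cochains m (Suc p)"
  shows "codifferential br met m p (act f (\<lambda>x. proj (g x)) \<psi>) = act f (\<lambda>x. proj (g x)) (codifferential br met m p \<psi>)"
proof (rule codifferential_eqI)
  let ?g = "\<lambda>x. proj (g x)"
  have pg: "linear ?g" using linear_compose[OF lin(2) linear_proj] by (simp add: o_def)
  show "act f ?g (codifferential br met m p \<psi>) \<in> cochains m p"
    by (rule act_cochains[OF codifferential_cochain lin(1) pg]) (simp add: proj_props)
  have af: "adj f (adj g v) = v" for v using adj_adj_comp[OF lin] inv adj_id by simp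
  fix \<phi> assume \<phi>: "\<phi> \<in> cochains m p"
  have sl: "slot_linear m p \<phi>" "slot_linear m (Suc p) \<psi>" "slot_linear m p (codifferential br met m p \<psi>)"
    using \<phi> \<psi> codifferential_cochain[of p \<psi>] by (simp_all add: cochains_iff)
  have "cmet (Suc p) (differential br m p \<phi>) (act f ?g \<psi>) = cmet (Suc p) (act (adj f) (adj g) (differential br m p \<phi>)) \<psi>"
    by (rule cmet_act[OF slot_linear_differential[OF sl(1) br_bilinear m_subspace m_closed] sl(2) lin am])
  also have "act (adj f) (adj g) (differential br m p \<phi>) = differential br m p (act (adj f) (adj g) \<phi>)"
    by (rule differential_act[symmetric]) (simp_all add: linear_adj am hom af)
  also have "cmet (Suc p) \<dots> \<psi> = cmet p (act (adj f) (adj g) \<phi>) (codifferential br met m p \<psi>)"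
    by (rule codifferential_adjoint, rule act_cochains[OF \<phi> linear_adj linear_adj am])
  also have "\<dots> = cmet p \<phi> (act f ?g (codifferential br met m p \<psi>))"
    by (rule cmet_act[symmetric, OF sl(1,3) lin am])
  finally show "cmet (Suc p) (differential br m p \<phi>) (act f ?g \<psi>) = cmet p \<phi> (act f ?g (codifferential br met m p \<psi>))" .
qed

text \<open>
  In degree \<open>0\<close> the same computation runs backwards: \<open>\<partial>\<close> and the adjoint action agree on the constant
  \<open>v\<close> as \<open>1\<close>-cochains. The value of this equality at \<open>adj f x\<close> is the claim.
\<close>

lemma adj_bracket_if_codifferential_act_commute:
  assumes lin: "linear f" "linear g" and inv: "\<And>x. f (g x) = x"
    and am: "\<And>x. x \<in> m \<Longrightarrow> adj f x \<in> m" "\<And>x. x \<in> m \<Longrightarrow> adj g x \<in> m"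
    and commute: "\<And>\<psi>. \<psi> \<in> cochains m (Suc 0) \<Longrightarrow>
      codifferential br met m 0 (act f (\<lambda>x. proj (g x)) \<psi>) = act f (\<lambda>x. proj (g x)) (codifferential br met m 0 \<psi>)"
    and x: "x \<in> m"
  shows "adj f (br x v) = br (adj f x) (adj f v)"
proof -
  let ?g = "\<lambda>x. proj (g x)"
  \<comment> \<open>\<open>c v\<close> is the vector \<open>v\<close> as a \<open>0\<close>-cochain.\<close>
  define c where "c v xs = (if xs = [] then v else 0)" for v :: 'h and xs :: "'h list"
  have c: "c v \<in> cochains m 0" for v
    by (auto simp: c_def cochains_def)
  have c1: "\<kappa> \<in> cochains m (Suc 0)"
    if "slot_linear m (Suc 0) \<kappa>" "\<And>xs. \<not> (length xs = Suc 0 \<and> set xs \<subseteq> m) \<Longrightarrow> \<kappa> xs = 0" for \<kappa> :: "'h list \<Rightarrow> 'h"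
    unfolding cochains_iff using that by (metis distinct_singleton length_Suc_conv length_0_conv)
  have sl: "slot_linear m (Suc 0) (differential br m 0 (c v))" for v
    using c by (intro slot_linear_differential br_bilinear m_subspace m_closed) (simp_all add: cochains_iff)
  have dc: "differential br m 0 (c v) \<in> cochains m (Suc 0)" for v
    by (rule c1[OF sl]) (auto simp: differential_def)
  let ?a = "act (adj f) (adj g) (differential br m 0 (c v))"
  let ?b = "differential br m 0 (act (adj f) (adj g) (c v))"
  have ac: "act (adj f) (adj g) (c v) = c (adj f v)"
    by (rule ext) (simp add: act_def c_def linear_0[OF linear_adj])
  have "?a = ?b"
  proof (rule cochain_eqI)
    show a: "?a \<in> cochains m (Suc 0)" by (rule act_cochains[OF dc linear_adj linear_adj am(2)])
    show b: "?b \<in> cochains m (Suc 0)" unfolding ac by (rule dc)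
    fix \<psi> assume \<psi>: "\<psi> \<in> cochains m (Suc 0)"
    have sym: "cmet p \<alpha> \<beta> = cmet p \<beta> \<alpha>" for p \<alpha> \<beta> by (simp add: cmet_eq met_sym)
    have sl': "slot_linear m 0 (c v)" "slot_linear m (Suc 0) \<psi>" "slot_linear m 0 (codifferential br met m 0 \<psi>)"
      using \<psi> c codifferential_cochain[of 0 \<psi>] by (simp_all add: cochains_iff)
    have "cmet (Suc 0) ?a \<psi> = cmet (Suc 0) (differential br m 0 (c v)) (act f ?g \<psi>)"
      by (rule cmet_act[symmetric, OF sl sl'(2) lin am(2)])
    also have "\<dots> = cmet 0 (c v) (act f ?g (codifferential br met m 0 \<psi>))"
      unfolding commute[OF \<psi>, symmetric] by (rule codifferential_adjoint[OF c])
    also have "\<dots> = cmet 0 (act (adj f) (adj g) (c v)) (codifferential br met m 0 \<psi>)"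
      by (rule cmet_act[OF sl'(1,3) lin am(2)])
    also have "\<dots> = cmet (Suc 0) ?b \<psi>"
      unfolding ac by (rule codifferential_adjoint[symmetric, OF c])
    finally show "cmet (Suc 0) \<psi> ?a = cmet (Suc 0) \<psi> ?b" by (simp add: sym[of _ \<psi>])
  qed
  then have "?a [adj f x] = ?b [adj f x]" by simp
  moreover have "adj g (adj f x) = x" using adj_adj_comp[OF lin(2,1)] inv adj_id by simp
  ultimately show ?thesis
    using x am unfolding ac by (simp add: act_def differential_def c_def nths_singleton)
qed

lemma admissible_iff_adj_bracket:
  fixes H :: "('g, 'k) monoid_scheme"
  assumes "subgroup Q H" "group H"
    and lin: "\<And>g. g \<in> Q \<Longrightarrow> linear (Ad g)"
    and mult: "\<And>g h x. g \<in> Q \<Longrightarrow> h \<in> Q \<Longrightarrow> Ad (g \<otimes>\<^bsub>H\<^esub> h) x = Ad g (Ad h x)"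
    and one: "\<And>x. Ad \<one>\<^bsub>H\<^esub> x = x"
    and am: "\<And>g x. g \<in> Q \<Longrightarrow> x \<in> m \<Longrightarrow> adj (Ad g) x \<in> m"
  shows "admissible H Q Ad br m q met \<longleftrightarrow>
    (\<forall>g\<in>Q. \<forall>x\<in>m. \<forall>v. adj (Ad g) (br x v) = br (adj (Ad g) x) (adj (Ad g) v))"
proof -
  have sub: "m_inv H g \<in> Q" "g \<in> carrier H" if "g \<in> Q" for g
    using that assms(1) by (simp_all add: subgroup.m_inv_closed subgroup.mem_carrier)
  have inv: "Ad g (Ad (m_inv H g) x) = x" "Ad (m_inv H g) (Ad g x) = x" if "g \<in> Q" for g x
    using that sub[OF that] mult[of g "m_inv H g"] mult[of "m_inv H g" g] one assms(2)
    by (simp_all add: group.r_inv group.l_inv)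
  show ?thesis
    unfolding admissible_def cochain_action_eq
  proof (intro iffI ballI allI)
    fix g x v assume a: "\<forall>p. \<forall>g\<in>Q. \<forall>\<psi>\<in>cochains m (Suc p).
        codifferential br met m p (act (Ad g) (\<lambda>x. proj (Ad (inv\<^bsub>H\<^esub> g) x)) \<psi>) =
        act (Ad g) (\<lambda>x. proj (Ad (inv\<^bsub>H\<^esub> g) x)) (codifferential br met m p \<psi>)" and g: "g \<in> Q" "x \<in> m"
    show "adj (Ad g) (br x v) = br (adj (Ad g) x) (adj (Ad g) v)"
      by (rule adj_bracket_if_codifferential_act_commute[where g = "Ad (m_inv H g)"])
        (use a g sub lin am inv in auto)
  next
    fix p g \<psi> assume "\<forall>g\<in>Q. \<forall>x\<in>m. \<forall>v. adj (Ad g) (br x v) = br (adj (Ad g) x) (adj (Ad g) v)"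
      and "g \<in> Q" "\<psi> \<in> cochains m (Suc p)"
    then show "codifferential br met m p (act (Ad g) (\<lambda>x. proj (Ad (inv\<^bsub>H\<^esub> g) x)) \<psi>) =
        act (Ad g) (\<lambda>x. proj (Ad (inv\<^bsub>H\<^esub> g) x)) (codifferential br met m p \<psi>)"
      using sub lin am inv by (intro codifferential_act_commute) auto
  qed
qed

end

section \<open>Charts\<close>

text \<open>
  Derivatives at points of an open set see only the values on that set.
\<close>

lemma Ck_on_cong:
  assumes "open S" "\<And>x. x \<in> S \<Longrightarrow> f x = g x" "Ck_on n S f"
  shows "Ck_on n S g"
proof (cases n)
  case 0
  then show ?thesis using assms continuous_on_cong[of S S f g] by simp
next
  case (Suc k)
  then obtain f' where f': "\<And>x. x \<in> S \<Longrightarrow> (f has_derivative f' x) (at x)" "\<And>v. Ck_on k S (\<lambda>x. f' x v)"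
    using assms(3) by auto
  have "(g has_derivative f' x) (at x)" if "x \<in> S" for x
    using has_derivative_transform_within_open[OF f'(1)[OF that] assms(1) that] assms(2) by blast
  then show ?thesis using Suc f'(2) by auto
qed

lemma has_derivative_eventually_cong:
  assumes "(f has_derivative D) (at x)" "\<forall>\<^sub>F u in nhds x. f u = g u"
  shows "(g has_derivative D) (at x)"
proof (rule has_derivative_transform_eventually[OF assms(1)])
  show "\<forall>\<^sub>F u in at x. f u = g u" using assms(2) by (simp add: eventually_nhds_conv_at)
  show "f x = g x" using assms(2) by (rule eventually_nhds_x_imp_x)
qed simp

lemma chart_inv_left: "is_chart T c \<Longrightarrow> x \<in> fst c \<Longrightarrow> chart_inv c (snd c x) = x"
proof -
  assume c: "is_chart T c" and x: "x \<in> fst c"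
  have "topspace (subtopology T (fst c)) = fst c"
    using c by (auto simp: is_chart_def dest: openin_subset)
  then have "inj_on (snd c) (fst c)"
    using c homeomorphic_imp_injective_map unfolding is_chart_def by metis
  then show ?thesis using x by (simp add: chart_inv_def)
qed

lemma chart_inv_right:
  assumes "u \<in> snd c ` fst c"
  shows "snd c (chart_inv c u) = u" "chart_inv c u \<in> fst c"
  using assms by (simp_all add: chart_inv_def f_inv_into_f inv_into_into)

lemma open_chart_image: "is_chart T c \<Longrightarrow> open (snd c ` fst c)"
  by (simp add: is_chart_def)

lemma continuous_map_chart_inv:
  assumes "is_chart T c"
  shows "continuous_map (top_of_set (snd c ` fst c)) T (chart_inv c)"
proof -
  have top: "topspace (subtopology T (fst c)) = fst c"
    using assms by (auto simp: is_chart_def dest: openin_subset)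
  obtain g where g: "homeomorphic_maps (subtopology T (fst c)) (top_of_set (snd c ` fst c)) (snd c) g"
    using assms unfolding is_chart_def homeomorphic_map_maps by blast
  then have "continuous_map (top_of_set (snd c ` fst c)) T g"
    by (auto simp: homeomorphic_maps_def intro: continuous_map_into_fulltopology)
  moreover have "g u = chart_inv c u" if "u \<in> snd c ` fst c" for u
    using g that top chart_inv_left[OF assms] unfolding homeomorphic_maps_def by force
  ultimately show ?thesis by (auto intro: continuous_map_eq)
qed

lemma eventually_chart_inv:
  assumes c: "is_chart T c" and "x \<in> fst c" "openin T V" "x \<in> V"
  shows "\<forall>\<^sub>F u in nhds (snd c x). u \<in> snd c ` fst c \<and> chart_inv c u \<in> V"
proof -
  let ?U = "{u \<in> snd c ` fst c. chart_inv c u \<in> V}"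
  have "openin (top_of_set (snd c ` fst c)) ?U"
    using openin_continuous_map_preimage[OF continuous_map_chart_inv[OF c] assms(3)] by simp
  then have "open ?U" using openin_open_trans open_chart_image[OF c] by blast
  moreover have "snd c x \<in> ?U" using assms chart_inv_left[OF c] by auto
  ultimately show ?thesis unfolding eventually_nhds by (intro exI[of _ ?U]) simp
qed

text \<open>
  The chain rule for \<open>F \<circ> \<gamma>\<close> through a chart of the intermediate manifold; \<open>\<gamma>\<close> and \<open>F\<close> may start and
  end in any normed space.
\<close>

lemma chart_chain:
  assumes d: "is_chart T d"
    and \<gamma>: "((\<lambda>u. snd d (\<gamma> u)) has_derivative D1) (at u0)" "\<forall>\<^sub>F u in nhds u0. \<gamma> u \<in> fst d"
    and F: "((\<lambda>w. F (chart_inv d w)) has_derivative D2) (at (snd d (\<gamma> u0)))"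
  shows "((\<lambda>u. F (\<gamma> u)) has_derivative (\<lambda>v. D2 (D1 v))) (at u0)"
proof (rule has_derivative_eventually_cong)
  show "((\<lambda>u. F (chart_inv d (snd d (\<gamma> u)))) has_derivative (\<lambda>v. D2 (D1 v))) (at u0)"
    by (rule has_derivative_compose[OF \<gamma>(1) F])
  show "\<forall>\<^sub>F u in nhds u0. F (chart_inv d (snd d (\<gamma> u))) = F (\<gamma> u)"
    using \<gamma>(2) by (rule eventually_mono) (simp add: chart_inv_left[OF d])
qed

lemma smooth_map_differentiable:
  assumes "smooth_map T A T' A' f" "c \<in> A" "d \<in> A'" "x \<in> fst c" "f x \<in> fst d"
  shows "(snd d \<circ> f \<circ> chart_inv c) differentiable (at (snd c x))"
proof -
  have "Ck_on 1 (snd c ` {x \<in> fst c. f x \<in> fst d}) (snd d \<circ> f \<circ> chart_inv c)"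
    using assms unfolding smooth_map_def smooth_on_def by blast
  then show ?thesis using assms by (auto simp: differentiable_def)
qed

section \<open>Maps between Euclidean spaces\<close>

lemma linear_basis_sum:
  fixes f :: "'x::euclidean_space \<Rightarrow> 'y::real_vector"
  assumes "linear f"
  shows "f x = (\<Sum>b\<in>Basis. (x \<bullet> b) *\<^sub>R f b)"
proof -
  have "f x = f (\<Sum>b\<in>Basis. (x \<bullet> b) *\<^sub>R b)" by (simp add: euclidean_representation)
  then show ?thesis by (simp add: linear_sum[OF assms] linear_scale[OF assms])
qed

text \<open>
  At a point of the ball where \<open>norm F\<close> attains its maximum \<open>M\<close>, the mean value inequality gives
  \<open>M \<le> K M r \<le> M / 2\<close>.
\<close>

lemma zero_on_cball_if_derivative_bound:
  fixes F :: "'x::euclidean_space \<Rightarrow> 'v::real_normed_vector"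
  assumes r: "r > 0" "K * r \<le> 1 / 2" "K \<ge> 0" and F0: "F e = 0"
    and D: "\<And>u. u \<in> cball e r \<Longrightarrow> \<exists>D. (F has_derivative D) (at u) \<and> (\<forall>w. norm (D w) \<le> norm w * (K * norm (F u)))"
    and u: "u \<in> cball e r"
  shows "F u = 0"
proof -
  obtain F' where F': "\<And>u. u \<in> cball e r \<Longrightarrow> (F has_derivative F' u) (at u)"
    "\<And>u w. u \<in> cball e r \<Longrightarrow> norm (F' u w) \<le> norm w * (K * norm (F u))"
    using D by metis
  have "continuous_on (cball e r) (\<lambda>u. norm (F u))"
    using F'(1) by (intro continuous_on_norm) (meson continuous_at_imp_continuous_on has_derivative_continuous)
  then obtain m where m: "m \<in> cball e r" "\<And>u. u \<in> cball e r \<Longrightarrow> norm (F u) \<le> norm (F m)"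
    using continuous_attains_sup[of "cball e r" "\<lambda>u. norm (F u)"] r by fastforce
  have "norm (F m - F e) \<le> (K * norm (F m)) * norm (m - e)"
  proof (rule differentiable_bound[OF convex_cball])
    fix x assume x: "x \<in> cball e r"
    show "(F has_derivative F' x) (at x within cball e r)" using F'(1)[OF x] by (rule has_derivative_at_withinI)
    show "onorm (F' x) \<le> K * norm (F m)"
    proof (rule onorm_bound)
      show "norm (F' x w) \<le> K * norm (F m) * norm w" for w
        using F'(2)[OF x, of w] m(2)[OF x] r(3) 
          mult_left_mono[OF mult_left_mono[OF m(2)[OF x] r(3)] norm_ge_zero[of w]] by (simp add: mult_ac)
    qed (use r in simp)
  qed (use m r in auto)
  also have "\<dots> \<le> (K * norm (F m)) * r"
    using m(1) r by (intro mult_left_mono) (auto simp: dist_norm norm_minus_commute)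
  also have "\<dots> = (K * r) * norm (F m)" by simp
  also have "\<dots> \<le> 1 / 2 * norm (F m)" using r by (intro mult_right_mono) auto
  finally have "norm (F m) \<le> 0" using F0 by simp
  then show ?thesis using m(2)[OF u] by simp
qed

section \<open>Lie groups and the adjoint representation\<close>

locale real_lie_group =
  fixes G :: "('g, 'm) monoid_scheme" (structure) and T :: "'g topology"
    and A :: "('g, 'e::euclidean_space) chart set"
  assumes lie_group: "lie_group G T A"
begin

sublocale group G
  using lie_group by (simp add: lie_group_def)

lemma topspace: "topspace T = carrier G"
  using lie_group by (simp add: lie_group_def)

lemma is_chart: "c \<in> A \<Longrightarrow> is_chart T c"
  using lie_group by (simp add: lie_group_def smooth_manifold_def)

lemma chart_carrier: "c \<in> A \<Longrightarrow> x \<in> fst c \<Longrightarrow> x \<in> carrier G"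
  using is_chart topspace openin_subset[of T "fst c"] by (auto simp: is_chart_def)

lemma openin_chart: "c \<in> A \<Longrightarrow> openin T (fst c)"
  using is_chart by (simp add: is_chart_def)

lemma chart_around: "x \<in> carrier G \<Longrightarrow> \<exists>c\<in>A. x \<in> fst c"
  using lie_group topspace by (auto simp: lie_group_def smooth_manifold_def)

lemma continuous_mult: "continuous_map (prod_topology T T) T (\<lambda>(x, y). x \<otimes> y)"
  using lie_group by (simp add: lie_group_def smooth_map_def)

lemma continuous_inv: "continuous_map T T (m_inv G)"
  using lie_group by (simp add: lie_group_def smooth_map_def)

lemma continuous_left_mult: "g \<in> carrier G \<Longrightarrow> continuous_map T T (\<lambda>x. g \<otimes> x)"
  using continuous_map_compose[OF continuous_map_pairedI[of T T "\<lambda>_. g" T "\<lambda>x. x"] continuous_mult]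
  by (simp add: o_def topspace)

lemma continuous_right_mult: "g \<in> carrier G \<Longrightarrow> continuous_map T T (\<lambda>x. x \<otimes> g)"
  using continuous_map_compose[OF continuous_map_pairedI[of T T "\<lambda>x. x" T "\<lambda>_. g"] continuous_mult]
  by (simp add: o_def topspace)

lemma eventually_chart_inv_map:
  assumes "c \<in> A" "x \<in> fst c" "continuous_map T T f" "openin T V" "f x \<in> V"
  shows "\<forall>\<^sub>F u in nhds (snd c x). u \<in> snd c ` fst c \<and> f (chart_inv c u) \<in> V"
proof -
  have "openin T {x \<in> topspace T. f x \<in> V}"
    using assms by (intro openin_continuous_map_preimage)
  then have "\<forall>\<^sub>F u in nhds (snd c x). u \<in> snd c ` fst c \<and> chart_inv c u \<in> {x \<in> topspace T. f x \<in> V}"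
    using assms by (intro eventually_chart_inv) (auto simp: is_chart topspace chart_carrier)
  then show ?thesis by (rule eventually_mono) simp
qed

text \<open>
  The multiplication in two charts, with separate coordinates. It coincides with the coordinate
  expression in the product atlas on \<open>mult_dom\<close>.
\<close>

definition mult_coord :: "('g, 'e) chart \<Rightarrow> ('g, 'e) chart \<Rightarrow> ('g, 'e) chart \<Rightarrow> 'e \<times> 'e \<Rightarrow> 'e" where
  "mult_coord c c' d = (\<lambda>(u, v). snd d (chart_inv c u \<otimes> chart_inv c' v))"

definition mult_dom :: "('g, 'e) chart \<Rightarrow> ('g, 'e) chart \<Rightarrow> ('g, 'e) chart \<Rightarrow> ('e \<times> 'e) set" where
  "mult_dom c c' d = {(u, v). u \<in> snd c ` fst c \<and> v \<in> snd c' ` fst c' \<and> chart_inv c u \<otimes> chart_inv c' v \<in> fst d}"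

lemma open_mult_dom:
  assumes "c \<in> A" "c' \<in> A" "d \<in> A"
  shows "open (mult_dom c c' d)"
proof -
  let ?S = "(snd c ` fst c) \<times> (snd c' ` fst c')"
  have "continuous_map (top_of_set ?S) T (chart_inv c \<circ> fst)"
    by (rule continuous_map_compose[OF _ continuous_map_chart_inv[OF is_chart[OF assms(1)]]])
      (auto intro: continuous_intros)
  moreover have "continuous_map (top_of_set ?S) T (chart_inv c' \<circ> snd)"
    by (rule continuous_map_compose[OF _ continuous_map_chart_inv[OF is_chart[OF assms(2)]]])
      (auto intro: continuous_intros)
  ultimately have "continuous_map (top_of_set ?S) (prod_topology T T) (\<lambda>z. (chart_inv c (fst z), chart_inv c' (snd z)))"
    by (auto intro: continuous_map_pairedI simp: o_def)
  from continuous_map_compose[OF this continuous_mult]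
  have "continuous_map (top_of_set ?S) T (\<lambda>z. chart_inv c (fst z) \<otimes> chart_inv c' (snd z))"
    by (simp add: o_def)
  from openin_continuous_map_preimage[OF this openin_chart[OF assms(3)]]
  have "openin (top_of_set ?S) (mult_dom c c' d)"
    by (simp add: mult_dom_def case_prod_unfold mem_Times_iff conj_assoc)
  moreover have "open ?S"
    using assms by (intro open_Times open_chart_image[OF is_chart])
  ultimately show ?thesis using openin_open_trans by blast
qed

lemma mult_coord_Ck:
  assumes "c \<in> A" "c' \<in> A" "d \<in> A"
  shows "Ck_on n (mult_dom c c' d) (mult_coord c c' d)"
proof -
  let ?p = "(fst c \<times> fst c', map_prod (snd c) (snd c'))"
  have "?p \<in> prod_atlas A A" using assms unfolding prod_atlas_def by blast
  then have Ck: "Ck_on n (snd ?p ` {x \<in> fst ?p. (\<lambda>(x, y). x \<otimes> y) x \<in> fst d}) (snd d \<circ> (\<lambda>(x, y). x \<otimes> y) \<circ> chart_inv ?p)"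
    using lie_group assms(3) unfolding lie_group_def smooth_map_def smooth_on_def by blast
  have S: "snd ?p ` {x \<in> fst ?p. (\<lambda>(x, y). x \<otimes> y) x \<in> fst d} = mult_dom c c' d"
  proof (rule equalityI; rule subsetI)
    fix z assume "z \<in> snd ?p ` {x \<in> fst ?p. (\<lambda>(x, y). x \<otimes> y) x \<in> fst d}"
    then show "z \<in> mult_dom c c' d"
      by (auto simp: mult_dom_def chart_inv_left[OF is_chart[OF assms(1)]] chart_inv_left[OF is_chart[OF assms(2)]])
  next
    fix z assume "z \<in> mult_dom c c' d"
    then show "z \<in> snd ?p ` {x \<in> fst ?p. (\<lambda>(x, y). x \<otimes> y) x \<in> fst d}"
      by (intro image_eqI[of _ _ "(chart_inv c (fst z), chart_inv c' (snd z))"])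
        (auto simp: mult_dom_def chart_inv_right simp del: image_iff)
  qed
  have inv: "chart_inv ?p z = (chart_inv c (fst z), chart_inv c' (snd z))" if "z \<in> mult_dom c c' d" for z
  proof -
    have "inj_on (snd ?p) (fst ?p)"
      using chart_inv_left[OF is_chart[OF assms(1)]] chart_inv_left[OF is_chart[OF assms(2)]]
      by (auto intro!: inj_onI) metis+
    moreover have "z \<in> snd ?p ` fst ?p" using that[folded S] by blast
    ultimately show ?thesis
      unfolding chart_inv_def using that
      by (intro inv_into_f_eq) (auto simp: mult_dom_def f_inv_into_f inv_into_into simp del: image_iff)
  qed
  show ?thesis
    by (rule Ck_on_cong[OF open_mult_dom[OF assms] _ Ck[unfolded S]])
      (simp add: inv mult_coord_def case_prod_unfold)
qed

lemma mult_coord_deriv: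
  assumes "c \<in> A" "c' \<in> A" "d \<in> A"
  shows "\<exists>M'. \<forall>z\<in>mult_dom c c' d. (mult_coord c c' d has_derivative M' z) (at z) \<and>
    (\<forall>v. (\<lambda>z. M' z v) differentiable (at z))"
proof -
  obtain M' where M': "\<And>z. z \<in> mult_dom c c' d \<Longrightarrow> (mult_coord c c' d has_derivative M' z) (at z)"
    "\<And>v. Ck_on 1 (mult_dom c c' d) (\<lambda>z. M' z v)"
    using mult_coord_Ck[OF assms, of 2] by (auto simp: numeral_2_eq_2)
  have "(\<lambda>z. M' z v) differentiable (at z)" if "z \<in> mult_dom c c' d" for z v
    using M'(2)[of v] that by (auto simp: differentiable_def)
  then show ?thesis using M'(1) by blast
qed

lemma left_mult_differentiable:
  assumes "g \<in> carrier G" "c \<in> A" "x \<in> fst c" "d \<in> A" "g \<otimes> x \<in> fst d"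
  shows "(\<lambda>u. snd d (g \<otimes> chart_inv c u)) differentiable (at (snd c x))"
proof -
  obtain b where b: "b \<in> A" "g \<in> fst b" using chart_around assms(1) by blast
  have bg: "chart_inv b (snd b g) = g" "chart_inv c (snd c x) = x"
    using b assms chart_inv_left[OF is_chart] by blast+
  have "(snd b g, snd c x) \<in> mult_dom b c d" using b assms bg by (simp add: mult_dom_def)
  then obtain D where "(mult_coord b c d has_derivative D) (at (snd b g, snd c x))"
    using mult_coord_deriv[OF b(1) assms(2,4)] by blast
  then have "((\<lambda>u. mult_coord b c d (snd b g, u)) has_derivative (\<lambda>u. D (0, u))) (at (snd c x))"
    by (rule has_derivative_compose[rotated]) (auto intro!: derivative_eq_intros)
  then show ?thesis by (auto simp: mult_coord_def bg differentiable_def)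
qed

lemma right_mult_differentiable:
  assumes "g \<in> carrier G" "c \<in> A" "x \<in> fst c" "d \<in> A" "x \<otimes> g \<in> fst d"
  shows "(\<lambda>u. snd d (chart_inv c u \<otimes> g)) differentiable (at (snd c x))"
proof -
  obtain b where b: "b \<in> A" "g \<in> fst b" using chart_around assms(1) by blast
  have bg: "chart_inv b (snd b g) = g" "chart_inv c (snd c x) = x"
    using b assms chart_inv_left[OF is_chart] by blast+
  have "(snd c x, snd b g) \<in> mult_dom c b d" using b assms bg by (simp add: mult_dom_def)
  then obtain D where "(mult_coord c b d has_derivative D) (at (snd c x, snd b g))"
    using mult_coord_deriv[OF assms(2) b(1) assms(4)] by blast
  then have "((\<lambda>u. mult_coord c b d (u, snd b g)) has_derivative (\<lambda>u. D (u, 0))) (at (snd c x))"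
    by (rule has_derivative_compose[rotated]) (auto intro!: derivative_eq_intros)
  then show ?thesis by (auto simp: mult_coord_def bg differentiable_def)
qed

lemma inv_differentiable:
  assumes "c \<in> A" "x \<in> fst c" "d \<in> A" "inv x \<in> fst d"
  shows "(\<lambda>u. snd d (inv (chart_inv c u))) differentiable (at (snd c x))"
  using smooth_map_differentiable[of T A T A "m_inv G" c d x] lie_group assms
  by (simp add: lie_group_def o_def)

text \<open>
  Conjugation is a left translation followed by a right one; a chart around \<open>g\<close> links the two.
\<close>

lemma conjugation_chart_derivative:
  assumes "g \<in> carrier G" "c \<in> A" "\<one> \<in> fst c"
  shows "((\<lambda>u. snd c (g \<otimes> chart_inv c u \<otimes> inv g)) has_derivative Ad_chart G c g) (at (snd c \<one>))"
proof -
  obtain d where d: "d \<in> A" "g \<in> fst d" using chart_around assms(1) by blast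
  have one: "chart_inv c (snd c \<one>) = \<one>" using chart_inv_left[OF is_chart] assms by blast
  obtain D1 where D1: "((\<lambda>u. snd d (g \<otimes> chart_inv c u)) has_derivative D1) (at (snd c \<one>))"
    using left_mult_differentiable[of g c \<one> d] assms d unfolding differentiable_def by auto
  obtain D2 where D2: "((\<lambda>w. snd c (chart_inv d w \<otimes> inv g)) has_derivative D2) (at (snd d g))"
    using right_mult_differentiable[of "inv g" d g c] assms d unfolding differentiable_def by auto
  have "((\<lambda>u. snd c ((g \<otimes> chart_inv c u) \<otimes> inv g)) has_derivative (\<lambda>v. D2 (D1 v))) (at (snd c \<one>))"
  proof (rule chart_chain[OF is_chart[OF d(1)] D1])
    have "\<forall>\<^sub>F u in nhds (snd c \<one>). u \<in> snd c ` fst c \<and> g \<otimes> chart_inv c u \<in> fst d"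
      using assms d by (intro eventually_chart_inv_map continuous_left_mult openin_chart) auto
    then show "\<forall>\<^sub>F u in nhds (snd c \<one>). g \<otimes> chart_inv c u \<in> fst d" by (rule eventually_mono) simp
    show "((\<lambda>w. snd c (chart_inv d w \<otimes> inv g)) has_derivative D2) (at (snd d (g \<otimes> chart_inv c (snd c \<one>))))"
      using D2 one assms(1) by simp
  qed
  then have "(\<lambda>u. snd c (g \<otimes> chart_inv c u \<otimes> inv g)) differentiable (at (snd c \<one>))"
    unfolding differentiable_def by blast
  then show ?thesis
    unfolding frechet_derivative_works by (simp add: Ad_chart_def chart_deriv_def o_def)
qed

lemma eventually_chart_inv_carrier:
  assumes "c \<in> A" "x \<in> fst c"
  shows "\<forall>\<^sub>F u in nhds (snd c x). chart_inv c u \<in> carrier G \<and> chart_inv c u \<in> fst c \<and> snd c (chart_inv c u) = u"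
proof -
  have "\<forall>\<^sub>F u in nhds (snd c x). u \<in> snd c ` fst c"
    using assms open_chart_image[OF is_chart] by (intro eventually_nhds_in_open) auto
  then show ?thesis by (rule eventually_mono) (simp only: chart_inv_right chart_carrier[OF assms(1)] simp_thms)
qed

lemma linear_Ad_chart: "g \<in> carrier G \<Longrightarrow> c \<in> A \<Longrightarrow> \<one> \<in> fst c \<Longrightarrow> linear (Ad_chart G c g)"
  using conjugation_chart_derivative has_derivative_linear by blast

lemma Ad_chart_one:
  assumes "c \<in> A" "\<one> \<in> fst c"
  shows "Ad_chart G c \<one> = (\<lambda>v. v)"
proof -
  have "((\<lambda>u. snd c (\<one> \<otimes> chart_inv c u \<otimes> inv \<one>)) has_derivative (\<lambda>v. v)) (at (snd c \<one>))"
    by (rule has_derivative_eventually_cong[OF has_derivative_ident], 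
        rule eventually_mono[OF eventually_chart_inv_carrier[OF assms]]) simp
  then show ?thesis
    using conjugation_chart_derivative[OF one_closed assms] has_derivative_unique by blast
qed

lemma Ad_chart_mult:
  assumes g: "g \<in> carrier G" and h: "h \<in> carrier G" and c: "c \<in> A" "\<one> \<in> fst c"
  shows "Ad_chart G c (g \<otimes> h) = (\<lambda>v. Ad_chart G c g (Ad_chart G c h v))"
proof -
  have one: "chart_inv c (snd c \<one>) = \<one>" using chart_inv_left[OF is_chart] c by blast
  let ?\<gamma> = "\<lambda>u. h \<otimes> chart_inv c u \<otimes> inv h"
  have cont: "continuous_map T T (\<lambda>x. h \<otimes> x \<otimes> inv h)"
    using continuous_map_compose[OF continuous_left_mult[OF h] continuous_right_mult[OF inv_closed[OF h]]]
    by (simp add: o_def)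
  have "((\<lambda>u. snd c (g \<otimes> ?\<gamma> u \<otimes> inv g)) has_derivative (\<lambda>v. Ad_chart G c g (Ad_chart G c h v))) (at (snd c \<one>))"
  proof (rule chart_chain[OF is_chart[OF c(1)] conjugation_chart_derivative[OF h c]])
    have "\<forall>\<^sub>F u in nhds (snd c \<one>). u \<in> snd c ` fst c \<and> ?\<gamma> u \<in> fst c"
      using c h by (intro eventually_chart_inv_map cont openin_chart) auto
    then show "\<forall>\<^sub>F u in nhds (snd c \<one>). ?\<gamma> u \<in> fst c" by (rule eventually_mono) simp
    show "((\<lambda>w. snd c (g \<otimes> chart_inv c w \<otimes> inv g)) has_derivative Ad_chart G c g) (at (snd c (?\<gamma> (snd c \<one>))))"
      using conjugation_chart_derivative[OF g c] one h by simp
  qed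
  then have "((\<lambda>u. snd c (g \<otimes> h \<otimes> chart_inv c u \<otimes> inv (g \<otimes> h))) has_derivative (\<lambda>v. Ad_chart G c g (Ad_chart G c h v))) (at (snd c \<one>))"
    by (rule has_derivative_eventually_cong, intro eventually_mono[OF eventually_chart_inv_carrier[OF c]])
      (simp add: g h m_assoc inv_mult_group)
  then show ?thesis
    using conjugation_chart_derivative[OF m_closed[OF g h] c] has_derivative_unique by blast
qed

lemma eventually_inv_chart:
  assumes c: "c \<in> A" "\<one> \<in> fst c"
  shows "\<forall>\<^sub>F u in nhds (snd c \<one>). u \<in> snd c ` fst c \<and> inv (chart_inv c u) \<in> fst c"
  using c by (intro eventually_chart_inv_map continuous_inv openin_chart) auto

text \<open>
  With \<open>M\<close> the multiplication and \<open>\<iota>\<close> the inversion in the chart, conjugation by the point \<open>u\<close> is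
  \<open>v \<mapsto> M (M (u, v), \<iota> u)\<close>. Its derivative at the unit consists of partial derivatives of \<open>M\<close>, which
  are themselves differentiable as \<open>M\<close> is twice differentiable.
\<close>

lemma Ad_chart_differentiable:
  assumes c: "c \<in> A" "\<one> \<in> fst c"
  shows "(\<lambda>u. Ad_chart G c (chart_inv c u) w) differentiable (at (snd c \<one>))"
proof -
  define e where "e = snd c \<one>"
  define \<iota> where "\<iota> u = snd c (inv (chart_inv c u))" for u
  have e: "chart_inv c e = \<one>" "\<iota> e = e" "e \<in> snd c ` fst c"
    using chart_inv_left[OF is_chart] c by (auto simp: e_def \<iota>_def)
  obtain D\<iota> where D\<iota>: "(\<iota> has_derivative D\<iota>) (at e)"
    using inv_differentiable[of c \<one> c] c unfolding differentiable_def e_def \<iota>_def by auto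
  obtain M' where M': "\<And>z. z \<in> mult_dom c c c \<Longrightarrow> (mult_coord c c c has_derivative M' z) (at z)"
    and M'': "\<And>z v. z \<in> mult_dom c c c \<Longrightarrow> (\<lambda>z. M' z v) differentiable (at z)"
    using mult_coord_deriv[OF c(1) c(1) c(1)] by blast
  have ee: "(e, e) \<in> mult_dom c c c" using e c by (auto simp: mult_dom_def)
  have Ad: "Ad_chart G c (chart_inv c u) w = M' (u, \<iota> u) (M' (u, e) (0, w), 0)"
    and dom: "(u, \<iota> u) \<in> mult_dom c c c"
    if u: "u \<in> snd c ` fst c" "inv (chart_inv c u) \<in> fst c" for u
  proof -
    define g where "g = chart_inv c u"
    have g: "g \<in> carrier G" "g \<in> fst c" "snd c g = u" "chart_inv c u = g"
      using chart_inv_right[OF u(1)] c chart_carrier by (auto simp: g_def)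
    have i: "chart_inv c (\<iota> u) = inv g" 
      using chart_inv_left[OF is_chart[OF c(1)] u(2)] by (simp add: \<iota>_def g_def)
    show dom: "(u, \<iota> u) \<in> mult_dom c c c"
      using u g i c by (auto simp: mult_dom_def \<iota>_def)
    have dom1: "(u, e) \<in> mult_dom c c c" using u(1) g e by (auto simp: mult_dom_def)
    have d1: "((\<lambda>v. snd c (g \<otimes> chart_inv c v)) has_derivative (\<lambda>v. M' (u, e) (0, v))) (at e)"
    proof -
      have "((\<lambda>v. mult_coord c c c (u, v)) has_derivative (\<lambda>v. M' (u, e) (0, v))) (at e)"
        by (rule has_derivative_compose[where f = "\<lambda>v. (u, v)", OF _ M'[OF dom1]]) (auto intro!: derivative_eq_intros)
      then show ?thesis by (simp add: mult_coord_def g(4))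
    qed
    have d2: "((\<lambda>v. snd c (chart_inv c v \<otimes> inv g)) has_derivative (\<lambda>v. M' (u, \<iota> u) (v, 0))) (at u)"
    proof -
      have "((\<lambda>v. mult_coord c c c (v, \<iota> u)) has_derivative (\<lambda>v. M' (u, \<iota> u) (v, 0))) (at u)"
        by (rule has_derivative_compose[where f = "\<lambda>v. (v, \<iota> u)", OF _ M'[OF dom]]) (auto intro!: derivative_eq_intros)
      then show ?thesis by (simp add: mult_coord_def i)
    qed
    have "((\<lambda>v. snd c (g \<otimes> chart_inv c v \<otimes> inv g)) has_derivative (\<lambda>v. M' (u, \<iota> u) (M' (u, e) (0, v), 0))) (at e)"
    proof (rule chart_chain[OF is_chart[OF c(1)] d1])
      have "\<forall>\<^sub>F v in nhds e. v \<in> snd c ` fst c \<and> g \<otimes> chart_inv c v \<in> fst c"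
        unfolding e_def using c g by (intro eventually_chart_inv_map continuous_left_mult openin_chart) auto
      then show "\<forall>\<^sub>F v in nhds e. g \<otimes> chart_inv c v \<in> fst c" by (rule eventually_mono) simp
      show "((\<lambda>v. snd c (chart_inv c v \<otimes> inv g)) has_derivative (\<lambda>v. M' (u, \<iota> u) (v, 0))) (at (snd c (g \<otimes> chart_inv c e)))"
        using d2 g e by simp
    qed
    then have "Ad_chart G c g = (\<lambda>v. M' (u, \<iota> u) (M' (u, e) (0, v), 0))"
      using conjugation_chart_derivative[OF g(1) c] has_derivative_unique unfolding e_def by blast
    then show "Ad_chart G c (chart_inv c u) w = M' (u, \<iota> u) (M' (u, e) (0, w), 0)"
      by (simp add: g_def)
  qed
  \<comment> \<open>Differentiability of \<open>M'\<close> is known for fixed directions only, so the inner derivative is expanded.\<close>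
  have expand: "M' (u, \<iota> u) (M' (u, e) (0, w), 0) = (\<Sum>b\<in>Basis. (M' (u, e) (0, w) \<bullet> b) *\<^sub>R M' (u, \<iota> u) (b, 0))"
    if "(u, \<iota> u) \<in> mult_dom c c c" for u
  proof -
    have "linear (M' (u, \<iota> u))" using M'[OF that] has_derivative_linear by blast
    then have "linear (\<lambda>v. M' (u, \<iota> u) (v, 0))"
      by (rule linear_compose[unfolded o_def, rotated]) (simp add: linear_iff)
    then show ?thesis by (rule linear_basis_sum)
  qed
  have pair1: "((\<lambda>u. (u, e)) has_derivative (\<lambda>v. (v, 0))) (at e)" by (auto intro!: derivative_eq_intros)
  have pair2: "((\<lambda>u. (u, \<iota> u)) has_derivative (\<lambda>v. (v, D\<iota> v))) (at e)"
    using D\<iota> by (auto intro!: derivative_eq_intros)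
  have "(\<lambda>u. M' (u, e) v) differentiable (at e)" for v
  proof -
    obtain D where "((\<lambda>z. M' z v) has_derivative D) (at (e, e))"
      using M''[OF ee] unfolding differentiable_def by blast
    from has_derivative_compose[OF pair1 this] show ?thesis unfolding differentiable_def by blast
  qed
  moreover have "(\<lambda>u. M' (u, \<iota> u) v) differentiable (at e)" for v
  proof -
    obtain D where "((\<lambda>z. M' z v) has_derivative D) (at (e, \<iota> e))"
      using M''[OF ee, of v] unfolding e(2) differentiable_def by blast
    from has_derivative_compose[OF pair2 this] show ?thesis unfolding differentiable_def by blast
  qed
  ultimately have "(\<lambda>u. \<Sum>b\<in>Basis. (M' (u, e) (0, w) \<bullet> b) *\<^sub>R M' (u, \<iota> u) (b, 0)) differentiable (at e)"
    by (intro differentiable_sum differentiable_scaleR differentiable_inner finite_Basis differentiable_const) auto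
  then obtain D where D: "((\<lambda>u. \<Sum>b\<in>Basis. (M' (u, e) (0, w) \<bullet> b) *\<^sub>R M' (u, \<iota> u) (b, 0)) has_derivative D) (at e)"
    unfolding differentiable_def by blast
  have "((\<lambda>u. Ad_chart G c (chart_inv c u) w) has_derivative D) (at e)"
    by (rule has_derivative_eventually_cong[OF D], rule eventually_mono[OF eventually_inv_chart[OF c, folded e_def]])
      (simp add: Ad dom expand)
  then show ?thesis unfolding differentiable_def e_def by blast
qed

section \<open>Functions with a linear self-bound on the derivative\<close>

text \<open>
  Turns statements in the coordinates of one chart around the unit into openness statements
  at every point of the group.
\<close>

lemma chart_neighbourhood:
  assumes "c \<in> A" "\<one> \<in> fst c" "r > 0" "g \<in> carrier G"
  shows "\<exists>N. openin T N \<and> g \<in> N \<and> (\<forall>h\<in>N. \<exists>u\<in>ball (snd c \<one>) r. h = g \<otimes> chart_inv c u)"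
proof -
  let ?V = "{x \<in> topspace (subtopology T (fst c)). snd c x \<in> ball (snd c \<one>) r \<inter> snd c ` fst c}"
  have "continuous_map (subtopology T (fst c)) (top_of_set (snd c ` fst c)) (snd c)"
    using is_chart[OF assms(1)] by (simp add: is_chart_def homeomorphic_imp_continuous_map)
  moreover have "openin (top_of_set (snd c ` fst c)) (ball (snd c \<one>) r \<inter> snd c ` fst c)"
    by (simp add: openin_open_Int Int_commute)
  ultimately have "openin (subtopology T (fst c)) ?V" by (rule openin_continuous_map_preimage)
  then have V: "openin T ?V" using openin_chart[OF assms(1)] openin_trans_full by blast
  let ?N = "{h \<in> topspace T. inv g \<otimes> h \<in> ?V}"
  have "openin T ?N"
    by (rule openin_continuous_map_preimage[OF continuous_left_mult[OF inv_closed[OF assms(4)]] V])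
  moreover have "g \<in> ?N" using assms by (auto simp: topspace)
  moreover have "\<exists>u\<in>ball (snd c \<one>) r. h = g \<otimes> chart_inv c u" if "h \<in> ?N" for h
  proof
    have h: "h \<in> carrier G" "inv g \<otimes> h \<in> fst c" "snd c (inv g \<otimes> h) \<in> ball (snd c \<one>) r"
      using that by (auto simp: topspace)
    show "h = g \<otimes> chart_inv c (snd c (inv g \<otimes> h))"
      using h assms(4) by (simp add: chart_inv_left[OF is_chart[OF assms(1)]] m_assoc[symmetric])
    show "snd c (inv g \<otimes> h) \<in> ball (snd c \<one>) r" by (fact h)
  qed
  ultimately show ?thesis by blast
qed

text \<open>
  The hypothesis differentiates \<open>f\<close> at \<open>g\<close> along \<open>g\<close> times a chart around the unit. To differentiate
  at a nearby point \<open>g h\<close> with \<open>h = chart_inv c u\<close>, write \<open>f (g v) = f (g h (h\<inverse> v))\<close>. The chain rule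
  yields \<open>Tm (M' (\<iota> u, u) (0, w)) (f (g h))\<close>, where the first argument is the logarithmic derivative
  of \<open>u \<mapsto> h\<close>; it is bounded near the unit by continuity of \<open>M'\<close>. The bound \<open>K\<close> and the
  neighbourhood are the same for all \<open>g\<close>.
\<close>

lemma local_derivative_bound:
  fixes f :: "'g \<Rightarrow> 'v::real_normed_vector"
  assumes c: "c \<in> A" "\<one> \<in> fst c" and Tm: "bounded_bilinear Tm"
    and f: "\<And>g. g \<in> carrier G \<Longrightarrow> ((\<lambda>u. f (g \<otimes> chart_inv c u)) has_derivative (\<lambda>w. Tm w (f g))) (at (snd c \<one>))"
  shows "\<exists>K. \<forall>\<^sub>F u in nhds (snd c \<one>). \<forall>g\<in>carrier G. \<exists>D.
    ((\<lambda>u. f (g \<otimes> chart_inv c u)) has_derivative D) (at u) \<and> (\<forall>w. norm (D w) \<le> norm w * (K * norm (f (g \<otimes> chart_inv c u))))"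
proof -
  define e where "e = snd c \<one>"
  define \<iota> where "\<iota> u = snd c (inv (chart_inv c u))" for u
  have e: "chart_inv c e = \<one>" "\<iota> e = e" "e \<in> snd c ` fst c"
    using chart_inv_left[OF is_chart] c by (auto simp: e_def \<iota>_def)
  have \<iota>_cont: "isCont \<iota> e"
    using inv_differentiable[of c \<one> c] c differentiable_imp_continuous_within unfolding e_def \<iota>_def by auto
  obtain M' where M': "\<And>z. z \<in> mult_dom c c c \<Longrightarrow> (mult_coord c c c has_derivative M' z) (at z)"
    and M'': "\<And>z v. z \<in> mult_dom c c c \<Longrightarrow> (\<lambda>z. M' z v) differentiable (at z)"
    using mult_coord_deriv[OF c(1) c(1) c(1)] by blast
  have ee: "(e, e) \<in> mult_dom c c c" using e c by (auto simp: mult_dom_def)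
  have ev_bound: "\<forall>\<^sub>F u in nhds e. \<forall>b\<in>Basis. norm (M' (\<iota> u, u) (0, b)) < norm (M' (e, e) (0, b)) + 1"
  proof (rule eventually_ball_finite[OF finite_Basis], rule ballI)
    fix b :: 'e
    have "isCont (\<lambda>z. M' z (0, b)) (\<iota> e, e)"
      using differentiable_imp_continuous_within[OF M''[OF ee]] e(2) by simp
    then have "isCont (\<lambda>u. M' (\<iota> u, u) (0, b)) e"
      by (rule isCont_o2[rotated]) (intro continuous_intros \<iota>_cont)
    then have "isCont (\<lambda>u. norm (M' (\<iota> u, u) (0, b))) e" by (intro continuous_intros)
    then have "((\<lambda>u. norm (M' (\<iota> u, u) (0, b))) \<longlongrightarrow> norm (M' (e, e) (0, b))) (nhds e)"
      using e(2) by (simp add: continuous_at tendsto_nhds_iff)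
    then show "\<forall>\<^sub>F u in nhds e. norm (M' (\<iota> u, u) (0, b)) < norm (M' (e, e) (0, b)) + 1"
      by (rule order_tendstoD) simp
  qed
  have ev_dom: "\<forall>\<^sub>F u in nhds e. u \<in> snd c ` fst c \<and> inv (chart_inv c u) \<in> fst c"
    unfolding e_def using c by (intro eventually_inv_chart)
  obtain K0 where K0: "K0 > 0" "\<And>w v. norm (Tm w v) \<le> norm w * norm v * K0"
    using bounded_bilinear.pos_bounded[OF Tm] by blast
  define C where "C = (\<Sum>b\<in>(Basis :: 'e set). norm (M' (e, e) (0, b)) + 1)"
  from ev_bound ev_dom have "\<forall>\<^sub>F u in nhds e. \<forall>g\<in>carrier G. \<exists>D.
    ((\<lambda>u. f (g \<otimes> chart_inv c u)) has_derivative D) (at u) \<and>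
    (\<forall>w. norm (D w) \<le> norm w * ((C * K0) * norm (f (g \<otimes> chart_inv c u))))"
  proof eventually_elim
    case (elim u)
    define h where "h = chart_inv c u"
    have h: "h \<in> carrier G" "chart_inv c u = h" "chart_inv c (\<iota> u) = inv h"
      using chart_inv_right[of u c] elim(2) c(1) chart_carrier chart_inv_left[OF is_chart[OF c(1)]]
      by (auto simp: h_def \<iota>_def)
    have dom: "(\<iota> u, u) \<in> mult_dom c c c"
      using elim(2) h c by (auto simp: mult_dom_def \<iota>_def)
    have lin: "linear (\<lambda>w. M' (\<iota> u, u) (0, w))"
      using linear_compose[OF _ has_derivative_linear[OF M'[OF dom]], of "\<lambda>w. (0, w)"]
      by (simp add: o_def linear_iff)
    have bound: "norm (M' (\<iota> u, u) (0, w)) \<le> norm w * C" for w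
    proof -
      have "norm (M' (\<iota> u, u) (0, w)) = norm (\<Sum>b\<in>Basis. (w \<bullet> b) *\<^sub>R M' (\<iota> u, u) (0, b))"
        using linear_basis_sum[OF lin, of w] by simp
      also have "\<dots> \<le> (\<Sum>b\<in>Basis. norm w * (norm (M' (e, e) (0, b)) + 1))"
      proof (rule sum_norm_le)
        fix b :: 'e assume b: "b \<in> Basis"
        then have "norm (M' (\<iota> u, u) (0, b)) \<le> norm (M' (e, e) (0, b)) + 1"
          using elim(1) less_imp_le by blast
        then show "norm ((w \<bullet> b) *\<^sub>R M' (\<iota> u, u) (0, b)) \<le> norm w * (norm (M' (e, e) (0, b)) + 1)"
          using Basis_le_norm[OF b, of w] by (simp add: mult_mono)
      qed
      also have "\<dots> = norm w * C" by (simp add: C_def sum_distrib_left)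
      finally show ?thesis .
    qed
    show ?case
    proof
      fix g assume g: "g \<in> carrier G"
      let ?D = "\<lambda>w. Tm (M' (\<iota> u, u) (0, w)) (f (g \<otimes> h))"
      have d: "((\<lambda>v. snd c (inv h \<otimes> chart_inv c v)) has_derivative (\<lambda>v. M' (\<iota> u, u) (0, v))) (at u)"
      proof -
        have "((\<lambda>v. mult_coord c c c (\<iota> u, v)) has_derivative (\<lambda>v. M' (\<iota> u, u) (0, v))) (at u)"
          by (rule has_derivative_compose[where f = "\<lambda>v. (\<iota> u, v)", OF _ M'[OF dom]]) (auto intro!: derivative_eq_intros)
        then show ?thesis by (simp add: mult_coord_def h)
      qed
      have ev: "\<forall>\<^sub>F v in nhds u. v \<in> snd c ` fst c \<and> inv h \<otimes> chart_inv c v \<in> fst c"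
        using eventually_chart_inv_map[of c h "\<lambda>x. inv h \<otimes> x" "fst c"] elim(2) h c
          chart_inv_right[of u c] by (auto intro: continuous_left_mult openin_chart)
      have "((\<lambda>v. f ((g \<otimes> h) \<otimes> (inv h \<otimes> chart_inv c v))) has_derivative ?D) (at u)"
      proof (rule chart_chain[OF is_chart[OF c(1)] d, where F = "\<lambda>x. f ((g \<otimes> h) \<otimes> x)"])
        show "\<forall>\<^sub>F v in nhds u. inv h \<otimes> chart_inv c v \<in> fst c"
          using ev by (rule eventually_mono) simp
        show "((\<lambda>w. f (g \<otimes> h \<otimes> chart_inv c w)) has_derivative (\<lambda>w. Tm w (f (g \<otimes> h)))) (at (snd c (inv h \<otimes> chart_inv c u)))"
          using f[of "g \<otimes> h"] g h by simp
      qed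
      then have "((\<lambda>v. f (g \<otimes> chart_inv c v)) has_derivative ?D) (at u)"
      proof (rule has_derivative_eventually_cong)
        show "\<forall>\<^sub>F v in nhds u. f ((g \<otimes> h) \<otimes> (inv h \<otimes> chart_inv c v)) = f (g \<otimes> chart_inv c v)"
          using ev
        proof (rule eventually_mono)
          fix v assume v: "v \<in> snd c ` fst c \<and> inv h \<otimes> chart_inv c v \<in> fst c"
          have "chart_inv c v \<in> carrier G"
            by (rule chart_carrier[OF c(1) chart_inv_right(2)[OF conjunct1[OF v]]])
          then have "(g \<otimes> h) \<otimes> (inv h \<otimes> chart_inv c v) = g \<otimes> chart_inv c v"
            using g h(1) m_assoc[of g h] m_assoc[of h "inv h" "chart_inv c v"] by simp
          then show "f ((g \<otimes> h) \<otimes> (inv h \<otimes> chart_inv c v)) = f (g \<otimes> chart_inv c v)"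
            by simp
        qed
      qed
      moreover have "norm (?D w) \<le> norm w * ((C * K0) * norm (f (g \<otimes> h)))" for w
      proof -
        have "norm (?D w) \<le> norm (M' (\<iota> u, u) (0, w)) * norm (f (g \<otimes> h)) * K0" by (rule K0)
        also have "\<dots> \<le> (norm w * C) * norm (f (g \<otimes> h)) * K0"
          using bound[of w] K0(1) by (intro mult_right_mono) auto
        finally show ?thesis by (simp add: mult_ac)
      qed
      ultimately show "\<exists>D. ((\<lambda>u. f (g \<otimes> chart_inv c u)) has_derivative D) (at u) \<and>
          (\<forall>w. norm (D w) \<le> norm w * ((C * K0) * norm (f (g \<otimes> chart_inv c u))))"
        unfolding h(2) by blast
    qed
  qed
  then show ?thesis unfolding e_def by blast
qed

text \<open>
  By the local estimate, a zero of \<open>f\<close> is surrounded by zeros; since \<open>f\<close> is continuous, the set where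
  it does not vanish is open as well, and connectedness decides.
\<close>

lemma vanish_if_equivariant_derivative:
  fixes f :: "'g \<Rightarrow> 'v::real_normed_vector"
  assumes conn: "connected_space T" and c: "c \<in> A" "\<one> \<in> fst c" and Tm: "bounded_bilinear Tm"
    and f: "\<And>g. g \<in> carrier G \<Longrightarrow> ((\<lambda>u. f (g \<otimes> chart_inv c u)) has_derivative (\<lambda>w. Tm w (f g))) (at (snd c \<one>))"
    and f1: "f \<one> = 0" and g: "g \<in> carrier G"
  shows "f g = 0"
proof -
  define e where "e = snd c \<one>"
  have e: "chart_inv c e = \<one>" using chart_inv_left[OF is_chart] c by (auto simp: e_def)
  obtain K where "\<forall>\<^sub>F u in nhds e. \<forall>g\<in>carrier G. \<exists>D.
    ((\<lambda>u. f (g \<otimes> chart_inv c u)) has_derivative D) (at u) \<and> (\<forall>w. norm (D w) \<le> norm w * (K * norm (f (g \<otimes> chart_inv c u))))"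
    using local_derivative_bound[OF c Tm f] unfolding e_def by blast
  then obtain r0 where r0: "r0 > 0" and D: "\<And>u g. dist u e < r0 \<Longrightarrow> g \<in> carrier G \<Longrightarrow> \<exists>D.
    ((\<lambda>u. f (g \<otimes> chart_inv c u)) has_derivative D) (at u) \<and> (\<forall>w. norm (D w) \<le> norm w * (K * norm (f (g \<otimes> chart_inv c u))))"
    unfolding eventually_nhds_metric by blast
  define K' where "K' = max K 0"
  \<comment> \<open>The radius must stay inside the neighbourhood and satisfy \<open>K' r \<le> 1 / 2\<close>.\<close>
  define r where "r = min (r0 / 2) (1 / (2 * (K' + 1)))"
  have K': "K' \<ge> 0" by (simp add: K'_def)
  have "K' * r \<le> K' * (1 / (2 * (K' + 1)))" using K' by (intro mult_left_mono) (auto simp: r_def)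
  also have "\<dots> \<le> 1 / 2" using K' by (simp add: field_simps)
  finally have r: "r > 0" "r < r0" "K' * r \<le> 1 / 2" using r0 K' by (auto simp: r_def)
  have zero: "f (h \<otimes> chart_inv c u) = 0" if h: "h \<in> carrier G" "f h = 0" "u \<in> ball e r" for h u
  proof (rule zero_on_cball_if_derivative_bound[where F = "\<lambda>u. f (h \<otimes> chart_inv c u)", OF r(1,3) K'])
    show "f (h \<otimes> chart_inv c e) = 0" using h e by simp
    show "u \<in> cball e r" using h by simp
    fix v assume "v \<in> cball e r"
    then obtain D where "((\<lambda>u. f (h \<otimes> chart_inv c u)) has_derivative D) (at v)"
       "\<And>w. norm (D w) \<le> norm w * (K * norm (f (h \<otimes> chart_inv c v)))"
      using D[of v h] h r by (auto simp: dist_commute)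
    moreover have "norm w * (K * norm (f (h \<otimes> chart_inv c v))) \<le> norm w * (K' * norm (f (h \<otimes> chart_inv c v)))" for w
      by (intro mult_left_mono mult_right_mono) (auto simp: K'_def)
    ultimately show "\<exists>D. ((\<lambda>u. f (h \<otimes> chart_inv c u)) has_derivative D) (at v) \<and>
       (\<forall>w. norm (D w) \<le> norm w * (K' * norm (f (h \<otimes> chart_inv c v))))"
      by (meson order_trans)
  qed
  have open1: "openin T {h \<in> carrier G. f h = 0}"
  proof (subst openin_subopen, intro ballI)
    fix h assume h: "h \<in> {h \<in> carrier G. f h = 0}"
    then obtain N where N: "openin T N" "h \<in> N" "\<And>x. x \<in> N \<Longrightarrow> \<exists>u\<in>ball e r. x = h \<otimes> chart_inv c u"
      using chart_neighbourhood[OF c r(1), of h] unfolding e_def by blast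
    have "N \<subseteq> {h \<in> carrier G. f h = 0}"
    proof
      fix x assume x: "x \<in> N"
      then have "x \<in> carrier G" using openin_subset[OF N(1)] topspace by auto
      then show "x \<in> {h \<in> carrier G. f h = 0}" using N(3)[OF x] zero h by auto
    qed
    then show "\<exists>N. openin T N \<and> h \<in> N \<and> N \<subseteq> {h \<in> carrier G. f h = 0}" using N by blast
  qed
  have open2: "openin T {h \<in> carrier G. f h \<noteq> 0}"
  proof (subst openin_subopen, intro ballI)
    fix h assume h: "h \<in> {h \<in> carrier G. f h \<noteq> 0}"
    have "isCont (\<lambda>u. f (h \<otimes> chart_inv c u)) e"
      using f[of h] h has_derivative_continuous unfolding e_def by blast
    then have "\<forall>\<^sub>F u in nhds e. f (h \<otimes> chart_inv c u) \<noteq> 0"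
      using h e tendsto_imp_eventually_ne[of "\<lambda>u. f (h \<otimes> chart_inv c u)" _ "nhds e" 0]
      by (auto simp: continuous_at tendsto_nhds_iff)
    then obtain s where s: "s > 0" "\<And>u. u \<in> ball e s \<Longrightarrow> f (h \<otimes> chart_inv c u) \<noteq> 0"
      unfolding eventually_nhds_metric by (auto simp: dist_commute)
    obtain N where N: "openin T N" "h \<in> N" "\<And>x. x \<in> N \<Longrightarrow> \<exists>u\<in>ball e s. x = h \<otimes> chart_inv c u"
      using chart_neighbourhood[OF c s(1), of h] h unfolding e_def by blast
    have "N \<subseteq> {h \<in> carrier G. f h \<noteq> 0}"
    proof
      fix x assume x: "x \<in> N"
      then have "x \<in> carrier G" using openin_subset[OF N(1)] topspace by auto
      then show "x \<in> {h \<in> carrier G. f h \<noteq> 0}" using N(3)[OF x] s by auto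
    qed
    then show "\<exists>N. openin T N \<and> h \<in> N \<and> N \<subseteq> {h \<in> carrier G. f h \<noteq> 0}" using N by blast
  qed
  have cover: "topspace T \<subseteq> {h \<in> carrier G. f h = 0} \<union> {h \<in> carrier G. f h \<noteq> 0}" by (auto simp: topspace)
  have "{h \<in> carrier G. f h = 0} \<noteq> {}" using f1 by blast
  then have "{h \<in> carrier G. f h \<noteq> 0} = {}"
    using conn open1 open2 cover unfolding connected_space_def by blast
  then show ?thesis using g by blast
qed

end

section \<open>Admissibility is an infinitesimal condition\<close>

text \<open>
  The norm serves differentiation. The closure of \<open>q\<close> under the bracket makes the adjoints of
  \<open>ad x\<close> for \<open>x \<in> q\<close> preserve \<open>m\<close>.
\<close>

locale normed_metric_algebra = split_metric_algebra met E br m q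
  for met :: "'h::real_normed_vector \<Rightarrow> 'h \<Rightarrow> real" and E br m q +
  assumes met_bounded: "bounded_bilinear met"
    and q_closed: "\<And>x y. x \<in> q \<Longrightarrow> y \<in> q \<Longrightarrow> br x y \<in> q"
begin

lemma bounded_linear_if_linear:
  fixes f :: "'h \<Rightarrow> 'v::real_normed_vector"
  assumes "linear f"
  shows "bounded_linear f"
proof -
  have "f x = (\<Sum>b\<in>E. met x b *\<^sub>R f b)" for x
  proof -
    have "f x = f (\<Sum>b\<in>E. met x b *\<^sub>R b)" by (simp add: met_expand)
    then show ?thesis by (simp add: linear_sum[OF assms] linear_scale[OF assms])
  qed
  then have eq: "f = (\<lambda>x. \<Sum>b\<in>E. met x b *\<^sub>R f b)" by (rule ext)
  show ?thesis
    by (subst eq) (intro bounded_linear_sum bounded_linear_scaleR_const bounded_bilinear.bounded_linear_left[OF met_bounded])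
qed

lemma bounded_bilinear_if_bilinear:
  fixes B :: "'h \<Rightarrow> 'h \<Rightarrow> 'v::real_normed_vector"
  assumes "bilinear B"
  shows "bounded_bilinear B"
proof -
  obtain K where K: "K > 0" "\<And>x y. norm (met x y) \<le> norm x * norm y * K"
    using bounded_bilinear.pos_bounded[OF met_bounded] by blast
  have "\<exists>C. \<forall>y. norm (B b y) \<le> norm y * C" for b
    using bounded_linear.bounded[OF bounded_linear_if_linear[of "B b"]] assms by (auto simp: bilinear_def)
  then obtain C where C: "\<And>b y. norm (B b y) \<le> norm y * C b" by metis
  show ?thesis
  proof (rule bounded_bilinear.intro)
    show "\<exists>K'. \<forall>x y. norm (B x y) \<le> norm x * norm y * K'"
    proof (intro exI allI)
      fix x y
      have lin: "linear (\<lambda>x. B x y)" using assms by (simp add: bilinear_def)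
      have "B x y = (\<Sum>b\<in>E. met x b *\<^sub>R B b y)"
        using linear_sum[OF lin, of "\<lambda>b. met x b *\<^sub>R b" E] linear_scale[OF lin] by (simp add: met_expand)
      then have "norm (B x y) \<le> (\<Sum>b\<in>E. norm x * norm y * (norm b * K * C b))"
      proof (simp only:, intro sum_norm_le)
        fix b
        have "norm (met x b *\<^sub>R B b y) \<le> (norm x * norm b * K) * (norm y * C b)"
          using K(2)[of x b] C[of b y] K(1) by (simp add: mult_mono)
        then show "norm (met x b *\<^sub>R B b y) \<le> norm x * norm y * (norm b * K * C b)"
          by (simp add: mult_ac)
      qed
      then show "norm (B x y) \<le> norm x * norm y * (\<Sum>b\<in>E. norm b * K * C b)"
        by (simp add: sum_distrib_left)
    qed
  qed (use assms in \<open>simp_all add: bilinear_ladd bilinear_radd bilinear_lmul bilinear_rmul\<close>)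
qed

lemma br_linear: "linear (br x)"
  using br_bilinear by (simp add: bilinear_def)

lemma adj_ad_bilinear: "bilinear (\<lambda>x. adj (br x))"
  unfolding bilinear_def
proof (intro conjI allI)
  show "linear (adj (br x))" for x by (rule linear_adj)
  show "linear (\<lambda>x. adj (br x) v)" for v
    by (rule linearI; rule adj_eqI[OF br_linear])
      (simp_all add: met_simps met_adj[OF br_linear] bilinear_ladd[OF br_bilinear] bilinear_lmul[OF br_bilinear])
qed

text \<open>
  The adjoint of a map that preserves \<open>q\<close> preserves the orthogonal complement \<open>m\<close> of \<open>q\<close>.
\<close>

lemma adj_ad_m:
  assumes "x \<in> q" "y \<in> m"
  shows "adj (br x) y \<in> m"
  by (rule mem_m_if_orth) (use assms q_closed orth in \<open>simp add: met_adj[OF br_linear]\<close>)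

lemma has_derivative_adj:
  assumes "\<And>z. ((\<lambda>u. Ad u z) has_derivative (\<lambda>w. Ad' w z)) (at e)"
  shows "((\<lambda>u. adj (Ad u) v) has_derivative (\<lambda>w. adj (Ad' w) v)) (at e)"
  unfolding adj_def
  by (intro has_derivative_sum has_derivative_scaleR_left
    bounded_linear.has_derivative[OF bounded_bilinear.bounded_linear_right[OF met_bounded]] assms)

end

locale metric_algebra_of_lie_group = normed_metric_algebra met E br m q
  for met :: "'h::real_normed_vector \<Rightarrow> 'h \<Rightarrow> real" and E br m q +
  fixes H :: "'g monoid" and T :: "'g topology" and A :: "('g, 'e::euclidean_space) chart set"
    and c :: "('g, 'e) chart" and L :: "'e \<Rightarrow> 'h"
    and Q :: "'g set" and TQ :: "'g topology" and AQ :: "('g, 'f::euclidean_space) chart set"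
  assumes H: "lie_group H T A" and c: "c \<in> A" "\<one>\<^bsub>H\<^esub> \<in> fst c"
    and L: "lie_algebra_identification H c br L"
    and Q: "lie_subgroup H T A Q TQ AQ" and Q_connected: "connected_space TQ"
    and Q_tangent: "L ` subgroup_tangent H c AQ = q"
begin

sublocale H: real_lie_group H T A
  by unfold_locales (rule H)

sublocale Q: real_lie_group "H\<lparr>carrier := Q\<rparr>" TQ AQ
  by unfold_locales (use Q in \<open>simp add: lie_subgroup_def\<close>)

abbreviation Ad where "Ad \<equiv> Ad_rep H c L"

lemma Q_subgroup: "subgroup Q H"
  using Q by (simp add: lie_subgroup_def)

lemma QD: "g \<in> Q \<Longrightarrow> g \<in> carrier H"
  using Q_subgroup by (rule subgroup.mem_carrier)

lemma L_linear: "linear L" and L_bij: "bij L"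
  using L by (simp_all add: lie_algebra_identification_def)

lemma L_inv: "the_inv L (L u) = u" "L (the_inv L x) = x"
  using L_bij by (simp_all add: the_inv_f_f f_the_inv_into_f bij_is_inj bij_is_surj)

lemma linear_the_inv_L: "linear (the_inv L)"
proof (rule linearI)
  fix x y
  have "L (the_inv L x + the_inv L y) = x + y" by (simp add: linear_add[OF L_linear] L_inv)
  then show "the_inv L (x + y) = the_inv L x + the_inv L y" by (metis L_inv(1))
next
  fix r x
  have "L (r *\<^sub>R the_inv L x) = r *\<^sub>R x" by (simp add: linear_scale[OF L_linear] L_inv)
  then show "the_inv L (r *\<^sub>R x) = r *\<^sub>R the_inv L x" by (metis L_inv(1))
qed

lemma Ad_linear: "g \<in> carrier H \<Longrightarrow> linear (Ad g)"
  unfolding Ad_rep_def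
  by (intro linear_compose[OF linear_the_inv_L] linear_compose[OF _ L_linear] H.linear_Ad_chart c)

lemma Ad_mult: "g \<in> carrier H \<Longrightarrow> h \<in> carrier H \<Longrightarrow> Ad (g \<otimes>\<^bsub>H\<^esub> h) x = Ad g (Ad h x)"
  by (simp add: Ad_rep_def H.Ad_chart_mult c L_inv)

lemma Ad_one: "Ad \<one>\<^bsub>H\<^esub> x = x"
  by (simp add: Ad_rep_def H.Ad_chart_one c L_inv)

text \<open>
  The bracket of the Lie algebra of \<open>H\<close> is by definition the derivative of \<open>Ad\<close> at the unit.
\<close>

lemma Ad_derivative_H:
  "((\<lambda>u. Ad (chart_inv c u) z) has_derivative (\<lambda>w. br (L w) z)) (at (snd c \<one>\<^bsub>H\<^esub>))"
proof -
  let ?f = "\<lambda>u. Ad_chart H c (chart_inv c u) (the_inv L z)"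
  have "(?f has_derivative frechet_derivative ?f (at (snd c \<one>\<^bsub>H\<^esub>))) (at (snd c \<one>\<^bsub>H\<^esub>))"
    using H.Ad_chart_differentiable[OF c] frechet_derivative_works by blast
  then have "((\<lambda>u. L (?f u)) has_derivative (\<lambda>w. L (frechet_derivative ?f (at (snd c \<one>\<^bsub>H\<^esub>)) w))) (at (snd c \<one>\<^bsub>H\<^esub>))"
    by (rule bounded_linear.has_derivative[OF linear_conv_bounded_linear[THEN iffD1, OF L_linear]])
  moreover have "L (frechet_derivative ?f (at (snd c \<one>\<^bsub>H\<^esub>)) w) = br (L w) z" for w
    using L unfolding lie_algebra_identification_def by (simp add: L_inv)
  ultimately show ?thesis by (simp add: Ad_rep_def)
qed

text \<open>
  The tangent map of the inclusion \<open>Q \<rightarrow> H\<close> at the unit, read in a chart \<open>d\<close> of \<open>Q\<close> and in \<open>\<hh>\<close>.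
\<close>

definition incl_deriv :: "('g, 'f) chart \<Rightarrow> 'f \<Rightarrow> 'h" where
  "incl_deriv d w = L (chart_deriv d c (\<lambda>x. x) \<one>\<^bsub>H\<^esub> w)"

context
  fixes d assumes d: "d \<in> AQ" "\<one>\<^bsub>H\<^esub> \<in> fst d"
begin

lemma d_one: "chart_inv d (snd d \<one>\<^bsub>H\<^esub>) = \<one>\<^bsub>H\<^esub>"
  using chart_inv_left[OF Q.is_chart[OF d(1)] d(2)] .

lemma inclusion_derivative:
  "((\<lambda>u. snd c (chart_inv d u)) has_derivative chart_deriv d c (\<lambda>x. x) \<one>\<^bsub>H\<^esub>) (at (snd d \<one>\<^bsub>H\<^esub>))"
proof -
  have "smooth_map TQ AQ T A (\<lambda>x. x)" using Q by (simp add: lie_subgroup_def)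
  from smooth_map_differentiable[OF this d(1) c(1) d(2) c(2)]
  show ?thesis unfolding chart_deriv_def frechet_derivative_works by (simp add: o_def)
qed

lemma incl_deriv_bounded: "bounded_linear (incl_deriv d)"
  unfolding incl_deriv_def
  by (rule bounded_linear_compose[OF linear_conv_bounded_linear[THEN iffD1, OF L_linear]
        has_derivative_bounded_linear[OF inclusion_derivative]])

lemma incl_deriv_q: "incl_deriv d w \<in> q"
  unfolding Q_tangent[symmetric] incl_deriv_def subgroup_tangent_def using d by blast

lemma Ad_derivative:
  "((\<lambda>u. Ad (chart_inv d u) z) has_derivative (\<lambda>w. br (incl_deriv d w) z)) (at (snd d \<one>\<^bsub>H\<^esub>))"
  unfolding incl_deriv_def
proof (rule chart_chain[OF H.is_chart[OF c(1)] inclusion_derivative, where F = "\<lambda>x. Ad x z"])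
  have "continuous_map TQ T (\<lambda>x. x)" using Q by (simp add: lie_subgroup_def smooth_map_def)
  then have "openin TQ {x \<in> topspace TQ. x \<in> fst c}"
    using openin_continuous_map_preimage H.openin_chart[OF c(1)] by blast
  then have "\<forall>\<^sub>F u in nhds (snd d \<one>\<^bsub>H\<^esub>). u \<in> snd d ` fst d \<and> chart_inv d u \<in> {x \<in> topspace TQ. x \<in> fst c}"
    by (rule eventually_chart_inv[OF Q.is_chart[OF d(1)] d(2)])
      (use c(2) Q_subgroup in \<open>simp add: Q.topspace subgroup.one_closed\<close>)
  then show "\<forall>\<^sub>F u in nhds (snd d \<one>\<^bsub>H\<^esub>). chart_inv d u \<in> fst c"
    by (rule eventually_mono) simp
  show "((\<lambda>w. Ad (chart_inv c w) z) has_derivative (\<lambda>w. br (L w) z)) (at (snd c (chart_inv d (snd d \<one>\<^bsub>H\<^esub>))))"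
    unfolding d_one by (rule Ad_derivative_H)
qed

lemma adj_Ad_derivative:
  "((\<lambda>u. adj (Ad (chart_inv d u)) v) has_derivative (\<lambda>w. adj (br (incl_deriv d w)) v)) (at (snd d \<one>\<^bsub>H\<^esub>))"
  by (rule has_derivative_adj[OF Ad_derivative])

lemma adj_Ad_mult_chart:
  assumes "g \<in> Q"
  shows "\<forall>\<^sub>F u in nhds (snd d \<one>\<^bsub>H\<^esub>). \<forall>v. adj (Ad (chart_inv d u)) (adj (Ad g) v) = adj (Ad (g \<otimes>\<^bsub>H\<^esub> chart_inv d u)) v"
  using Q.eventually_chart_inv_carrier[OF d]
proof (rule eventually_mono, intro allI)
  fix u v
  assume "chart_inv d u \<in> carrier (H\<lparr>carrier := Q\<rparr>) \<and> chart_inv d u \<in> fst d \<and> snd d (chart_inv d u) = u"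
  then have h: "chart_inv d u \<in> carrier H" using QD by simp
  show "adj (Ad (chart_inv d u)) (adj (Ad g) v) = adj (Ad (g \<otimes>\<^bsub>H\<^esub> chart_inv d u)) v"
    unfolding adj_adj_comp[OF Ad_linear[OF h] Ad_linear[OF QD[OF assms]]]
    by (simp add: Ad_mult[OF QD[OF assms] h, abs_def])
qed

lemma adj_Ad_one_chart: "adj (Ad (chart_inv d (snd d \<one>\<^bsub>H\<^esub>))) v = v"
proof -
  have "Ad \<one>\<^bsub>H\<^esub> = (\<lambda>x. x)" using Ad_one by blast
  then show ?thesis unfolding d_one by (simp add: adj_id)
qed

lemma adj_ad_incl_bounded:
  assumes "linear f"
  shows "bounded_bilinear (\<lambda>w v. f (adj (br (incl_deriv d w)) v))"
proof -
  have "bilinear (\<lambda>x v. f (adj (br x) v))"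
    using adj_ad_bilinear linear_compose[OF _ assms] unfolding bilinear_def o_def by fast
  from bounded_bilinear.comp1[OF bounded_bilinear_if_bilinear[OF this] incl_deriv_bounded]
  show ?thesis .
qed

lemma adj_Ad_bracket_derivative:
  "((\<lambda>u. adj (Ad (chart_inv d u)) t - br (adj (Ad (chart_inv d u)) y) (adj (Ad (chart_inv d u)) v))
     has_derivative (\<lambda>w. adj (br (incl_deriv d w)) t
       - (br y (adj (br (incl_deriv d w)) v) + br (adj (br (incl_deriv d w)) y) v))) (at (snd d \<one>\<^bsub>H\<^esub>))"
  using has_derivative_diff[OF adj_Ad_derivative[of t]
      bounded_bilinear.FDERIV[OF bounded_bilinear_if_bilinear[OF br_bilinear] adj_Ad_derivative[of y] adj_Ad_derivative[of v]]]
  unfolding adj_Ad_one_chart .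

text \<open>
  It is equivalent that \<open>Ad g\<close> preserves \<open>q\<close>. The function \<open>f g = \<pi> (C g y)\<close>, with \<open>\<pi>\<close> the projection
  onto \<open>q\<close> and \<open>C g\<close> the adjoint of \<open>Ad g\<close>, has derivative \<open>\<pi> (a (C g y)) = \<pi> (a (f g))\<close>, as the
  adjoint \<open>a\<close> of \<open>ad x\<close> preserves \<open>m\<close>. Adjoints turn \<open>Ad (g h) = Ad g Ad h\<close> into
  \<open>C (g h) = C h C g\<close>; this is why the varying factor \<open>h\<close> stands on the right.
\<close>

lemma adj_Ad_m:
  assumes y: "y \<in> m" and g: "g \<in> Q"
  shows "adj (Ad g) y \<in> m"
proof -
  define \<pi> where "\<pi> x = x - proj x" for x
  have \<pi>: "linear \<pi>" unfolding \<pi>_def by (intro linear_compose_sub linear_proj linear_id[unfolded id_def])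
  have \<pi>m: "\<pi> x = 0" if "x \<in> m" for x using that by (simp add: \<pi>_def proj_m)
  have "\<pi> (adj (Ad g) y) = 0"
  proof (rule Q.vanish_if_equivariant_derivative[where f = "\<lambda>g. \<pi> (adj (Ad g) y)", OF Q_connected d(1) _ adj_ad_incl_bounded[OF \<pi>]])
    show "\<one>\<^bsub>H\<lparr>carrier := Q\<rparr>\<^esub> \<in> fst d" using d by simp
    have "Ad \<one>\<^bsub>H\<^esub> = (\<lambda>x. x)" using Ad_one by blast
    then show "\<pi> (adj (Ad \<one>\<^bsub>H\<lparr>carrier := Q\<rparr>\<^esub>) y) = 0" by (simp add: adj_id \<pi>m y)
    show "g \<in> carrier (H\<lparr>carrier := Q\<rparr>)" using g by simp
    fix g assume "g \<in> carrier (H\<lparr>carrier := Q\<rparr>)"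
    then have g: "g \<in> Q" by simp
    have "((\<lambda>u. \<pi> (adj (Ad (chart_inv d u)) (adj (Ad g) y))) has_derivative (\<lambda>w. \<pi> (adj (br (incl_deriv d w)) (adj (Ad g) y)))) (at (snd d \<one>\<^bsub>H\<^esub>))"
      by (rule bounded_linear.has_derivative[OF bounded_linear_if_linear[OF \<pi>] adj_Ad_derivative])
    then have "((\<lambda>u. \<pi> (adj (Ad (g \<otimes>\<^bsub>H\<^esub> chart_inv d u)) y)) has_derivative (\<lambda>w. \<pi> (adj (br (incl_deriv d w)) (adj (Ad g) y)))) (at (snd d \<one>\<^bsub>H\<^esub>))"
      by (rule has_derivative_eventually_cong, intro eventually_mono[OF adj_Ad_mult_chart[OF g]]) simp
    moreover have "\<pi> (adj (br (incl_deriv d w)) (adj (Ad g) y)) = \<pi> (adj (br (incl_deriv d w)) (\<pi> (adj (Ad g) y)))" for w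
    proof -
      have "adj (Ad g) y = \<pi> (adj (Ad g) y) + proj (adj (Ad g) y)" by (simp add: \<pi>_def)
      then have "\<pi> (adj (br (incl_deriv d w)) (adj (Ad g) y)) = \<pi> (adj (br (incl_deriv d w)) (\<pi> (adj (Ad g) y)))
          + \<pi> (adj (br (incl_deriv d w)) (proj (adj (Ad g) y)))"
        by (metis linear_add[OF \<pi>] linear_add[OF linear_adj])
      then show ?thesis by (simp add: \<pi>m adj_ad_m incl_deriv_q proj_props)
    qed
    ultimately show "((\<lambda>u. \<pi> (adj (Ad (g \<otimes>\<^bsub>H\<lparr>carrier := Q\<rparr>\<^esub> chart_inv d u)) y)) has_derivative
        (\<lambda>w. \<pi> (adj (br (incl_deriv d w)) (\<pi> (adj (Ad g) y))))) (at (snd d \<one>\<^bsub>H\<lparr>carrier := Q\<rparr>\<^esub>))"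
      by simp
  qed
  then show ?thesis using proj_props[of "adj (Ad g) y"] by (simp add: \<pi>_def)
qed

text \<open>
  Let \<open>f g = C g [y, v] - [C g y, C g v]\<close>. As \<open>C (g h) = C h C g\<close>, the derivative of \<open>h \<mapsto> f (g h)\<close> at
  the unit is \<open>a (C g [y, v]) - [a (C g y), C g v] - [C g y, a (C g v)]\<close>. The hypothesis applies to
  \<open>C g y \<in> m\<close> and turns this into \<open>a (f g)\<close>.
\<close>

lemma adj_Ad_bracket_if_infinitesimal:
  assumes inf: "\<And>x y v. x \<in> q \<Longrightarrow> y \<in> m \<Longrightarrow> adj (br x) (br y v) = br (adj (br x) y) v + br y (adj (br x) v)"
    and y: "y \<in> m" and g: "g \<in> Q"
  shows "adj (Ad g) (br y v) = br (adj (Ad g) y) (adj (Ad g) v)"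
proof -
  define f where "f g = adj (Ad g) (br y v) - br (adj (Ad g) y) (adj (Ad g) v)" for g
  have "f g = 0"
  proof (rule Q.vanish_if_equivariant_derivative[where f = f, OF Q_connected d(1) _ adj_ad_incl_bounded[OF linear_id[unfolded id_def]]])
    show "\<one>\<^bsub>H\<lparr>carrier := Q\<rparr>\<^esub> \<in> fst d" using d by simp
    have "Ad \<one>\<^bsub>H\<^esub> = (\<lambda>x. x)" using Ad_one by blast
    then show "f \<one>\<^bsub>H\<lparr>carrier := Q\<rparr>\<^esub> = 0" by (simp add: adj_id f_def)
    show "g \<in> carrier (H\<lparr>carrier := Q\<rparr>)" using g by simp
    fix g assume "g \<in> carrier (H\<lparr>carrier := Q\<rparr>)"
    then have g: "g \<in> Q" by simp
    let ?C = "adj (Ad g)"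
    have "((\<lambda>u. f (g \<otimes>\<^bsub>H\<^esub> chart_inv d u)) has_derivative (\<lambda>w. adj (br (incl_deriv d w)) (?C (br y v))
       - (br (?C y) (adj (br (incl_deriv d w)) (?C v)) + br (adj (br (incl_deriv d w)) (?C y)) (?C v)))) (at (snd d \<one>\<^bsub>H\<^esub>))"
      by (rule has_derivative_eventually_cong[OF adj_Ad_bracket_derivative], intro eventually_mono[OF adj_Ad_mult_chart[OF g]])
        (simp add: f_def)
    moreover have "adj (br (incl_deriv d w)) (?C (br y v))
       - (br (?C y) (adj (br (incl_deriv d w)) (?C v)) + br (adj (br (incl_deriv d w)) (?C y)) (?C v))
       = adj (br (incl_deriv d w)) (f g)" for w
      using inf[OF incl_deriv_q adj_Ad_m[OF y g]] by (simp add: f_def linear_diff[OF linear_adj])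
    ultimately show "((\<lambda>u. f (g \<otimes>\<^bsub>H\<lparr>carrier := Q\<rparr>\<^esub> chart_inv d u)) has_derivative
        (\<lambda>w. adj (br (incl_deriv d w)) (f g))) (at (snd d \<one>\<^bsub>H\<lparr>carrier := Q\<rparr>\<^esub>))"
      by simp
  qed
  then show ?thesis by (simp add: f_def)
qed

lemma infinitesimal_if_adj_Ad_bracket:
  assumes inv: "\<And>g. g \<in> Q \<Longrightarrow> adj (Ad g) (br y v) = br (adj (Ad g) y) (adj (Ad g) v)"
  shows "adj (br (incl_deriv d w)) (br y v) = br (adj (br (incl_deriv d w)) y) v + br y (adj (br (incl_deriv d w)) v)"
proof -
  have "((\<lambda>u. 0) has_derivative (\<lambda>w. adj (br (incl_deriv d w)) (br y v)
       - (br y (adj (br (incl_deriv d w)) v) + br (adj (br (incl_deriv d w)) y) v))) (at (snd d \<one>\<^bsub>H\<^esub>))"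
    by (rule has_derivative_eventually_cong[OF adj_Ad_bracket_derivative],
        rule eventually_mono[OF Q.eventually_chart_inv_carrier[OF d]]) (simp add: inv)
  from has_derivative_unique[OF this has_derivative_const]
  have "adj (br (incl_deriv d w)) (br y v) - (br y (adj (br (incl_deriv d w)) v) + br (adj (br (incl_deriv d w)) y) v) = 0"
    by (rule fun_cong)
  then show ?thesis by (simp add: add.commute)
qed

end

lemma admissible_iff_infinitesimal:
  "admissible H Q Ad br m q met \<longleftrightarrow>
    (\<forall>x\<in>q. \<forall>y\<in>m. \<forall>v. adj (br x) (br y v) = br (adj (br x) y) v + br y (adj (br x) v))"
proof -
  obtain d where d: "d \<in> AQ" "\<one>\<^bsub>H\<^esub> \<in> fst d"
    using Q.chart_around[of "\<one>\<^bsub>H\<^esub>"] Q_subgroup by (auto simp: subgroup.one_closed)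
  have "admissible H Q Ad br m q met \<longleftrightarrow>
    (\<forall>g\<in>Q. \<forall>x\<in>m. \<forall>v. adj (Ad g) (br x v) = br (adj (Ad g) x) (adj (Ad g) v))"
    by (rule admissible_iff_adj_bracket[OF Q_subgroup H.group_axioms])
      (simp_all add: Ad_linear QD Ad_mult Ad_one adj_Ad_m[OF d])
  also have "\<dots> \<longleftrightarrow> (\<forall>x\<in>q. \<forall>y\<in>m. \<forall>v. adj (br x) (br y v) = br (adj (br x) y) v + br y (adj (br x) v))"
  proof (intro iffI ballI allI)
    fix x y v assume inv: "\<forall>g\<in>Q. \<forall>x\<in>m. \<forall>v. adj (Ad g) (br x v) = br (adj (Ad g) x) (adj (Ad g) v)"
      and x: "x \<in> q" and y: "y \<in> m"
    obtain d' w where d': "d' \<in> AQ" "\<one>\<^bsub>H\<^esub> \<in> fst d'" "x = incl_deriv d' w"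
      using x unfolding Q_tangent[symmetric] subgroup_tangent_def incl_deriv_def by blast
    show "adj (br x) (br y v) = br (adj (br x) y) v + br y (adj (br x) v)"
      unfolding d'(3) by (rule infinitesimal_if_adj_Ad_bracket[OF d'(1,2)]) (use inv y in blast)
  next
    fix g x v assume "\<forall>x\<in>q. \<forall>y\<in>m. \<forall>v. adj (br x) (br y v) = br (adj (br x) y) v + br y (adj (br x) v)"
      and "g \<in> Q" "x \<in> m"
    then show "adj (Ad g) (br x v) = br (adj (Ad g) x) (adj (Ad g) v)"
      by (intro adj_Ad_bracket_if_infinitesimal[OF d]) auto
  qed
  finally show ?thesis .
qed

end

section \<open>The cotangent Lie algebra\<close>

lemma sharp_apply: "blinfun_apply (sharp X) Y = X \<bullet> Y"
  by (simp add: sharp_def)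

lemma sharp_sum: "sharp (\<Sum>b\<in>Basis. blinfun_apply \<xi> b *\<^sub>R b) = \<xi>"
proof (rule blinfun_eqI)
  fix Y
  have "blinfun_apply \<xi> Y = blinfun_apply \<xi> (\<Sum>b\<in>Basis. (Y \<bullet> b) *\<^sub>R b)"
    by (simp add: euclidean_representation)
  also have "\<dots> = (\<Sum>b\<in>Basis. blinfun_apply \<xi> b * (b \<bullet> Y))"
    unfolding blinfun.sum_right by (intro sum.cong refl) (simp add: blinfun.bilinear_simps inner_commute)
  finally show "blinfun_apply (sharp (\<Sum>b\<in>Basis. blinfun_apply \<xi> b *\<^sub>R b)) Y = blinfun_apply \<xi> Y"
    by (simp add: sharp_apply inner_sum_left)
qed

lemma inj_sharp: "inj sharp"
proof (rule injI)
  fix X Y :: 'a assume "sharp X = sharp Y"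
  then have "X \<bullet> Z = Y \<bullet> Z" for Z by (metis sharp_apply)
  then show "X = Y" by (simp add: euclidean_eq_iff[of X Y])
qed

lemma flat_eq: "flat \<xi> = (\<Sum>b\<in>Basis. blinfun_apply \<xi> b *\<^sub>R b)"
  using the_inv_f_f[OF inj_sharp, of "\<Sum>b\<in>Basis. blinfun_apply \<xi> b *\<^sub>R b"]
  by (simp only: sharp_sum flat_def)

lemma sharp_flat: "sharp (flat \<xi>) = \<xi>"
  by (simp add: flat_eq sharp_sum)

lemma flat_sharp: "flat (sharp X) = X"
  unfolding flat_def by (rule the_inv_f_f[OF inj_sharp])

lemma flat_inner: "flat \<xi> \<bullet> Y = blinfun_apply \<xi> Y"
  by (metis sharp_apply sharp_flat)

lemma bounded_linear_flat: "bounded_linear flat"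
  unfolding flat_eq[abs_def]
  by (intro bounded_linear_sum bounded_linear_scaleR_const
      bounded_bilinear.bounded_linear_left[OF bounded_bilinear_blinfun_apply])

lemma linear_sharp: "linear sharp"
  by (rule linearI; rule blinfun_eqI) (simp_all add: sharp_apply blinfun.bilinear_simps inner_simps)

lemma cotangent_metric_inner: "cotangent_metric x y = (fst x, flat (snd x)) \<bullet> (fst y, flat (snd y))"
  by (simp add: cotangent_metric_def case_prod_unfold)

lemma bounded_bilinear_cotangent_metric: "bounded_bilinear cotangent_metric"
proof -
  have "bounded_linear (\<lambda>x :: 'a cotangent. (fst x, flat (snd x)))"
    by (intro bounded_linear_Pair bounded_linear_fst bounded_linear_compose[OF bounded_linear_flat bounded_linear_snd])
  from bounded_bilinear.comp[OF bounded_bilinear_inner this this]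
  show ?thesis unfolding cotangent_metric_inner[abs_def] .
qed

lemma bounded_bilinear_imp_bilinear:
  assumes "bounded_bilinear f" shows "bilinear f"
  unfolding bilinear_def
  by (intro conjI allI bounded_linear.linear bounded_bilinear.bounded_linear_left[OF assms]
      bounded_bilinear.bounded_linear_right[OF assms])

definition cotangent_basis :: "'a::euclidean_space cotangent set" where
  "cotangent_basis = (\<lambda>b. (b, 0)) ` Basis \<union> (\<lambda>b. (0, sharp b)) ` Basis"

lemma flat_zero: "flat 0 = 0"
  using linear_0[OF bounded_linear.linear[OF bounded_linear_flat]] .

lemma cotangent_basis: "orthonormal_basis cotangent_metric UNIV (cotangent_basis :: 'a::euclidean_space cotangent set)"
  unfolding orthonormal_basis_def
proof (intro conjI ballI)
  show "finite cotangent_basis" by (simp add: cotangent_basis_def)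
  show "span cotangent_basis = (UNIV :: 'a cotangent set)"
  proof (intro equalityI subset_UNIV subsetI)
    fix x :: "'a cotangent"
    have fst_sum: "fst (\<Sum>b\<in>B. f b) = (\<Sum>b\<in>B. fst (f b))" and snd_sum: "snd (\<Sum>b\<in>B. f b) = (\<Sum>b\<in>B. snd (f b))"
      for B :: "'a set" and f :: "'a \<Rightarrow> 'a cotangent"
      by (induction B rule: infinite_finite_induct) simp_all
    have "(\<Sum>b\<in>Basis. (flat (snd x) \<bullet> b) *\<^sub>R sharp b) = sharp (\<Sum>b\<in>Basis. (flat (snd x) \<bullet> b) *\<^sub>R b)"
      by (simp add: linear_sum[OF linear_sharp] linear_scale[OF linear_sharp])
    then have "x = (\<Sum>b\<in>Basis. (fst x \<bullet> b) *\<^sub>R (b, 0)) + (\<Sum>b\<in>Basis. (flat (snd x) \<bullet> b) *\<^sub>R (0, sharp b))"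
      by (intro prod_eqI) (simp_all add: fst_sum snd_sum euclidean_representation sharp_flat)
    moreover have "\<dots> \<in> span cotangent_basis"
      by (intro span_add span_sum span_scale span_base) (auto simp: cotangent_basis_def)
    ultimately show "x \<in> span cotangent_basis" by simp
  qed
  fix x y :: "'a cotangent" assume "x \<in> cotangent_basis" "y \<in> cotangent_basis"
  then show "cotangent_metric x y = (if x = y then 1 else 0)"
    using inj_sharp[THEN injD] linear_0[OF linear_sharp]
    by (auto simp: cotangent_basis_def cotangent_metric_inner flat_sharp flat_zero inner_Basis split: if_splits)
qed simp

lemma coadjoint_apply:
  assumes "bilinear br"
  shows "blinfun_apply (coadjoint br X \<alpha>) Y = - blinfun_apply \<alpha> (br X Y)"
proof -
  have "bounded_linear (br X)"
    using assms by (simp add: bilinear_def linear_conv_bounded_linear)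
  then have "bounded_linear (\<lambda>Y. - blinfun_apply \<alpha> (br X Y))"
    by (intro bounded_linear_minus bounded_linear_compose[OF blinfun.bounded_linear_right])
  then show ?thesis by (simp add: coadjoint_def bounded_linear_Blinfun_apply)
qed

lemma cotangent_bracket_bilinear:
  assumes "bilinear br"
  shows "bilinear (cotangent_bracket br)"
  unfolding bilinear_def
  by (intro conjI allI linearI prod_eqI blinfun_eqI)
    (simp_all add: cotangent_bracket_def case_prod_unfold coadjoint_apply[OF assms] blinfun.bilinear_simps
      bilinear_ladd[OF assms] bilinear_radd[OF assms] bilinear_lmul[OF assms] bilinear_rmul[OF assms] algebra_simps)

lemma lie_algebra_antisym:
  assumes "lie_algebra br"
  shows "br y x = - br x y"
proof -
  have b: "bilinear br" and z: "\<And>x. br x x = 0" using assms by (simp_all add: lie_algebra_def)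
  have "br y x + br x y = 0"
    using z[of "x + y"] z[of x] z[of y] by (simp add: bilinear_ladd[OF b] bilinear_radd[OF b] add.commute)
  then show ?thesis by (rule eq_neg_iff_add_eq_0[THEN iffD2])
qed

text \<open>
  \<open>\<langle>x, \<theta> y\<rangle>\<close> is the canonical pairing \<open>(X, \<xi>), (Y, \<eta>) \<mapsto> \<xi> Y + \<eta> X\<close> of \<open>\<gg> \<oplus> \<gg>\<^sup>*\<close>, for which
  \<open>ad x\<close> is skew; conjugation by the involution \<open>\<theta>\<close> turns skewness into this formula for the adjoint.
\<close>

lemma cotangent_metric_ad_theta:
  assumes "lie_algebra br"
  shows "cotangent_metric (- theta (cotangent_bracket br x (theta v))) u = cotangent_metric v (cotangent_bracket br x u)"
proof -
  have b: "bilinear br" using assms by (simp add: lie_algebra_def)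
  obtain X \<xi> U \<mu> V \<nu> where "x = (X, \<xi>)" "u = (U, \<mu>)" "v = (V, \<nu>)" by (metis surj_pair)
  moreover have "Y \<bullet> flat \<alpha> = blinfun_apply \<alpha> Y" for Y :: 'a and \<alpha>
    by (simp add: flat_inner[symmetric] inner_commute)
  ultimately show ?thesis
    using lie_algebra_antisym[OF assms, of "flat \<nu>" U]
    by (simp add: cotangent_metric_def theta_def cotangent_bracket_def flat_inner[of _ U] coadjoint_apply[OF b]
      linear_neg[OF bounded_linear.linear[OF bounded_linear_flat]] flat_sharp
      blinfun.bilinear_simps sharp_apply)
qed

section \<open>The gradation\<close>

lemma neg_part_bracket:
  assumes b: "bilinear br" and g: "gradation br \<gg> k" and x: "x \<in> neg_part \<gg>" and y: "y \<in> neg_part \<gg>"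
  shows "br x y \<in> neg_part \<gg>"
proof -
  have lin: "linear (br u)" "linear (\<lambda>u. br u v)" for u v using b by (simp_all add: bilinear_def)
  have hom: "br u v \<in> neg_part \<gg>" if "i < 0" "u \<in> \<gg> i" "j < 0" "v \<in> \<gg> j" for i j u v
  proof -
    have "br u v \<in> \<gg> (i + j)" using g that by (simp add: gradation_def)
    then show ?thesis unfolding neg_part_def by (intro span_base UN_I[of "i + j"]) (use that in auto)
  qed
  have "br u y \<in> neg_part \<gg>" if "i < 0" "u \<in> \<gg> i" for i u
  proof -
    have "subspace {v. br u v \<in> neg_part \<gg>}"
      using linear_subspace_vimage[OF lin(1)[of u] subspace_span[of "\<Union>i\<in>{..<0}. \<gg> i"]] by (simp add: neg_part_def vimage_def)
    then show ?thesis
      using y span_minimal[of "\<Union>i\<in>{..<0}. \<gg> i" "{v. br u v \<in> neg_part \<gg>}"] hom that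
      unfolding neg_part_def by blast
  qed
  moreover have "subspace {u. br u y \<in> neg_part \<gg>}"
    using linear_subspace_vimage[OF lin(2)[of y] subspace_span[of "\<Union>i\<in>{..<0}. \<gg> i"]] by (simp add: neg_part_def vimage_def)
  ultimately show ?thesis
    using x span_minimal[of "\<Union>i\<in>{..<0}. \<gg> i" "{u. br u y \<in> neg_part \<gg>}"] unfolding neg_part_def by blast
qed

lemma neg_part_orthogonal:
  assumes "adapted_metric \<gg>" "x \<in> neg_part \<gg>" "y \<in> \<gg> 0"
  shows "x \<bullet> y = 0"
proof -
  have "subspace {x. x \<bullet> y = 0}" by (simp add: subspace_def inner_simps)
  moreover have "(\<Union>i\<in>{..<0}. \<gg> i) \<subseteq> {x. x \<bullet> y = 0}"
  proof
    fix z assume "z \<in> (\<Union>i\<in>{..<0}. \<gg> i)"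
    then obtain i where "i < 0" "z \<in> \<gg> i" by auto
    then show "z \<in> {x. x \<bullet> y = 0}"
      using assms(1)[unfolded adapted_metric_def, rule_format, of i 0 z y] assms(3) by simp
  qed
  ultimately show ?thesis using assms(2) span_minimal unfolding neg_part_def by blast
qed

lemma gradation_split:
  assumes "gradation br \<gg> k" "k > 0"
  shows "\<exists>y\<in>neg_part \<gg>. x - y \<in> \<gg> 0"
proof -
  have "\<forall>x. \<exists>!f. (\<forall>i. f i \<in> \<gg> i) \<and> x = (\<Sum>i\<in>{- k..0}. f i)"
    using assms(1) unfolding gradation_def by (elim conjE)
  from ex1_implies_ex[OF spec[OF this, of x]]
  obtain f where f: "\<And>i. f i \<in> \<gg> i" "x = (\<Sum>i\<in>{- k..0}. f i)" by blast
  have "{- k..0} = insert 0 {- k..<0}" using assms(2) by auto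
  then have x: "x = f 0 + (\<Sum>i\<in>{- k..<0}. f i)" using f(2) by simp
  have "(\<Sum>i\<in>{- k..<0}. f i) \<in> neg_part \<gg>"
    unfolding neg_part_def by (intro span_sum span_base) (use f(1) in auto)
  then show ?thesis using x f(1)[of 0] by (intro bexI[of _ "\<Sum>i\<in>{- k..<0}. f i"]) simp_all
qed

lemma cotangent_normed_metric_algebra:
  assumes lie: "lie_algebra br" and fund: "fundamental_gradation br \<gg> k" and adapted: "adapted_metric \<gg>"
  shows "normed_metric_algebra cotangent_metric cotangent_basis (cotangent_bracket br) (cotangent_neg \<gg>) (cotangent_q \<gg>)"
proof -
  have b: "bilinear br" using lie by (simp add: lie_algebra_def)
  have g: "gradation br \<gg> k" "k > 0" using fund by (simp_all add: fundamental_gradation_def)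
  have g0: "subspace (\<gg> 0)" "\<And>x y. x \<in> \<gg> 0 \<Longrightarrow> y \<in> \<gg> 0 \<Longrightarrow> br x y \<in> \<gg> 0"
    using g(1) unfolding gradation_def by (metis, metis add_0)
  have neg: "subspace (neg_part \<gg>)" by (simp add: neg_part_def)
  show ?thesis
  proof (intro normed_metric_algebra.intro split_metric_algebra.intro finite_metric.intro
      split_metric_algebra_axioms.intro normed_metric_algebra_axioms.intro)
    show "bilinear cotangent_metric" by (intro bounded_bilinear_imp_bilinear bounded_bilinear_cotangent_metric)
    show "cotangent_metric x y = cotangent_metric y x" for x y :: "'a cotangent"
      by (simp add: cotangent_metric_inner inner_commute)
    show "orthonormal_basis cotangent_metric UNIV cotangent_basis" by (rule cotangent_basis)
    show "bilinear (cotangent_bracket br)" by (rule cotangent_bracket_bilinear[OF b])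
    show "subspace (cotangent_neg \<gg>)" "subspace (cotangent_q \<gg>)"
      using g0(1) neg by (simp_all add: cotangent_neg_def cotangent_q_def subspace_Times)
    show "cotangent_bracket br x y \<in> cotangent_neg \<gg>" if "x \<in> cotangent_neg \<gg>" "y \<in> cotangent_neg \<gg>" for x y
    proof -
      have "coadjoint br X 0 = 0" for X by (rule blinfun_eqI) (simp add: coadjoint_apply[OF b])
      then show ?thesis
        using that neg_part_bracket[OF b g(1)] by (auto simp: cotangent_neg_def cotangent_bracket_def)
    qed
    show "cotangent_metric x y = 0" if "x \<in> cotangent_neg \<gg>" "y \<in> cotangent_q \<gg>" for x y
      using that neg_part_orthogonal[OF adapted]
      by (auto simp: cotangent_neg_def cotangent_q_def cotangent_metric_inner flat_zero)
    show "\<exists>y\<in>cotangent_neg \<gg>. x - y \<in> cotangent_q \<gg>" for x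
    proof -
      obtain y where "y \<in> neg_part \<gg>" "fst x - y \<in> \<gg> 0" using gradation_split[OF g] by blast
      then show ?thesis by (intro bexI[of _ "(y, 0)"]) (auto simp: cotangent_neg_def cotangent_q_def mem_Times_iff)
    qed
    show "\<exists>B. orthonormal_basis cotangent_metric (cotangent_neg \<gg>) B"
    proof -
      obtain B0 where B0: "B0 \<subseteq> neg_part \<gg>" "pairwise orthogonal B0" "\<And>x. x \<in> B0 \<Longrightarrow> norm x = 1"
        "independent B0" "span B0 = neg_part \<gg>"
        using orthonormal_basis_subspace[OF neg] by metis
      have lin: "linear (\<lambda>x :: 'a. (x, 0 :: 'a \<Rightarrow>\<^sub>L real))" by (rule linearI) simp_all
      have "span ((\<lambda>x. (x, 0)) ` B0) = cotangent_neg \<gg>"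
        unfolding linear_span_image[OF lin] B0(5) by (auto simp: cotangent_neg_def)
      moreover have "x \<bullet> y = (if x = y then 1 else 0)" if "x \<in> B0" "y \<in> B0" for x y
        using B0(2) B0(3)[OF that(1)] that unfolding pairwise_def orthogonal_def by (auto simp: norm_eq_1)
      ultimately have "orthonormal_basis cotangent_metric (cotangent_neg \<gg>) ((\<lambda>x. (x, 0)) ` B0)"
        using B0(1) independent_imp_finite[OF B0(4)]
        by (auto simp: orthonormal_basis_def cotangent_neg_def cotangent_metric_inner flat_zero)
      then show ?thesis by blast
    qed
    show "bounded_bilinear (cotangent_metric :: 'a cotangent \<Rightarrow> _)" by (rule bounded_bilinear_cotangent_metric)
    show "cotangent_bracket br x y \<in> cotangent_q \<gg>" if "x \<in> cotangent_q \<gg>" "y \<in> cotangent_q \<gg>" for x y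
      using that g0(2) by (auto simp: cotangent_q_def cotangent_bracket_def)
  qed
qed

text \<open>
  \<open>\<theta> Y\<close> lies in \<open>\<gg>\<^sup>*\<close>, which is an abelian ideal, so \<open>\<xi>\<close> brackets to zero with it.
\<close>

lemma cotangent_bracket_theta_neg:
  assumes "bilinear br"
  shows "cotangent_bracket br (X, \<xi>) (theta (Y, 0)) = cotangent_bracket br (X, 0) (theta (Y, 0))"
proof -
  have "coadjoint br 0 \<zeta> = 0" for \<zeta>
    by (rule blinfun_eqI) (simp add: coadjoint_apply[OF assms] bilinear_lzero[OF assms] blinfun.bilinear_simps)
  then show ?thesis by (simp add: theta_def cotangent_bracket_def flat_zero)
qed

theorem proposition10:
  fixes br :: "'a::euclidean_space \<Rightarrow> 'a \<Rightarrow> 'a"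
    and \<gg> :: "int \<Rightarrow> 'a set"
    and k :: int
    and H :: "'g monoid"
    and T :: "'g topology"
    and A :: "('g, 'e::euclidean_space) chart set"
    and c :: "('g, 'e) chart"
    and L :: "'e \<Rightarrow> 'a cotangent"
    and Q :: "'g set"
    and TQ :: "'g topology"
    and AQ :: "('g, 'f::euclidean_space) chart set"
  assumes "lie_algebra br"
    and "fundamental_gradation br \<gg> k"
    and "adapted_metric \<gg>"
    and "lie_group H T A" and "connected_space T"
    and "c \<in> A" and "\<one>\<^bsub>H\<^esub> \<in> fst c"
    and "lie_algebra_identification H c (cotangent_bracket br) L"
    and "lie_subgroup H T A Q TQ AQ" and "connected_space TQ"
    and "L ` subgroup_tangent H c AQ = cotangent_q \<gg>"
  shows "admissible H Q (Ad_rep H c L) (cotangent_bracket br)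
            (cotangent_neg \<gg>) (cotangent_q \<gg>) cotangent_metric
    \<longleftrightarrow>
    (\<forall>X\<in>\<gg> 0. \<forall>\<xi>. \<forall>Y\<in>neg_part \<gg>. \<forall>Z \<alpha>.
       theta (cotangent_bracket br (X, \<xi>) (theta (cotangent_bracket br (Y, 0) (Z, \<alpha>))))
       = cotangent_bracket br (theta (cotangent_bracket br (X, 0) (theta (Y, 0)))) (Z, \<alpha>)
         + cotangent_bracket br (Y, 0) (theta (cotangent_bracket br (X, \<xi>) (theta (Z, \<alpha>)))))"
proof -
  let ?br = "cotangent_bracket br"
  let ?ad = "\<lambda>x v. theta (?br x (theta v))"
  have b: "bilinear br" using assms(1) by (simp add: lie_algebra_def)
  interpret normed_metric_algebra cotangent_metric cotangent_basis ?br "cotangent_neg \<gg>" "cotangent_q \<gg>"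
    by (rule cotangent_normed_metric_algebra[OF assms(1-3)])
  interpret metric_algebra_of_lie_group cotangent_metric cotangent_basis ?br "cotangent_neg \<gg>" "cotangent_q \<gg>"
      H T A c L Q TQ AQ
    by (intro metric_algebra_of_lie_group.intro metric_algebra_of_lie_group_axioms.intro
        normed_metric_algebra_axioms assms)
  have adj: "adj (?br x) v = - ?ad x v" for x v
    by (rule adj_eqI[OF br_linear cotangent_metric_ad_theta[OF assms(1)]])
  have "(adj (?br x) (?br y v) = ?br (adj (?br x) y) v + ?br y (adj (?br x) v))
      \<longleftrightarrow> (?ad x (?br y v) = ?br (?ad x y) v + ?br y (?ad x v))" for x y v
    unfolding adj bilinear_lneg[OF br_bilinear] bilinear_rneg[OF br_bilinear] minus_add_distrib[symmetric]
    by (rule neg_equal_iff_equal)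
  then have "admissible H Q (Ad_rep H c L) ?br (cotangent_neg \<gg>) (cotangent_q \<gg>) cotangent_metric \<longleftrightarrow>
      (\<forall>x\<in>cotangent_q \<gg>. \<forall>y\<in>cotangent_neg \<gg>. \<forall>v. ?ad x (?br y v) = ?br (?ad x y) v + ?br y (?ad x v))"
    unfolding admissible_iff_infinitesimal by simp
  also have "\<dots> \<longleftrightarrow> (\<forall>X\<in>\<gg> 0. \<forall>\<xi>. \<forall>Y\<in>neg_part \<gg>. \<forall>Z \<alpha>.
       ?ad (X, \<xi>) (?br (Y, 0) (Z, \<alpha>)) = ?br (?ad (X, \<xi>) (Y, 0)) (Z, \<alpha>) + ?br (Y, 0) (?ad (X, \<xi>) (Z, \<alpha>)))"
    unfolding cotangent_q_def cotangent_neg_def by (simp only: Ball_def split_paired_All mem_Times_iff fst_conv snd_conv) auto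
  also have "\<dots> \<longleftrightarrow> (\<forall>X\<in>\<gg> 0. \<forall>\<xi>. \<forall>Y\<in>neg_part \<gg>. \<forall>Z \<alpha>.
       ?ad (X, \<xi>) (?br (Y, 0) (Z, \<alpha>)) = ?br (?ad (X, 0) (Y, 0)) (Z, \<alpha>) + ?br (Y, 0) (?ad (X, \<xi>) (Z, \<alpha>)))"
  proof (intro ball_cong all_cong1 refl)
    fix X \<xi> Y Z \<alpha>
    have "?br (X, \<xi>) (theta (Y, 0)) = ?br (X, 0) (theta (Y, 0))"
      by (rule cotangent_bracket_theta_neg[OF b])
    then show "(?ad (X, \<xi>) (?br (Y, 0) (Z, \<alpha>)) = ?br (?ad (X, \<xi>) (Y, 0)) (Z, \<alpha>) + ?br (Y, 0) (?ad (X, \<xi>) (Z, \<alpha>)))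
      \<longleftrightarrow> (?ad (X, \<xi>) (?br (Y, 0) (Z, \<alpha>)) = ?br (?ad (X, 0) (Y, 0)) (Z, \<alpha>) + ?br (Y, 0) (?ad (X, \<xi>) (Z, \<alpha>)))"
      by (simp only:)
  qed
  finally show ?thesis .
qed

end
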